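(* Let $C$ be an algebraically closed field of characteristic zero, let $t=(t_1,\dots,t_l)$ be differential indeterminates over $C$, and let $A(t)\in C\langle t\rangle^{n\times n}$. Let $R_1$ be a localization of $C\{t\}$ by a finitely generated multiplicative subset of $C\{t\}$ such that $A(t)\in R_1^{n\times n}$. Let $G(C)$ be the differential Galois group of $\partial(y)=A(t)y$ over $C\langle t\rangle$. Let $\sigma: C\{t\}\to C[z]$, $t\mapsto \sigma(t)=(r_1,\dots,r_l)\in C[z]^l$, be a differential $C$-algebra homomorphism such that it extends to a differential homomorphism $\sigma:R_1\to R_2$, where $R_2$ is the localization of $C[z]$ by the image under $\sigma$ of the multiplicative subset defining $R_1$ (so the generators of this multiplicative subset do not vanish under $\sigma$). Then the differential Galois group $H(C)$ of the specialized equation $\partial(y)=A(\sigma(t))y$ over $C(z)$ is a subgroup of $G(C)$.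
   Context: $C\{t\}=C\{t_1,\dots,t_l\}$ is the differential polynomial ring over $C$ (elements of $C$ are constants) and $C\langle t\rangle=C\langle t_1,\dots,t_l\rangle$ is its field of fractions, a differential field with field of constants $C$. The rings $C[z]\subset C(z)$ carry the derivation $\frac{d}{dz}$. $A(\sigma(t))$ denotes the matrix obtained by applying $\sigma$ to the entries of $A(t)$. The differential Galois group of a linear differential equation $\partial(y)=Ay$ of size $n$ over a differential field $F$ with field of constants $C$ is the group of differential $F$-automorphisms of a Picard-Vessiot ring of the equation over $F$; it is identified with a Zariski closed subgroup of $\mathrm{GL}_n(C)$ through its action $\gamma(Z)=ZM_\gamma$ on a fundamental solution matrix $Z$. This subgroup is determined up to conjugation in $\mathrm{GL}_n(C)$, depending on the choice of the fundamental matrix; the inclusion $H(C)\subseteq G(C)$ is meant for suitable choices of the fundamental matrices. *)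

theory Defs
  imports
    "HOL-Analysis.Determinants"
    "HOL-Computational_Algebra.Polynomial_Factorial"
    "HOL-Library.Poly_Mapping"
    "HOL-Library.Countable"
begin

section \<open>Differential rings\<close>

definition derivation :: "('a::comm_ring_1 \<Rightarrow> 'a) \<Rightarrow> bool" where
  "derivation d \<longleftrightarrow>
     (\<forall>x y. d (x + y) = d x + d y) \<and> (\<forall>x y. d (x * y) = d x * y + x * d y)"

definition diff_ring_hom_on ::
  "'a::comm_ring_1 set \<Rightarrow> ('a \<Rightarrow> 'a) \<Rightarrow> ('b::comm_ring_1 \<Rightarrow> 'b) \<Rightarrow> ('a \<Rightarrow> 'b) \<Rightarrow> bool" where
  "diff_ring_hom_on R d d' f \<longleftrightarrow>
     f 1 = 1 \<and>
     (\<forall>x\<in>R. \<forall>y\<in>R. f (x + y) = f x + f y) \<and>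
     (\<forall>x\<in>R. \<forall>y\<in>R. f (x * y) = f x * f y) \<and>
     (\<forall>x\<in>R. f (d x) = d' (f x))"

definition differential_ideal :: "('a::comm_ring_1 \<Rightarrow> 'a) \<Rightarrow> 'a set \<Rightarrow> bool" where
  "differential_ideal d I \<longleftrightarrow>
     0 \<in> I \<and> (\<forall>x\<in>I. \<forall>y\<in>I. x + y \<in> I) \<and> (\<forall>r. \<forall>x\<in>I. r * x \<in> I) \<and> (\<forall>x\<in>I. d x \<in> I)"

definition diff_simple :: "('a::comm_ring_1 \<Rightarrow> 'a) \<Rightarrow> bool" where
  "diff_simple d \<longleftrightarrow> (\<forall>I. differential_ideal d I \<longrightarrow> I = {0} \<or> I = UNIV)"

inductive_set generated_subring :: "'a::comm_ring_1 set \<Rightarrow> 'a set" for X where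
  gen: "x \<in> X \<Longrightarrow> x \<in> generated_subring X"
| one: "1 \<in> generated_subring X"
| neg: "x \<in> generated_subring X \<Longrightarrow> - x \<in> generated_subring X"
| add: "\<lbrakk>x \<in> generated_subring X; y \<in> generated_subring X\<rbrakk> \<Longrightarrow> x + y \<in> generated_subring X"
| mult: "\<lbrakk>x \<in> generated_subring X; y \<in> generated_subring X\<rbrakk> \<Longrightarrow> x * y \<in> generated_subring X"


section \<open>Localizations and fraction fields\<close>

inductive_set mult_generated :: "'a::comm_ring_1 set \<Rightarrow> 'a set" for X where
  one: "1 \<in> mult_generated X"
| mult: "\<lbrakk>x \<in> X; y \<in> mult_generated X\<rbrakk> \<Longrightarrow> x * y \<in> mult_generated X"

text \<open>Localizations of an integral domain are formed inside its fraction field; this is meant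
  for multiplicative subsets that do not contain zero.\<close>

definition localization :: "'a::idom set \<Rightarrow> 'a fract set" where
  "localization M = {Fract p s | p s. s \<in> M}"

text \<open>The quotient rule. For a derivation the result does not depend on the chosen
  representative, see \<open>fract_deriv_Fract\<close>.\<close>

definition fract_deriv :: "('a::idom \<Rightarrow> 'a) \<Rightarrow> 'a fract \<Rightarrow> 'a fract" where
  "fract_deriv d x =
     (let (a, b) = (SOME (a, b). b \<noteq> 0 \<and> x = Fract a b)
      in Fract (d a * b - a * d b) (b * b))"

lemma fract_deriv_Fract:
  fixes d :: "'a::idom \<Rightarrow> 'a"
  assumes d: "derivation d" and b: "b \<noteq> 0"
  shows "fract_deriv d (Fract a b) = Fract (d a * b - a * d b) (b * b)"
proof -
  define P where "P = (\<lambda>(a', b'). b' \<noteq> 0 \<and> Fract a b = Fract a' b')"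
  obtain u v where uv: "Eps P = (u, v)" by fastforce
  have "P (a, b)" using b by (simp add: P_def)
  then have "P (u, v)" by (metis uv someI)
  then have v: "v \<noteq> 0" and "Fract a b = Fract u v" by (simp_all add: P_def)
  then have e: "a * v = u * b" using b by (simp add: eq_fract)
  have "d (a * v) = d (u * b)" using e by simp
  then have e': "d a * v + a * d v = d u * b + u * d b"
    using d by (simp add: derivation_def)
  have "(d u * v - u * d v) * (b * b) = (d u * b) * (v * b) - (u * b) * (d v * b)"
    by (simp add: algebra_simps)
  also have "d u * b = d a * v + a * d v - u * d b" using e' by simp
  also have "(d a * v + a * d v - u * d b) * (v * b) - (u * b) * (d v * b)
      = (d a * v + a * d v) * (v * b) - (u * b) * (d b * v + d v * b)"
    by (simp add: algebra_simps)
  also have "\<dots> = (d a * v + a * d v) * (v * b) - (a * v) * (d b * v + d v * b)"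
    by (simp add: e)
  also have "\<dots> = (d a * b - a * d b) * (v * v)"
    by (simp add: algebra_simps)
  finally have "Fract (d u * v - u * d v) (v * v) = Fract (d a * b - a * d b) (b * b)"
    using v b by (simp add: eq_fract)
  then show ?thesis
    using uv by (simp add: fract_deriv_def P_def)
qed


section \<open>The differential polynomial ring\<close>

text \<open>\<open>Dvar i j\<close> is the \<open>j\<close>-th derivative of the indeterminate \<open>t\<^sub>i\<close>.\<close>

datatype 'l dvar = Dvar (indet: 'l) (dord: nat)

text \<open>The order on the variables has no mathematical meaning; \<open>Poly_Mapping\<close> needs one
  in order to provide the \<open>idom\<close> instance of polynomial rings.\<close>

instantiation dvar :: (countable) linorder
begin

definition less_eq_dvar :: "'a dvar \<Rightarrow> 'a dvar \<Rightarrow> bool" where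
  "x \<le> y \<longleftrightarrow> to_nat (indet x) < to_nat (indet y) \<or> indet x = indet y \<and> dord x \<le> dord y"

definition less_dvar :: "'a dvar \<Rightarrow> 'a dvar \<Rightarrow> bool" where
  "x < y \<longleftrightarrow> to_nat (indet x) < to_nat (indet y) \<or> indet x = indet y \<and> dord x < dord y"

instance
proof
  fix x y z :: "'a dvar"
  show "x < y \<longleftrightarrow> x \<le> y \<and> \<not> y \<le> x"
    by (auto simp: less_eq_dvar_def less_dvar_def)
  show "x \<le> x"
    by (simp add: less_eq_dvar_def)
  show "x \<le> z" if "x \<le> y" "y \<le> z"
    using that by (auto simp: less_eq_dvar_def)
  show "x = y" if "x \<le> y" "y \<le> x"
    using that by (auto simp: less_eq_dvar_def intro: dvar.expand)
  show "x \<le> y \<or> y \<le> x"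
    by (metis less_eq_dvar_def linorder_neqE_nat linorder_linear to_nat_split)
qed

end

text \<open>Polynomials with coefficients in \<open>'c\<close> in the variables \<open>t\<^sub>i\<^sup>(\<^sup>j\<^sup>)\<close>, for \<open>i\<close> in \<open>'l\<close>
  and \<open>j\<close> in the natural numbers.\<close>

type_synonym ('l, 'c) dpoly = "('l dvar \<Rightarrow>\<^sub>0 nat) \<Rightarrow>\<^sub>0 'c"

definition dpoly_const :: "'c \<Rightarrow> ('l, 'c::zero) dpoly" where
  "dpoly_const c = Poly_Mapping.single 0 c"

definition dpoly_var :: "'l \<Rightarrow> nat \<Rightarrow> ('l, 'c::zero_neq_one) dpoly" where
  "dpoly_var i j = Poly_Mapping.single (Poly_Mapping.single (Dvar i j) 1) 1"

definition dvar_succ :: "'l dvar \<Rightarrow> 'l dvar" where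
  "dvar_succ v = Dvar (indet v) (Suc (dord v))"

definition monom_deriv :: "('l dvar \<Rightarrow>\<^sub>0 nat) \<Rightarrow> ('l, 'c::comm_ring_1) dpoly" where
  "monom_deriv m =
     (\<Sum>v\<in>Poly_Mapping.keys m.
        Poly_Mapping.single
          (m - Poly_Mapping.single v 1 + Poly_Mapping.single (dvar_succ v) 1)
          (of_nat (Poly_Mapping.lookup m v)))"

definition dpoly_deriv :: "('l, 'c::comm_ring_1) dpoly \<Rightarrow> ('l, 'c) dpoly" where
  "dpoly_deriv p =
     (\<Sum>m\<in>Poly_Mapping.keys p. dpoly_const (Poly_Mapping.lookup p m) * monom_deriv m)"

lemma dpoly_deriv_const: "dpoly_deriv (dpoly_const c) = 0"
  by (simp add: dpoly_deriv_def dpoly_const_def monom_deriv_def)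

lemma dpoly_deriv_var: "dpoly_deriv (dpoly_var i j) = dpoly_var i (Suc j)"
  by (simp add: dpoly_deriv_def dpoly_const_def dpoly_var_def monom_deriv_def dvar_succ_def
      mult_single)

lemma monom_deriv_superset:
  assumes "finite V" "Poly_Mapping.keys m \<subseteq> V"
  shows "monom_deriv m =
     (\<Sum>v\<in>V. Poly_Mapping.single
          (m - Poly_Mapping.single v 1 + Poly_Mapping.single (dvar_succ v) 1)
          (of_nat (Poly_Mapping.lookup m v)))"
  unfolding monom_deriv_def using assms
  by (intro sum.mono_neutral_left) (auto simp: in_keys_iff)

lemma monom_shift:
  fixes m n :: "'a \<Rightarrow>\<^sub>0 nat"
  assumes "Poly_Mapping.lookup m v \<noteq> 0"
  shows "m + n - Poly_Mapping.single v 1 = m - Poly_Mapping.single v 1 + n"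
  using assms
  by (intro poly_mapping_eqI) (auto simp: lookup_add lookup_minus lookup_single when_def)

lemma monom_deriv_add:
  "(monom_deriv (m + n) :: ('l, 'c::comm_ring_1) dpoly) =
     monom_deriv m * Poly_Mapping.single n 1 + Poly_Mapping.single m 1 * monom_deriv n"
proof -
  define V where "V = Poly_Mapping.keys m \<union> Poly_Mapping.keys n"
  have V: "finite V" "Poly_Mapping.keys m \<subseteq> V" "Poly_Mapping.keys n \<subseteq> V"
    "Poly_Mapping.keys (m + n) \<subseteq> V"
    using keys_add[of m n] by (auto simp: V_def)
  let ?s = "\<lambda>m v. Poly_Mapping.single
          (m - Poly_Mapping.single v 1 + Poly_Mapping.single (dvar_succ v) 1)
          (of_nat (Poly_Mapping.lookup m v)) :: ('l, 'c) dpoly"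
  have "?s (m + n) v = ?s m v * Poly_Mapping.single n 1 + Poly_Mapping.single m 1 * ?s n v" for v
  proof -
    let ?e = "Poly_Mapping.single v 1 :: _ \<Rightarrow>\<^sub>0 nat"
    let ?f = "Poly_Mapping.single (dvar_succ v) 1 :: _ \<Rightarrow>\<^sub>0 nat"
    have "?s m v * Poly_Mapping.single n 1 =
        Poly_Mapping.single (m + n - ?e + ?f) (of_nat (Poly_Mapping.lookup m v))"
      using monom_shift[of m v n]
      by (cases "Poly_Mapping.lookup m v = 0") (simp_all add: mult_single ac_simps)
    moreover have "Poly_Mapping.single m 1 * ?s n v =
        Poly_Mapping.single (m + n - ?e + ?f) (of_nat (Poly_Mapping.lookup n v))"
      using monom_shift[of n v m]
      by (cases "Poly_Mapping.lookup n v = 0") (simp_all add: mult_single ac_simps)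
    ultimately show ?thesis
      by (simp add: lookup_add single_add)
  qed
  then show ?thesis
    by (simp add: monom_deriv_superset[OF V(1,2)] monom_deriv_superset[OF V(1,3)]
        monom_deriv_superset[OF V(1,4)] sum.distrib sum_distrib_left sum_distrib_right)
qed

lemma dpoly_deriv_superset:
  assumes "finite M" "Poly_Mapping.keys p \<subseteq> M"
  shows "dpoly_deriv p = (\<Sum>m\<in>M. dpoly_const (Poly_Mapping.lookup p m) * monom_deriv m)"
  unfolding dpoly_deriv_def using assms
  by (intro sum.mono_neutral_left) (auto simp: in_keys_iff dpoly_const_def)

lemma dpoly_deriv_add: "dpoly_deriv (p + q) = dpoly_deriv p + dpoly_deriv q"
proof -
  define M where "M = Poly_Mapping.keys p \<union> Poly_Mapping.keys q"
  have M: "finite M" "Poly_Mapping.keys p \<subseteq> M" "Poly_Mapping.keys q \<subseteq> M"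
    "Poly_Mapping.keys (p + q) \<subseteq> M"
    using keys_add[of p q] by (auto simp: M_def)
  show ?thesis
    by (simp add: dpoly_deriv_superset[OF M(1,2)] dpoly_deriv_superset[OF M(1,3)]
        dpoly_deriv_superset[OF M(1,4)] lookup_add dpoly_const_def single_add
        distrib_right sum.distrib)
qed

lemma dpoly_deriv_single:
  "dpoly_deriv (Poly_Mapping.single m c) = dpoly_const c * monom_deriv m"
  by (cases "c = 0") (simp_all add: dpoly_deriv_def dpoly_const_def)

lemma dpoly_deriv_sum: "dpoly_deriv (\<Sum>x\<in>X. f x) = (\<Sum>x\<in>X. dpoly_deriv (f x))"
proof (induction X rule: infinite_finite_induct)
  case (insert x F)
  then show ?case by (simp add: dpoly_deriv_add)
qed (simp_all add: dpoly_deriv_def)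

lemma dpoly_deriv_mult: "dpoly_deriv (p * q) = dpoly_deriv p * q + p * dpoly_deriv q"
proof -
  let ?l = "\<lambda>p m. Poly_Mapping.single m (Poly_Mapping.lookup p m)"
  let ?P = "Poly_Mapping.keys p" and ?Q = "Poly_Mapping.keys q"
  have mono: "dpoly_deriv (Poly_Mapping.single m a * Poly_Mapping.single n b) =
      dpoly_deriv (Poly_Mapping.single m a) * Poly_Mapping.single n b +
      Poly_Mapping.single m a * dpoly_deriv (Poly_Mapping.single n b)"
    for m n :: "'a dvar \<Rightarrow>\<^sub>0 nat" and a b :: 'b
  proof -
    have split: "Poly_Mapping.single m a = dpoly_const a * Poly_Mapping.single m 1"
      for m :: "'a dvar \<Rightarrow>\<^sub>0 nat" and a :: 'b
      by (simp add: dpoly_const_def mult_single)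
    have const: "(dpoly_const (a * b) :: ('a, 'b) dpoly) = dpoly_const a * dpoly_const b"
      by (simp add: dpoly_const_def mult_single)
    show ?thesis
      unfolding mult_single dpoly_deriv_single
      by (simp add: monom_deriv_add const split[of m a] split[of n b] algebra_simps)
  qed
  have p: "(\<Sum>m\<in>?P. ?l p m) = p" and q: "(\<Sum>n\<in>?Q. ?l q n) = q"
    by (intro poly_mapping_eqI; simp add: lookup_sum lookup_single when_def in_keys_iff)+
  have "dpoly_deriv ((\<Sum>m\<in>?P. ?l p m) * (\<Sum>n\<in>?Q. ?l q n)) =
      (\<Sum>m\<in>?P. \<Sum>n\<in>?Q. dpoly_deriv (?l p m) * ?l q n + ?l p m * dpoly_deriv (?l q n))"
    by (simp only: sum_product dpoly_deriv_sum mono)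
  also have "\<dots> = dpoly_deriv (\<Sum>m\<in>?P. ?l p m) * (\<Sum>n\<in>?Q. ?l q n) +
      (\<Sum>m\<in>?P. ?l p m) * dpoly_deriv (\<Sum>n\<in>?Q. ?l q n)"
    by (simp only: sum_product dpoly_deriv_sum sum.distrib)
  finally show ?thesis
    by (simp only: p q)
qed

lemma derivation_dpoly_deriv: "derivation dpoly_deriv"
  by (simp add: derivation_def dpoly_deriv_add dpoly_deriv_mult)

lemma derivation_pderiv: "derivation (pderiv :: 'c::idom poly \<Rightarrow> 'c poly)"
  by (simp add: derivation_def pderiv_add pderiv_mult algebra_simps)


section \<open>Picard-Vessiot rings and differential Galois groups\<close>

definition entries :: "'a ^ 'n ^ 'm \<Rightarrow> 'a set" where
  "entries A = {A $ i $ j | i j. True}"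

text \<open>In what follows, a differential ring extension of a differential field is given by
  a homomorphism \<open>\<iota>\<close> of differential rings, which is automatically injective.\<close>

definition fundamental_matrix ::
  "('f::field \<Rightarrow> 'r::comm_ring_1) \<Rightarrow> ('r \<Rightarrow> 'r) \<Rightarrow> 'f ^ 'n ^ 'n \<Rightarrow> 'r ^ 'n ^ 'n \<Rightarrow> bool" where
  "fundamental_matrix \<iota> d A Z \<longleftrightarrow> invertible Z \<and> map_matrix d Z = map_matrix \<iota> A ** Z"

text \<open>The set of all \<open>w\<close> with \<open>w * det Z = 1\<close> consists of the inverse of \<open>det Z\<close>.
  Nontriviality of the ring is part of the class \<open>comm_ring_1\<close>.\<close>

definition picard_vessiot_ring ::
  "('f::field \<Rightarrow> 'f) \<Rightarrow> ('f \<Rightarrow> 'r::comm_ring_1) \<Rightarrow> ('r \<Rightarrow> 'r) \<Rightarrow> 'f ^ 'n ^ 'n \<Rightarrow> bool" where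
  "picard_vessiot_ring dF \<iota> d A \<longleftrightarrow>
     derivation d \<and> diff_ring_hom_on UNIV dF d \<iota> \<and> diff_simple d \<and>
     (\<exists>Z. fundamental_matrix \<iota> d A Z \<and>
          generated_subring (range \<iota> \<union> entries Z \<union> {w. w * det Z = 1}) = UNIV)"

definition diff_automorphisms ::
  "('f::field \<Rightarrow> 'r::comm_ring_1) \<Rightarrow> ('r \<Rightarrow> 'r) \<Rightarrow> ('r \<Rightarrow> 'r) set" where
  "diff_automorphisms \<iota> d =
     {\<gamma>. bij \<gamma> \<and> diff_ring_hom_on UNIV d d \<gamma> \<and> (\<forall>a. \<gamma> (\<iota> a) = \<iota> a)}"

text \<open>The differential Galois group in its matrix representation with respect to the
  fundamental matrix \<open>Z\<close>; the map \<open>\<kappa>\<close> embeds the constants into the base field.\<close>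

definition galois_group ::
  "('c::field \<Rightarrow> 'f::field) \<Rightarrow> ('f \<Rightarrow> 'r::comm_ring_1) \<Rightarrow> ('r \<Rightarrow> 'r) \<Rightarrow> 'r ^ 'n ^ 'n \<Rightarrow>
   ('c ^ 'n ^ 'n) set" where
  "galois_group \<kappa> \<iota> d Z =
     {M. invertible M \<and>
         (\<exists>\<gamma>\<in>diff_automorphisms \<iota> d. map_matrix \<gamma> Z = Z ** map_matrix (\<lambda>c. \<iota> (\<kappa> c)) M)}"

end

theory Submission
  imports Defs "HOL-Computational_Algebra.Formal_Power_Series" "HOL-Library.Function_Algebras"
begin

text \<open>
  Write \<open>R\<close> for the Picard-Vessiot ring over \<open>C\<langle>t\<rangle>\<close>, with fundamental matrix \<open>Z\<close>, and \<open>R\<^sub>0\<close> for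
  the \<open>R\<^sub>1\<close>-subalgebra generated by the entries of \<open>Z\<close> and its inverse. It is a union of finitely
  generated differential \<open>R\<^sub>1\<close>-modules. The linear relations between the generators of such a module
  are stable under the partial derivatives with respect to all \<open>t\<^sub>i\<^sup>(\<^sup>j\<^sup>)\<close> of sufficiently
  large order \<open>j\<close>. Commutators with the derivation produce the partial derivatives of lower order, and a
  nonzero ideal of \<open>R\<^sub>1\<close> stable under all partial derivatives is the unit ideal. This has two
  consequences: every such module has an \<open>R\<^sub>1\<close>-linear functional with value 1 at 1, so by the
  Nullstellensatz every point \<open>R\<^sub>1 \<rightarrow> C\<close> extends to \<open>R\<^sub>0 \<rightarrow> C\<close>; and an element of a finitely
  generated differential algebra that is constant and has a nonzero \<open>R\<^sub>1\<close>-multiple in the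
  \<open>R\<^sub>1\<close>-subalgebra lies in that subalgebra.

  Choose \<open>a\<close> in \<open>C\<close> where no specialized denominator vanishes. Extending the points given by \<open>z = a\<close> and
  composing with Taylor expansion yields differential homomorphisms of \<open>R\<^sub>0\<close> and of its
  analogue over \<open>C(z)\<close> to \<open>C[[z - a]]\<close>, the second one injective. Two fundamental matrices over
  \<open>C[[z - a]]\<close> differ by a matrix in \<open>GL\<^sub>n(C)\<close>, so after a change of the second fundamental matrix
  both have the same image.

  Now let \<open>M\<close> be in the specialized group and consider the subalgebra of \<open>R \<times> R\<close> generated over
  \<open>C\<langle>t\<rangle>\<close> by \<open>(Z, Z M)\<close> and its inverse. If it is not the graph of an automorphism, then it contains \<open>(1, 0)\<close>,
  which then already lies in the \<open>R\<^sub>1\<close>-subalgebra. Specializing \<open>(1, 0)\<close> contradicts the existence of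
  the automorphism attached to \<open>M\<close>.\<close>

section \<open>Extension of homomorphisms to finitely generated algebras\<close>

text \<open>All intermediate rings (localizations, algebras over them) are subsets of an ambient
  ring type, since they vary within one proof.\<close>

definition subring_on :: "'a::comm_ring_1 set \<Rightarrow> bool" where
  "subring_on A \<longleftrightarrow> 1 \<in> A \<and> (\<forall>x\<in>A. - x \<in> A) \<and> (\<forall>x\<in>A. \<forall>y\<in>A. x + y \<in> A) \<and> (\<forall>x\<in>A. \<forall>y\<in>A. x * y \<in> A)"

text \<open>A homomorphism of a subring is a total function on the ambient type; its values outside
  \<open>A\<close> carry no information.\<close>

definition ring_hom_on :: "'a::comm_ring_1 set \<Rightarrow> ('a \<Rightarrow> 'b::comm_ring_1) \<Rightarrow> bool" where
  "ring_hom_on A f \<longleftrightarrow>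
     f 1 = 1 \<and> (\<forall>x\<in>A. \<forall>y\<in>A. f (x + y) = f x + f y) \<and> (\<forall>x\<in>A. \<forall>y\<in>A. f (x * y) = f x * f y)"

definition ideal_in :: "'a::comm_ring_1 set \<Rightarrow> 'a set \<Rightarrow> bool" where
  "ideal_in A J \<longleftrightarrow>
     J \<subseteq> A \<and> 0 \<in> J \<and> (\<forall>x\<in>J. \<forall>y\<in>J. x + y \<in> J) \<and> (\<forall>a\<in>A. \<forall>x\<in>J. a * x \<in> J)"

definition prime_in :: "'a::comm_ring_1 set \<Rightarrow> 'a set \<Rightarrow> bool" where
  "prime_in A P \<longleftrightarrow>
     ideal_in A P \<and> 1 \<notin> P \<and> (\<forall>x\<in>A. \<forall>y\<in>A. x * y \<in> P \<longrightarrow> x \<in> P \<or> y \<in> P)"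

text \<open>Elements are finite sums of products, built one summand at a time; this makes induction
  over representations of an element direct.\<close>

inductive_set ideal_generated :: "'a::comm_ring_1 set \<Rightarrow> 'a set \<Rightarrow> 'a set" for A N where
  zero: "0 \<in> ideal_generated A N"
| step: "\<lbrakk>u \<in> ideal_generated A N; a \<in> A; m \<in> N\<rbrakk> \<Longrightarrow> u + a * m \<in> ideal_generated A N"

text \<open>Used both for polynomials over a subring and, with an ideal in place of
  \<open>A\<close>, for polynomials that are zero modulo that ideal.\<close>

definition coeffs_in :: "'a::zero set \<Rightarrow> 'a poly \<Rightarrow> bool" where
  "coeffs_in A p \<longleftrightarrow> (\<forall>i. coeff p i \<in> A)"

lemma subring_onD:
  assumes "subring_on A"
  shows "1 \<in> A" "x \<in> A \<Longrightarrow> - x \<in> A" "\<lbrakk>x \<in> A; y \<in> A\<rbrakk> \<Longrightarrow> x + y \<in> A" "\<lbrakk>x \<in> A; y \<in> A\<rbrakk> \<Longrightarrow> x * y \<in> A"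
    "0 \<in> A" "\<lbrakk>x \<in> A; y \<in> A\<rbrakk> \<Longrightarrow> x - y \<in> A"
proof -
  show *: "1 \<in> A" "x \<in> A \<Longrightarrow> - x \<in> A" "\<lbrakk>x \<in> A; y \<in> A\<rbrakk> \<Longrightarrow> x + y \<in> A" "\<lbrakk>x \<in> A; y \<in> A\<rbrakk> \<Longrightarrow> x * y \<in> A" for x y
    using assms by (auto simp: subring_on_def)
  show "0 \<in> A" using *(3)[of 1 "-1"] *(1) *(2)[of 1] by simp
  show "\<lbrakk>x \<in> A; y \<in> A\<rbrakk> \<Longrightarrow> x - y \<in> A" using *(3)[of x "-y"] *(2)[of y] by simp
qed

lemma subring_on_sum:
  assumes "subring_on A" "\<And>i. i \<in> I \<Longrightarrow> f i \<in> A"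
  shows "(\<Sum>i\<in>I. f i) \<in> A"
  using assms(2)
  by (induction I rule: infinite_finite_induct) (auto intro: subring_onD[OF assms(1)])

lemma subring_on_prod:
  assumes "subring_on A" "\<And>i. i \<in> I \<Longrightarrow> f i \<in> A"
  shows "(\<Prod>i\<in>I. f i) \<in> A"
  using assms(2)
  by (induction I rule: infinite_finite_induct) (auto intro: subring_onD[OF assms(1)])

lemma subring_on_power: "\<lbrakk>subring_on A; x \<in> A\<rbrakk> \<Longrightarrow> x ^ n \<in> A"
  by (induction n) (auto intro: subring_onD)

lemma subring_on_generated: "subring_on (generated_subring X)"
  by (auto simp: subring_on_def intro: generated_subring.intros)

lemma subring_on_poly:
  assumes "subring_on A" "coeffs_in A p" "x \<in> A"
  shows "poly p x \<in> A"
  unfolding poly_altdef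
  by (intro subring_on_sum subring_onD(4) subring_on_power)
     (use assms in \<open>auto simp: coeffs_in_def\<close>)

lemma generated_subring_minimal:
  assumes "subring_on A" "X \<subseteq> A"
  shows "generated_subring X \<subseteq> A"
proof
  fix x assume "x \<in> generated_subring X"
  then show "x \<in> A"
    by induction (use assms subring_onD[OF assms(1)] in auto)
qed

lemma generated_subring_mono: "X \<subseteq> Y \<Longrightarrow> generated_subring X \<subseteq> generated_subring Y"
  by (intro generated_subring_minimal subring_on_generated) (auto intro: generated_subring.gen)

lemma ring_hom_onD:
  assumes "ring_hom_on A f" "subring_on A"
  shows "f 1 = 1" "f 0 = 0" "\<lbrakk>x \<in> A; y \<in> A\<rbrakk> \<Longrightarrow> f (x + y) = f x + f y"
    "\<lbrakk>x \<in> A; y \<in> A\<rbrakk> \<Longrightarrow> f (x * y) = f x * f y" "x \<in> A \<Longrightarrow> f (- x) = - f x"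
    "\<lbrakk>x \<in> A; y \<in> A\<rbrakk> \<Longrightarrow> f (x - y) = f x - f y"
proof -
  show *: "f 1 = 1" "\<lbrakk>x \<in> A; y \<in> A\<rbrakk> \<Longrightarrow> f (x + y) = f x + f y"
    "\<lbrakk>x \<in> A; y \<in> A\<rbrakk> \<Longrightarrow> f (x * y) = f x * f y" for x y
    using assms by (auto simp: ring_hom_on_def)
  show 0: "f 0 = 0" using *(2)[of 0 0] subring_onD(5)[OF assms(2)] by simp
  show minus: "f (- x) = - f x" if "x \<in> A" for x
    using *(2)[of x "-x"] that 0 subring_onD(2)[OF assms(2)]
    by (simp add: eq_neg_iff_add_eq_0 add.commute)
  show "f (x - y) = f x - f y" if "x \<in> A" "y \<in> A"
    using *(2)[of x "-y"] minus[of y] that subring_onD(2)[OF assms(2)] by simp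
qed

lemma ring_hom_on_sum:
  assumes "ring_hom_on A f" "subring_on A" "\<And>i. i \<in> I \<Longrightarrow> g i \<in> A"
  shows "f (\<Sum>i\<in>I. g i) = (\<Sum>i\<in>I. f (g i))"
  using assms(3)
  by (induction I rule: infinite_finite_induct)
     (auto simp: ring_hom_onD[OF assms(1,2)] subring_on_sum[OF assms(2)])

lemma ring_hom_on_power:
  assumes "ring_hom_on A f" "subring_on A" "x \<in> A"
  shows "f (x ^ n) = f x ^ n"
  by (induction n) (auto simp: ring_hom_onD[OF assms(1,2)] subring_on_power assms)

section \<open>Ideals and prime ideals of subrings\<close>

lemma ideal_inD:
  assumes "ideal_in A J"
  shows "x \<in> J \<Longrightarrow> x \<in> A" "0 \<in> J" "\<lbrakk>x \<in> J; y \<in> J\<rbrakk> \<Longrightarrow> x + y \<in> J"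
    "\<lbrakk>a \<in> A; x \<in> J\<rbrakk> \<Longrightarrow> a * x \<in> J" "\<lbrakk>a \<in> A; x \<in> J\<rbrakk> \<Longrightarrow> x * a \<in> J"
  using assms unfolding ideal_in_def by (auto simp: mult.commute[of _ a])

lemma ideal_in_minus:
  assumes "ideal_in A J" "subring_on A"
  shows "x \<in> J \<Longrightarrow> - x \<in> J" "\<lbrakk>x \<in> J; y \<in> J\<rbrakk> \<Longrightarrow> x - y \<in> J"
proof -
  show *: "x \<in> J \<Longrightarrow> - x \<in> J" for x
    using ideal_inD(4)[OF assms(1), of "-1" x] subring_onD(1,2)[OF assms(2)] by auto
  show "\<lbrakk>x \<in> J; y \<in> J\<rbrakk> \<Longrightarrow> x - y \<in> J"
    using ideal_inD(3)[OF assms(1), of x "-y"] *[of y] by simp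
qed

lemma ideal_in_sum:
  assumes "ideal_in A J" "\<And>i. i \<in> I \<Longrightarrow> f i \<in> J"
  shows "(\<Sum>i\<in>I. f i) \<in> J"
  using assms(2)
  by (induction I rule: infinite_finite_induct) (auto intro: ideal_inD[OF assms(1)])

lemma ideal_in_ideal_generated:
  assumes "subring_on A" "N \<subseteq> A"
  shows "ideal_in A (ideal_generated A N)"
proof -
  have 1: "x \<in> A" if "x \<in> ideal_generated A N" for x
    using that by induction (use assms in \<open>auto intro!: subring_onD[OF assms(1)]\<close>)
  have 2: "x + y \<in> ideal_generated A N" if "y \<in> ideal_generated A N" "x \<in> ideal_generated A N" for x y
    using that by induction (auto simp: add.assoc[symmetric] intro: ideal_generated.step)
  have 3: "a * x \<in> ideal_generated A N" if "x \<in> ideal_generated A N" "a \<in> A" for a x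
    using that
  proof induction
    case (step u b m)
    have "a * u + (a * b) * m \<in> ideal_generated A N"
      using step by (intro ideal_generated.step) (auto intro: subring_onD[OF assms(1)])
    then show ?case by (simp add: algebra_simps)
  qed (simp add: ideal_generated.zero)
  show ?thesis
    unfolding ideal_in_def using 1 2 3 ideal_generated.zero by blast
qed

lemma ideal_generated_superset: "subring_on A \<Longrightarrow> N \<subseteq> ideal_generated A N"
  using ideal_generated.step[OF ideal_generated.zero, of 1 A _ N] by (auto intro: subring_onD)

text \<open>Zorn's lemma gives an ideal maximal among the proper ideals above \<open>J\<close>, and
  such an ideal is prime.\<close>

lemma exists_prime_in:
  assumes A: "subring_on A" and J: "ideal_in A J" "1 \<notin> J"
  shows "\<exists>P. prime_in A P \<and> J \<subseteq> P"
proof -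
  define F where "F = {Q. ideal_in A Q \<and> J \<subseteq> Q \<and> 1 \<notin> Q}"
  have "\<exists>M\<in>F. \<forall>X\<in>F. M \<subseteq> X \<longrightarrow> X = M"
  proof (rule subset_Zorn_nonempty)
    show "F \<noteq> {}" using J by (auto simp: F_def)
    fix C assume C: "C \<noteq> {}" "subset.chain F C"
    then have CF: "\<And>Q. Q \<in> C \<Longrightarrow> ideal_in A Q \<and> J \<subseteq> Q \<and> 1 \<notin> Q"
      and lin: "\<And>Q Q'. Q \<in> C \<Longrightarrow> Q' \<in> C \<Longrightarrow> Q \<subseteq> Q' \<or> Q' \<subseteq> Q"
      by (auto simp: subset.chain_def F_def)
    have add: "x + y \<in> \<Union>C" if xy: "x \<in> \<Union>C" "y \<in> \<Union>C" for x y
    proof -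
      obtain Q Q' where Q: "Q \<in> C" "x \<in> Q" "Q' \<in> C" "y \<in> Q'" using xy by blast
      obtain Q'' where "Q'' \<in> C" "x \<in> Q''" "y \<in> Q''"
        using lin[OF Q(1,3)] Q by (meson subsetD)
      then have "x + y \<in> Q''" using CF ideal_inD(3) by blast
      with \<open>Q'' \<in> C\<close> show ?thesis by blast
    qed
    have "ideal_in A (\<Union>C)"
      unfolding ideal_in_def
    proof (intro conjI ballI)
      show "\<Union>C \<subseteq> A" using CF ideal_inD(1) by blast
      show "0 \<in> \<Union>C" using C(1) CF by (auto simp: ideal_in_def)
      show "a * x \<in> \<Union>C" if "a \<in> A" "x \<in> \<Union>C" for a x
        using that CF ideal_inD(4) by blast
    qed (rule add)
    then show "\<Union>C \<in> F" using C(1) CF by (fastforce simp: F_def)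
  qed
  then obtain P where PF: "P \<in> F" and Pmax: "\<And>X. X \<in> F \<Longrightarrow> P \<subseteq> X \<Longrightarrow> X = P" by metis
  have P: "ideal_in A P" "J \<subseteq> P" "1 \<notin> P" using PF by (simp_all add: F_def)
  have max: "Q = P" if "ideal_in A Q" "P \<subseteq> Q" "1 \<notin> Q" for Q
    using Pmax[of Q] that P(2) by (simp add: F_def)
  have "y \<in> P" if xy: "x \<in> A" "y \<in> A" "x * y \<in> P" "x \<notin> P" for x y
  proof -
    \<comment> \<open>The ideal generated by \<open>P\<close> and \<open>x\<close>. By maximality it
      contains 1, and multiplying \<open>1 = p + a * x\<close> by \<open>y\<close> puts
      \<open>y\<close> into \<open>P\<close>.\<close>
    define Q where "Q = {p + a * x | p a. p \<in> P \<and> a \<in> A}"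
    have "ideal_in A Q"
      unfolding ideal_in_def
    proof (intro conjI ballI)
      show "Q \<subseteq> A" using xy ideal_inD[OF P(1)] subring_onD[OF A] by (auto simp: Q_def)
      show "0 \<in> Q" unfolding Q_def using ideal_inD(2)[OF P(1)] subring_onD(5)[OF A]
        by (intro CollectI exI[of _ 0]) auto
      show "u + v \<in> Q" if uv: "u \<in> Q" "v \<in> Q" for u v
      proof -
        obtain p a p' a' where *: "u = p + a * x" "v = p' + a' * x" "p \<in> P" "p' \<in> P" "a \<in> A" "a' \<in> A"
          using uv by (auto simp: Q_def)
        have "u + v = (p + p') + (a + a') * x" using * by (simp add: algebra_simps)
        moreover have "p + p' \<in> P" using *(3,4) by (rule ideal_inD(3)[OF P(1)])
        moreover have "a + a' \<in> A" using *(5,6) by (rule subring_onD(3)[OF A])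
        ultimately show ?thesis unfolding Q_def by blast
      qed
      show "b * u \<in> Q" if bu: "b \<in> A" "u \<in> Q" for b u
      proof -
        obtain p a where *: "u = p + a * x" "p \<in> P" "a \<in> A"
          using bu by (auto simp: Q_def)
        have "b * u = (b * p) + (b * a) * x" using * by (simp add: algebra_simps)
        moreover have "b * p \<in> P" using bu(1) *(2) by (rule ideal_inD(4)[OF P(1)])
        moreover have "b * a \<in> A" using bu(1) *(3) by (rule subring_onD(4)[OF A])
        ultimately show ?thesis unfolding Q_def by blast
      qed
    qed
    moreover have "P \<subseteq> Q"
    proof
      fix p assume "p \<in> P"
      then have "p = p + 0 * x \<and> p \<in> P \<and> 0 \<in> A" using subring_onD(5)[OF A] by simp
      then show "p \<in> Q" unfolding Q_def by blast
    qed
    moreover have "x \<in> Q"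
    proof -
      have "x = 0 + 1 * x \<and> 0 \<in> P \<and> 1 \<in> A" using ideal_inD(2)[OF P(1)] subring_onD(1)[OF A] by simp
      then show ?thesis unfolding Q_def by blast
    qed
    ultimately have "1 \<in> Q" using max xy(4) by blast
    then obtain p a where pa: "1 = p + a * x" "p \<in> P" "a \<in> A" by (auto simp: Q_def)
    have "y = (p + a * x) * y" using pa(1) by simp
    also have "\<dots> = p * y + a * (x * y)" by (simp add: algebra_simps)
    also have "\<dots> \<in> P"
      by (intro ideal_inD(3)[OF P(1)] ideal_inD(4)[OF P(1) pa(3) xy(3)] ideal_inD(5)[OF P(1) xy(2) pa(2)])
    finally show ?thesis .
  qed
  then show ?thesis using P by (auto simp: prime_in_def)
qed

section \<open>Polynomials modulo a prime ideal and extension of homomorphisms\<close>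

lemma coeffs_in_ops:
  assumes "subring_on A"
  shows "coeffs_in A 0" "a \<in> A \<Longrightarrow> coeffs_in A [:a:]"
    "\<lbrakk>coeffs_in A p; coeffs_in A q\<rbrakk> \<Longrightarrow> coeffs_in A (p + q)"
    "\<lbrakk>coeffs_in A p; coeffs_in A q\<rbrakk> \<Longrightarrow> coeffs_in A (p - q)"
    "\<lbrakk>coeffs_in A p; coeffs_in A q\<rbrakk> \<Longrightarrow> coeffs_in A (p * q)"
    "\<lbrakk>a \<in> A; coeffs_in A p\<rbrakk> \<Longrightarrow> coeffs_in A (smult a p)"
    "a \<in> A \<Longrightarrow> coeffs_in A (monom a n)"
    "coeffs_in A p \<Longrightarrow> coeffs_in A (- p)"
  using subring_onD[OF assms]
  by (auto simp: coeffs_in_def coeff_mult coeff_pCons intro!: subring_on_sum[OF assms] split: nat.splits)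

text \<open>Division with remainder when the leading coefficient of \<open>g\<close> need not be a
  unit: each step multiplies by that coefficient before cancelling the top term, which accounts for
  its power in front of \<open>c\<close>.\<close>

lemma pseudo_division:
  fixes A :: "'a::comm_ring_1 set"
  assumes A: "subring_on A" and g: "coeffs_in A g" "degree g > 0"
  assumes c: "coeffs_in A c"
  shows "\<exists>k q r. coeffs_in A q \<and> coeffs_in A r \<and> smult (lead_coeff g ^ k) c = q * g + r \<and> degree r < degree g"
  using c
proof (induction "degree c" arbitrary: c rule: less_induct)
  case (less c)
  show ?case
  proof (cases "degree c < degree g")
    case True
    then show ?thesis
      by (intro exI[of _ 0] exI[of _ "0::'a poly"] exI[of _ c]) (use less coeffs_in_ops(1)[OF A] in auto)
  next
    case False
    let ?m = "monom (lead_coeff c) (degree c - degree g)"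
    define c1 where "c1 = smult (lead_coeff g) c - ?m * g"
    have lc: "lead_coeff g \<in> A" "lead_coeff c \<in> A" using g less by (auto simp: coeffs_in_def)
    have c1A: "coeffs_in A c1" unfolding c1_def
      using lc g less by (intro coeffs_in_ops[OF A]) auto
    have "degree c1 \<le> degree c" unfolding c1_def
    proof (rule degree_diff_le)
      show "degree (?m * g) \<le> degree c"
        using degree_mult_le[of ?m g] degree_monom_le[of "lead_coeff c" "degree c - degree g"] False by simp
    qed (rule degree_smult_le)
    moreover have "coeff c1 (degree c) = 0"
      using False by (simp add: c1_def coeff_monom_mult mult.commute[of "lead_coeff g"])
    \<comment> \<open>If \<open>c1 = 0\<close>, this still holds because \<open>degree c\<close> is
      at least \<open>degree g\<close>, which is positive.\<close>
    ultimately have "degree c1 < degree c"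
      using eq_zero_or_degree_less[of c1 "degree c"] g False by auto
    from less.hyps[OF this c1A] obtain k q r where
      *: "coeffs_in A q" "coeffs_in A r" "smult (lead_coeff g ^ k) c1 = q * g + r" "degree r < degree g"
      by blast
    have "smult (lead_coeff g ^ Suc k) c = smult (lead_coeff g ^ k) (c1 + ?m * g)"
      by (simp add: c1_def mult.commute)
    also have "\<dots> = (q + smult (lead_coeff g ^ k) ?m) * g + r"
      by (simp only: smult_add_right *(3)) (simp add: algebra_simps)
    finally show ?thesis
      using * lc by (intro exI[of _ "Suc k"] exI[of _ "q + smult (lead_coeff g ^ k) ?m"] exI[of _ r])
        (auto intro!: coeffs_in_ops[OF A] subring_on_power[OF A])
  qed
qed

lemma poly_in_ideal:
  assumes "subring_on A" "ideal_in A P" "coeffs_in P d" "x \<in> A"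
  shows "poly d x \<in> P"
  unfolding poly_altdef
  using assms by (intro ideal_in_sum[OF assms(2)] ideal_inD(5)[OF assms(2)] subring_on_power)
    (auto simp: coeffs_in_def)

text \<open>Cutting off the top coefficients that lie in \<open>P\<close> changes nothing modulo
  \<open>P\<close>; the result shows the true degree of \<open>c\<close> modulo \<open>P\<close>
  through a leading coefficient outside \<open>P\<close>.\<close>

lemma truncate_mod_ideal:
  assumes A: "subring_on A" "ideal_in A P" "x \<in> A" and B: "0 \<in> B" "coeffs_in B c"
    and c: "\<not> coeffs_in P c"
  shows "\<exists>c'. coeffs_in B c' \<and> lead_coeff c' \<notin> P \<and> degree c' \<le> degree c \<and>
    poly c x - poly c' x \<in> P \<and> coeffs_in P (c - c')"
proof -
  define I where "I = {i. coeff c i \<notin> P}"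
  have 0: "0 \<in> P" using ideal_inD(2)[OF A(2)] .
  have I: "I \<noteq> {}" "I \<subseteq> {..degree c}"
    using c 0 by (auto simp: I_def coeffs_in_def) (metis coeff_eq_0 not_le)
  then have fin: "finite I" using finite_subset by blast
  define j where "j = Max I"
  have j: "j \<in> I" using Max_in[OF fin I(1)] by (simp add: j_def)
  have gt: "coeff c i \<in> P" if "i > j" for i
    using that Max_ge[OF fin, of i] by (auto simp: j_def I_def)
  define c' where "c' = poly_cutoff (Suc j) c"
  have co: "coeff c' i = (if i \<le> j then coeff c i else 0)" for i
    by (simp add: c'_def coeff_poly_cutoff less_Suc_eq_le)
  have "coeff c' j \<notin> P" using j by (simp add: co I_def)
  moreover have "degree c' = j"
  proof (rule antisym)
    show "degree c' \<le> j" by (rule degree_le) (simp add: co)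
    show "j \<le> degree c'" using \<open>coeff c' j \<notin> P\<close> 0 by (intro le_degree) auto
  qed
  moreover have d: "coeffs_in P (c - c')" by (auto simp: coeffs_in_def co 0 gt)
  moreover have "poly (c - c') x \<in> P" by (rule poly_in_ideal[OF A(1,2) d A(3)])
  moreover have "coeffs_in B c'" using B by (auto simp: coeffs_in_def co)
  moreover have "j \<le> degree c" using j I by auto
  ultimately show ?thesis by (intro exI[of _ c']) simp
qed

lemma map_poly_hom_on:
  assumes h: "ring_hom_on A h" and A: "subring_on A"
    and p: "coeffs_in A p" and q: "coeffs_in A q"
  shows "map_poly h (p + q) = map_poly h p + map_poly h q"
    and "map_poly h (p * q) = map_poly h p * map_poly h q"
proof -
  have h0: "h 0 = 0" using ring_hom_onD(2)[OF h A] .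
  show "map_poly h (p + q) = map_poly h p + map_poly h q"
    by (rule poly_eqI) (use p q in \<open>auto simp: coeff_map_poly h0 coeffs_in_def ring_hom_onD(3)[OF h A]\<close>)
  show "map_poly h (p * q) = map_poly h p * map_poly h q"
  proof (rule poly_eqI)
    fix n
    have "h (\<Sum>i\<le>n. coeff p i * coeff q (n - i)) = (\<Sum>i\<le>n. h (coeff p i * coeff q (n - i)))"
      by (rule ring_hom_on_sum[OF h A]) (use p q in \<open>auto simp: coeffs_in_def intro: subring_onD[OF A]\<close>)
    also have "\<dots> = (\<Sum>i\<le>n. h (coeff p i) * h (coeff q (n - i)))"
      by (rule sum.cong) (use p q in \<open>auto simp: coeffs_in_def ring_hom_onD(4)[OF h A]\<close>)
    finally show "coeff (map_poly h (p * q)) n = coeff (map_poly h p * map_poly h q) n"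
      by (simp add: coeff_map_poly h0 coeff_mult)
  qed
qed

text \<open>Two polynomials with the same value at \<open>x\<close> differ by a relation of
  \<open>x\<close>, and relations vanish at \<xi> after applying \<open>h\<close>; hence sending
  \<open>x\<close> to \<xi> is well defined.\<close>

lemma extend_hom_by_root:
  fixes h :: "'b::comm_ring_1 \<Rightarrow> 'c::comm_ring_1"
  assumes h: "ring_hom_on A h" and A: "subring_on A" and P: "0 \<in> P"
    and xi: "\<And>c. coeffs_in A c \<Longrightarrow> poly c x \<in> P \<Longrightarrow> poly (map_poly h c) \<xi> = 0"
  shows "\<exists>h'. ring_hom_on {poly c x | c. coeffs_in A c} h' \<and>
    (\<forall>c. coeffs_in A c \<longrightarrow> h' (poly c x) = poly (map_poly h c) \<xi>)"
proof -
  define h' where "h' y = poly (map_poly h (SOME c. coeffs_in A c \<and> poly c x = y)) \<xi>" for y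
  have h0: "h 0 = 0" using ring_hom_onD(2)[OF h A] .
  have ev: "h' (poly c x) = poly (map_poly h c) \<xi>" if c: "coeffs_in A c" for c
  proof -
    define c' where "c' = (SOME c'. coeffs_in A c' \<and> poly c' x = poly c x)"
    have c': "coeffs_in A c' \<and> poly c' x = poly c x"
      unfolding c'_def by (rule someI[of _ c]) (use c in simp)
    then have d: "coeffs_in A (c - c')" using c coeffs_in_ops(4)[OF A] by blast
    then have "poly (map_poly h (c - c')) \<xi> = 0" using c' P by (intro xi) auto
    moreover have "map_poly h c = map_poly h (c - c') + map_poly h c'"
      using map_poly_hom_on(1)[OF h A d, of c'] c' by simp
    ultimately show ?thesis by (simp add: h'_def c'_def)
  qed
  have "ring_hom_on {poly c x | c. coeffs_in A c} h'"
    unfolding ring_hom_on_def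
  proof (intro conjI ballI)
    have "h' (poly [:1:] x) = 1"
      by (subst ev) (auto intro!: coeffs_in_ops[OF A] subring_onD[OF A] simp: map_poly_pCons h0 ring_hom_onD(1)[OF h A])
    then show "h' 1 = 1" by simp
    fix y z assume "y \<in> {poly c x | c. coeffs_in A c}" "z \<in> {poly c x | c. coeffs_in A c}"
    then obtain c d where cd: "coeffs_in A c" "coeffs_in A d" "y = poly c x" "z = poly d x" by auto
    have "h' (poly (c + d) x) = poly (map_poly h c) \<xi> + poly (map_poly h d) \<xi>"
      using cd by (subst ev) (auto intro: coeffs_in_ops[OF A] simp: map_poly_hom_on[OF h A])
    then show "h' (y + z) = h' y + h' z" using cd by (simp add: ev)
    have "h' (poly (c * d) x) = poly (map_poly h c) \<xi> * poly (map_poly h d) \<xi>"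
      using cd by (subst ev) (auto intro: coeffs_in_ops[OF A] simp: map_poly_hom_on[OF h A])
    then show "h' (y * z) = h' y * h' z" using cd by (simp add: ev)
  qed
  with ev show ?thesis by blast
qed


text \<open>Such an \<open>h\<close> factors through the image of \<open>A\<close> in the quotient
  domain modulo \<open>P\<close>; the condition replaces forming that quotient.\<close>

definition hom_extending :: "'b::comm_ring_1 set \<Rightarrow> ('b \<Rightarrow> 'c::comm_ring_1) \<Rightarrow> 'b set \<Rightarrow> 'b set \<Rightarrow> ('b \<Rightarrow> 'c) \<Rightarrow> bool" where
  "hom_extending A0 h0 P A h \<longleftrightarrow>
     ring_hom_on A h \<and> (\<forall>a\<in>A0. h a = h0 a) \<and> (\<forall>p\<in>A \<inter> P. h p = 0)"

lemma hom_extending_simple: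
  fixes h :: "'b::comm_ring_1 \<Rightarrow> 'c::comm_ring_1"
  assumes h: "hom_extending A0 h0 P A1 h" and A1: "subring_on A1" "A0 \<subseteq> A1" and P: "0 \<in> P"
    and xi: "\<And>c. coeffs_in A1 c \<Longrightarrow> poly c x \<in> P \<Longrightarrow> poly (map_poly h c) \<xi> = 0"
  shows "\<exists>h'. hom_extending A0 h0 P {poly c x | c. coeffs_in A1 c} h' \<and>
    (\<forall>c. coeffs_in A1 c \<longrightarrow> h' (poly c x) = poly (map_poly h c) \<xi>)"
proof -
  have hom: "ring_hom_on A1 h" using h by (simp add: hom_extending_def)
  from extend_hom_by_root[OF hom A1(1) P, of x \<xi>, OF xi]
  obtain h' where h': "ring_hom_on {poly c x | c. coeffs_in A1 c} h'"
    "\<And>c. coeffs_in A1 c \<Longrightarrow> h' (poly c x) = poly (map_poly h c) \<xi>"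
    by blast
  have "h' a = h0 a" if "a \<in> A0" for a
  proof -
    have "coeffs_in A1 [:a:]" using that A1 by (intro coeffs_in_ops) auto
    from h'(2)[OF this] show ?thesis
      using that h ring_hom_onD(2)[OF hom A1(1)] by (simp add: map_poly_pCons hom_extending_def)
  qed
  moreover have "\<forall>p\<in>{poly c x | c. coeffs_in A1 c} \<inter> P. h' p = 0"
    using h'(2) xi by auto
  ultimately show ?thesis using h' unfolding hom_extending_def by blast
qed

text \<open>If \<open>x\<close> is algebraic over \<open>A1\<close> modulo \<open>P\<close>, let \<open>g\<close> be a relation of minimal degree. By
  pseudo-division some element \<open>e\<close> of \<open>A1\<close> outside \<open>P\<close> is a multiple of \<open>b\<close> modulo \<open>P\<close>, and a
  homomorphism not vanishing at \<open>e\<close> times the leading coefficient of \<open>g\<close> extends by sending \<open>x\<close> to a root.\<close>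

lemma hom_extension_step:
  fixes h0 :: "'b::comm_ring_1 \<Rightarrow> 'c::{alg_closed_field, field_char_0}"
  assumes A: "subring_on A" and P: "prime_in A P" and A1: "subring_on A1" "A1 \<subseteq> A" "A0 \<subseteq> A1" and x: "x \<in> A"
    and ext: "\<And>b. b \<in> A1 - P \<Longrightarrow> \<exists>h. hom_extending A0 h0 P A1 h \<and> h b \<noteq> 0"
    and b: "b \<in> {poly c x | c. coeffs_in A1 c} - P"
  shows "\<exists>h. hom_extending A0 h0 P {poly c x | c. coeffs_in A1 c} h \<and> h b \<noteq> 0"
proof -
  have PI: "ideal_in A P" and P1: "1 \<notin> P"
    and Pp: "\<And>x y. x \<in> A \<Longrightarrow> y \<in> A \<Longrightarrow> x * y \<in> P \<Longrightarrow> x \<in> P \<or> y \<in> P"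
    using P by (auto simp: prime_in_def)
  note P0 = ideal_inD(2)[OF PI]
  have sub: "coeffs_in A c" if "coeffs_in A1 c" for c
    using that A1(2) by (auto simp: coeffs_in_def)
  note A10 = subring_onD(5)[OF A1(1)]
  note trunc = truncate_mod_ideal[OF A PI x A10]
  note inP = poly_in_ideal[OF A PI _ x]
  obtain \<beta> where \<beta>: "coeffs_in A1 \<beta>" "b = poly \<beta> x" and bP: "b \<notin> P" using b by auto
  have bA: "b \<in> A" using \<beta> sub[OF \<beta>(1)] x subring_on_poly[OF A] by blast
  show ?thesis
  proof (cases "\<forall>c. coeffs_in A1 c \<longrightarrow> poly c x \<in> P \<longrightarrow> coeffs_in P c")
    case True
    \<comment> \<open>Here \<open>x\<close> is transcendental modulo \<open>P\<close>. It can be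
      sent to any value that is not a root of the image of \<beta>, and that image is nonzero
      because \<open>h\<close> does not kill one of its coefficients.\<close>
    have "\<not> coeffs_in P \<beta>" using inP \<beta> bP by blast
    then obtain j where j: "coeff \<beta> j \<notin> P" by (auto simp: coeffs_in_def)
    then obtain h where h: "hom_extending A0 h0 P A1 h" "h (coeff \<beta> j) \<noteq> 0"
      using ext[of "coeff \<beta> j"] \<beta>(1) by (auto simp: coeffs_in_def)
    have h0: "h 0 = 0" using h(1) A1(1) ring_hom_onD(2) by (auto simp: hom_extending_def)
    have "coeff (map_poly h \<beta>) j \<noteq> 0" using h(2) h0 by (simp add: coeff_map_poly)
    then have "map_poly h \<beta> \<noteq> 0" by auto
    then have "finite {\<xi>. poly (map_poly h \<beta>) \<xi> = 0}" by (rule poly_roots_finite)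
    then obtain \<xi> where \<xi>: "poly (map_poly h \<beta>) \<xi> \<noteq> 0"
      using infinite_UNIV_char_0[where 'a='c] by (metis (mono_tags, lifting) ex_new_if_finite mem_Collect_eq)
    have "poly (map_poly h c) \<xi> = 0" if c: "coeffs_in A1 c" "poly c x \<in> P" for c
    proof -
      have "map_poly h c = 0"
        using True c h(1) by (intro poly_eqI) (auto simp: coeff_map_poly h0 hom_extending_def coeffs_in_def)
      then show ?thesis by simp
    qed
    from hom_extending_simple[OF h(1) A1(1,3) P0, of x \<xi>, OF this]
    show ?thesis using \<xi> \<beta> by auto
  next
    case False
    \<comment> \<open>The algebraic relations of \<open>x\<close> modulo \<open>P\<close>,
      normalized so that \<open>degree\<close> is the degree modulo \<open>P\<close>.\<close>
    define G where "G g \<longleftrightarrow> coeffs_in A1 g \<and> poly g x \<in> P \<and> lead_coeff g \<notin> P" for g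
    have "\<exists>g. G g"
    proof -
      obtain c where c: "coeffs_in A1 c" "poly c x \<in> P" "\<not> coeffs_in P c" using False by blast
      from trunc[OF c(1,3)] obtain c' where c': "coeffs_in A1 c'" "lead_coeff c' \<notin> P" "poly c x - poly c' x \<in> P"
        by blast
      have "poly c' x = poly c x - (poly c x - poly c' x)" by simp
      also have "\<dots> \<in> P" using c(2) c'(3) by (rule ideal_in_minus(2)[OF PI A])
      finally show ?thesis using c' by (auto simp: G_def)
    qed
    then obtain g where g: "G g" and gmin: "\<And>g'. G g' \<Longrightarrow> degree g \<le> degree g'"
      using ex_has_least_nat[of G _ degree] by blast
    have small: "coeffs_in P c" if c: "coeffs_in A1 c" "poly c x \<in> P" "degree c < degree g" for c
    proof (rule ccontr)
      assume "\<not> coeffs_in P c"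
      from trunc[OF c(1) this] obtain c' where c': "coeffs_in A1 c'" "lead_coeff c' \<notin> P" "poly c x - poly c' x \<in> P"
        "degree c' \<le> degree c" by blast
      have "poly c' x = poly c x - (poly c x - poly c' x)" by simp
      also have "\<dots> \<in> P" using c(2) c'(3) by (rule ideal_in_minus(2)[OF PI A])
      finally have "G c'" using c' by (auto simp: G_def)
      from gmin[OF this] c'(4) c(3) show False by simp
    qed
    have gA: "coeffs_in A1 g" and gx: "poly g x \<in> P" and lg: "lead_coeff g \<notin> P" using g by (auto simp: G_def)
    have lgA: "lead_coeff g \<in> A1" using gA by (simp add: coeffs_in_def)
    have dg: "degree g > 0"
    proof (rule ccontr)
      assume "\<not> degree g > 0"
      then obtain a where "g = [:a:]" by (metis degree_eq_zeroE gr0I)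
      then show False using gx lg by simp
    qed
    have powP: "a ^ k \<notin> P" if "a \<in> A" "a \<notin> P" for a k
      by (induction k) (use that P1 Pp subring_on_power[OF A] in auto)
    \<comment> \<open>Polynomials below the degree of \<open>g\<close> and nonzero modulo
      \<open>P\<close> whose value at \<open>x\<close> is a multiple of \<open>b\<close> modulo
      \<open>P\<close>. One of least degree turns out to be a constant \<open>e\<close>.\<close>
    define E where "E r \<longleftrightarrow> coeffs_in A1 r \<and> lead_coeff r \<notin> P \<and> degree r < degree g \<and>
      (\<exists>u. coeffs_in A1 u \<and> poly r x - poly u x * b \<in> P)" for r
    have E_red: "\<exists>r'. E r' \<and> degree r' \<le> degree r"
      if r: "coeffs_in A1 r" "\<not> coeffs_in P r" "degree r < degree g"
        "coeffs_in A1 u" "poly r x - poly u x * b \<in> P" for r u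
    proof -
      from trunc[OF r(1,2)] obtain r' where r': "coeffs_in A1 r'" "lead_coeff r' \<notin> P"
        "poly r x - poly r' x \<in> P" "degree r' \<le> degree r" by blast
      have "poly r' x - poly u x * b = (poly r x - poly u x * b) - (poly r x - poly r' x)" by simp
      also have "\<dots> \<in> P" using r(5) r'(3) by (rule ideal_in_minus(2)[OF PI A])
      finally show ?thesis using r' r by (intro exI[of _ r']) (auto simp: E_def)
    qed
    have "\<exists>r. E r"
    proof -
      obtain k q s where s: "coeffs_in A1 q" "coeffs_in A1 s"
        "smult (lead_coeff g ^ k) \<beta> = q * g + s" "degree s < degree g"
        using pseudo_division[OF A1(1) gA dg \<beta>(1)] by blast
      have "poly (smult (lead_coeff g ^ k) \<beta>) x = poly (q * g + s) x" using s(3) by simp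
      then have eq: "lead_coeff g ^ k * b = poly q x * poly g x + poly s x" by (simp add: \<beta>)
      have qgP: "poly q x * poly g x \<in> P"
        using gx s(1) sub x by (intro ideal_inD(4)[OF PI] subring_on_poly[OF A]) auto
      have "lead_coeff g ^ k * b \<notin> P"
        using powP[of "lead_coeff g" k] lg bP Pp[OF _ bA, of "lead_coeff g ^ k"] lgA A1(2) subring_on_power[OF A] by blast
      then have "poly s x \<notin> P" using eq qgP ideal_inD(3)[OF PI] by auto
      then have sP: "\<not> coeffs_in P s" using inP by blast
      have "poly s x - poly [:lead_coeff g ^ k:] x * b = - (poly q x * poly g x)" using eq by simp
      also have "\<dots> \<in> P" using qgP by (rule ideal_in_minus(1)[OF PI A])
      finally show ?thesis
        using E_red[OF s(2) sP s(4), of "[:lead_coeff g ^ k:]"] subring_on_power[OF A1(1) lgA] coeffs_in_ops(2)[OF A1(1)]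
        by blast
    qed
    then obtain r where r: "E r" and rmin: "\<And>r'. E r' \<Longrightarrow> degree r \<le> degree r'"
      using ex_has_least_nat[of E _ degree] by blast
    obtain u where u: "coeffs_in A1 u" "poly r x - poly u x * b \<in> P" using r by (auto simp: E_def)
    have rA: "coeffs_in A1 r" and lr: "lead_coeff r \<notin> P" and drg: "degree r < degree g" using r by (auto simp: E_def)
    have lrA: "lead_coeff r \<in> A1" using rA by (simp add: coeffs_in_def)
    \<comment> \<open>Otherwise divide \<open>g\<close> by \<open>r\<close>. By minimality of
      \<open>r\<close> the remainder is zero modulo \<open>P\<close>, so \<open>q * r\<close> is a
      multiple of \<open>g\<close> modulo \<open>P\<close>; since \<open>r\<close> is no relation of
      \<open>x\<close>, \<open>q\<close> must be one.\<close>
    have r0: "degree r = 0"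
    proof (rule ccontr)
      assume "degree r \<noteq> 0"
      then have dr: "degree r > 0" by simp
      obtain k q s where s: "coeffs_in A1 q" "coeffs_in A1 s"
        "smult (lead_coeff r ^ k) g = q * r + s" "degree s < degree r"
        using pseudo_division[OF A1(1) rA dr gA] by blast
      have "poly (smult (lead_coeff r ^ k) g) x = poly (q * r + s) x" using s(3) by simp
      then have eq: "lead_coeff r ^ k * poly g x = poly q x * poly r x + poly s x" by simp
      have lhs: "lead_coeff r ^ k * poly g x \<in> P"
        using gx lrA A1(2) by (intro ideal_inD(4)[OF PI] subring_on_power[OF A]) auto
      have qA: "poly q x \<in> A" and rxA: "poly r x \<in> A" using s(1) rA sub x subring_on_poly[OF A] by auto
      have "coeffs_in P s"
      proof (rule ccontr)
        assume sP: "\<not> coeffs_in P s"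
        have "poly s x - poly (- (q * u)) x * b =
            lead_coeff r ^ k * poly g x - poly q x * (poly r x - poly u x * b)"
          using eq by (simp add: algebra_simps)
        also have "\<dots> \<in> P"
          using lhs ideal_inD(4)[OF PI qA u(2)] by (rule ideal_in_minus(2)[OF PI A])
        finally obtain r' where "E r'" "degree r' \<le> degree s"
          using E_red[OF s(2) sP, of "- (q * u)"] s(4) drg coeffs_in_ops(5,8)[OF A1(1)] s(1) u(1) by force
        with rmin[of r'] s(4) show False by simp
      qed
      then have "poly s x \<in> P" by (rule inP)
      then have "poly q x * poly r x \<in> P" using eq lhs ideal_in_minus(2)[OF PI A] by (metis add_diff_cancel_right')
      moreover have "poly r x \<notin> P"
        using small[OF rA _ drg] lr by (auto simp: coeffs_in_def)
      ultimately have qP: "poly q x \<in> P" using Pp qA rxA by blast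
      have top: "coeff (q * r) (degree g) = lead_coeff r ^ k * lead_coeff g"
      proof -
        have "coeff (smult (lead_coeff r ^ k) g) (degree g) = coeff (q * r) (degree g) + coeff s (degree g)"
          using s(3) by simp
        moreover have "coeff s (degree g) = 0" using s(4) drg by (intro coeff_eq_0) simp
        ultimately show ?thesis by simp
      qed
      have topP: "lead_coeff r ^ k * lead_coeff g \<notin> P"
        using Pp powP lr lg lrA lgA A1(2) subring_on_power[OF A] by (meson subsetD)
      have mulP: "coeff (p * r) i \<in> P" if "coeffs_in P p" for p i
        unfolding coeff_mult using rA A1(2) that
        by (intro ideal_in_sum[OF PI] ideal_inD(5)[OF PI]) (auto simp: coeffs_in_def)
      \<comment> \<open>If not, \<open>q\<close> has degree at least \<open>degree g\<close> modulo
        \<open>P\<close>. As \<open>degree r\<close> is positive, \<open>q * r\<close> then has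
        degree above that of \<open>g\<close> modulo \<open>P\<close>, which the division
        excludes.\<close>
      have "coeffs_in P q"
      proof (rule ccontr)
        assume "\<not> coeffs_in P q"
        from trunc[OF s(1) this] obtain q' where q': "coeffs_in A1 q'" "lead_coeff q' \<notin> P"
          "poly q x - poly q' x \<in> P" "coeffs_in P (q - q')" by blast
        have "poly q' x = poly q x - (poly q x - poly q' x)" by simp
        also have "\<dots> \<in> P" using qP q'(3) by (rule ideal_in_minus(2)[OF PI A])
        finally have "degree g \<le> degree q'" using gmin q' by (auto simp: G_def)
        then have "degree (smult (lead_coeff r ^ k) g - s) < degree q' + degree r"
          using degree_diff_le_max[of "smult (lead_coeff r ^ k) g" s] degree_smult_le[of "lead_coeff r ^ k" g] s(4) dr
          by linarith
        moreover have "smult (lead_coeff r ^ k) g - s = q * r" using s(3) by simp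
        ultimately have "coeff (q * r) (degree q' + degree r) = 0" by (intro coeff_eq_0) simp
        moreover have "q * r = q' * r + (q - q') * r" by (simp add: algebra_simps)
        ultimately have "lead_coeff q' * lead_coeff r = - coeff ((q - q') * r) (degree q' + degree r)"
          by (metis coeff_add coeff_mult_degree_sum eq_neg_iff_add_eq_0)
        also have "\<dots> \<in> P" using mulP[OF q'(4)] by (rule ideal_in_minus(1)[OF PI A])
        finally show False
          using Pp[of "lead_coeff q'" "lead_coeff r"] q'(1,2) lr lrA A1(2) by (auto simp: coeffs_in_def)
      qed
      then have "coeff (q * r) (degree g) \<in> P" by (rule mulP)
      then show False using top topP by simp
    qed
    then obtain e where e: "r = [:e:]" by (metis degree_eq_zeroE)
    have eP: "e \<notin> P" "e \<in> A1" using lr lrA e by auto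
    \<comment> \<open>A homomorphism not vanishing at the leading coefficient preserves the degree
      of \<open>g\<close>, so that a root exists; not vanishing at \<open>e\<close> will give a
      nonzero value at \<open>b\<close>.\<close>
    have "e * lead_coeff g \<in> A1 - P"
      using Pp[of e "lead_coeff g"] eP lg lgA A1(2) subring_onD(4)[OF A1(1)] by auto
    from ext[OF this] obtain h where h: "hom_extending A0 h0 P A1 h" "h (e * lead_coeff g) \<noteq> 0" by blast
    have hom: "ring_hom_on A1 h" using h(1) by (simp add: hom_extending_def)
    have hP: "h p = 0" if "p \<in> A1" "p \<in> P" for p using h(1) that by (simp add: hom_extending_def)
    have h0: "h 0 = 0" using ring_hom_onD(2)[OF hom A1(1)] .
    have hlg: "h (lead_coeff g) \<noteq> 0" and he: "h e \<noteq> 0"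
      using h(2) ring_hom_onD(4)[OF hom A1(1) eP(2) lgA] by auto
    have "degree (map_poly h g) = degree g"
      using hlg by (intro map_poly_degree_eq) auto
    then obtain \<xi> where \<xi>: "poly (map_poly h g) \<xi> = 0"
      using alg_closed_imp_poly_has_root[of "map_poly h g"] dg by auto
    \<comment> \<open>Pseudo-division of \<open>c\<close> by \<open>g\<close> leaves a remainder
      that is zero modulo \<open>P\<close> by minimality of \<open>g\<close>, and \<open>h\<close>
      maps the leading coefficient of \<open>g\<close> to a unit.\<close>
    have "poly (map_poly h c) \<xi> = 0" if c: "coeffs_in A1 c" "poly c x \<in> P" for c
    proof -
      obtain k q s where s: "coeffs_in A1 q" "coeffs_in A1 s"
        "smult (lead_coeff g ^ k) c = q * g + s" "degree s < degree g"
        using pseudo_division[OF A1(1) gA dg c(1)] by blast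
      have "poly (smult (lead_coeff g ^ k) c) x = poly (q * g + s) x" using s(3) by simp
      then have "poly s x = lead_coeff g ^ k * poly c x - poly q x * poly g x" by simp
      also have "\<dots> \<in> P"
        using c(2) gx s(1) sub x lgA A1(2)
        by (intro ideal_in_minus(2)[OF PI A] ideal_inD(4)[OF PI] subring_on_poly[OF A] subring_on_power[OF A]) auto
      finally have "coeffs_in P s" using small s by blast
      then have s0: "map_poly h s = 0"
        using s(2) by (intro poly_eqI) (auto simp: coeff_map_poly h0 hP coeffs_in_def)
      have lgk: "lead_coeff g ^ k \<in> A1" by (rule subring_on_power[OF A1(1) lgA])
      have "map_poly h ([:lead_coeff g ^ k:] * c) = map_poly h (q * g + s)" using s(3) by simp
      moreover have "map_poly h ([:lead_coeff g ^ k:] * c) = [:h (lead_coeff g) ^ k:] * map_poly h c"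
        using map_poly_hom_on(2)[OF hom A1(1) coeffs_in_ops(2)[OF A1(1) lgk] c(1)]
        by (simp add: map_poly_pCons h0 ring_hom_on_power[OF hom A1(1) lgA])
      moreover have "map_poly h (q * g + s) = map_poly h q * map_poly h g"
        using map_poly_hom_on(1)[OF hom A1(1) coeffs_in_ops(5)[OF A1(1) s(1) gA] s(2)]
          map_poly_hom_on(2)[OF hom A1(1) s(1) gA] s0 by simp
      ultimately have "poly ([:h (lead_coeff g) ^ k:] * map_poly h c) \<xi> = poly (map_poly h q * map_poly h g) \<xi>"
        by simp
      then show ?thesis using \<xi> hlg by simp
    qed
    from hom_extending_simple[OF h(1) A1(1,3) P0, of x \<xi>, OF this]
    obtain h' where h': "hom_extending A0 h0 P {poly c x | c. coeffs_in A1 c} h'"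
      "\<And>c. coeffs_in A1 c \<Longrightarrow> h' (poly c x) = poly (map_poly h c) \<xi>" by blast
    \<comment> \<open>Its value at \<open>x\<close> is \<open>e - poly u x * b\<close>, which lies
      in \<open>P\<close>. The extension therefore makes \<open>h e\<close> a multiple of
      \<open>h' b\<close>.\<close>
    define w where "w = [:e:] - u * \<beta>"
    have "coeffs_in A1 w" "poly w x \<in> P" unfolding w_def
      using eP u \<beta> e by (auto intro!: coeffs_in_ops[OF A1(1)])
    then have "h' (poly w x) = 0" using h'(1) by (auto simp: hom_extending_def)
    then have "poly (map_poly h w) \<xi> = 0" using h'(2) \<open>coeffs_in A1 w\<close> by simp
    moreover have "map_poly h [:e:] = map_poly h w + map_poly h u * map_poly h \<beta>"
      using map_poly_hom_on(1)[OF hom A1(1) \<open>coeffs_in A1 w\<close> coeffs_in_ops(5)[OF A1(1) u(1) \<beta>(1)]]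
        map_poly_hom_on(2)[OF hom A1(1) u(1) \<beta>(1)] by (simp add: w_def)
    then have "poly (map_poly h [:e:]) \<xi> = poly (map_poly h w + map_poly h u * map_poly h \<beta>) \<xi>" by simp
    ultimately have "h e = poly (map_poly h u) \<xi> * h' b"
      using h'(2)[OF \<beta>(1)] \<beta>(2) by (simp add: map_poly_pCons h0)
    then have "h' b \<noteq> 0" using he by auto
    with h'(1) show ?thesis by blast
  qed
qed


text \<open>Puts the adjunction of one generator into the form required by
  \<open>hom_extension_step\<close>.\<close>

lemma generated_subring_insert:
  assumes A: "subring_on A"
  shows "generated_subring (insert x A) = {poly c x | c. coeffs_in A c}" (is "_ = ?E")
proof
  have E: "subring_on ?E"
    unfolding subring_on_def
  proof (intro conjI ballI)
    have "1 = poly [:1:] x" "coeffs_in A [:1:]" using coeffs_in_ops(2)[OF A] subring_onD(1)[OF A] by auto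
    then show "1 \<in> ?E" by blast
    fix y assume "y \<in> ?E"
    then obtain c where c: "y = poly c x" "coeffs_in A c" by blast
    then have "- y = poly (- c) x" "coeffs_in A (- c)" using coeffs_in_ops(8)[OF A] by auto
    then show "- y \<in> ?E" by blast
    fix z assume "z \<in> ?E"
    then obtain d where d: "z = poly d x" "coeffs_in A d" by blast
    have "y + z = poly (c + d) x" "coeffs_in A (c + d)" using c d coeffs_in_ops(3)[OF A] by auto
    then show "y + z \<in> ?E" by blast
    have "y * z = poly (c * d) x" "coeffs_in A (c * d)" using c d coeffs_in_ops(5)[OF A] by auto
    then show "y * z \<in> ?E" by blast
  qed
  have "x = poly [:0, 1:] x" "coeffs_in A [:0, 1:]"
    using subring_onD(1,5)[OF A] by (auto simp: coeffs_in_def coeff_pCons split: nat.splits)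
  then have "x \<in> ?E" by blast
  moreover have "a \<in> ?E" if "a \<in> A" for a
  proof -
    have "a = poly [:a:] x" "coeffs_in A [:a:]" using coeffs_in_ops(2)[OF A that] by auto
    then show ?thesis by blast
  qed
  ultimately show "generated_subring (insert x A) \<subseteq> ?E"
    by (intro generated_subring_minimal E) auto
  have "coeffs_in (generated_subring (insert x A)) c" if "coeffs_in A c" for c
    using that by (auto simp: coeffs_in_def intro: generated_subring.gen)
  then show "?E \<subseteq> generated_subring (insert x A)"
    using subring_on_poly[OF subring_on_generated[of "insert x A"]] generated_subring.gen[of x "insert x A"] by blast
qed

lemma generated_subring_Un_insert:
  "generated_subring (A \<union> insert x X) = generated_subring (insert x (generated_subring (A \<union> X)))"
proof
  show "generated_subring (A \<union> insert x X) \<subseteq> generated_subring (insert x (generated_subring (A \<union> X)))"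
    by (intro generated_subring_minimal subring_on_generated) (auto intro: generated_subring.gen)
  have "generated_subring (A \<union> X) \<subseteq> generated_subring (A \<union> insert x X)"
    by (intro generated_subring_mono) auto
  then show "generated_subring (insert x (generated_subring (A \<union> X))) \<subseteq> generated_subring (A \<union> insert x X)"
    by (intro generated_subring_minimal subring_on_generated) (auto intro: generated_subring.gen)
qed

text \<open>A relative form of the weak Nullstellensatz.\<close>

theorem hom_extension:
  fixes h0 :: "'b::comm_ring_1 \<Rightarrow> 'c::{alg_closed_field, field_char_0}"
  assumes A0: "subring_on A0" and h0: "ring_hom_on A0 h0" and surj: "\<And>c. \<exists>a\<in>A0. h0 a = c"
    and X: "finite X"
    and proper: "1 \<notin> ideal_generated (generated_subring (A0 \<union> X)) {a \<in> A0. h0 a = 0}"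
  shows "\<exists>h. ring_hom_on (generated_subring (A0 \<union> X)) h \<and> (\<forall>a\<in>A0. h a = h0 a)"
proof -
  define A where "A = generated_subring (A0 \<union> X)"
  have A: "subring_on A" unfolding A_def by (rule subring_on_generated)
  have A0A: "A0 \<subseteq> A" by (auto simp: A_def intro: generated_subring.gen)
  have "ideal_in A (ideal_generated A {a \<in> A0. h0 a = 0})"
    by (rule ideal_in_ideal_generated[OF A]) (use A0A in blast)
  moreover have "1 \<notin> ideal_generated A {a \<in> A0. h0 a = 0}" using proper unfolding A_def .
  ultimately obtain P where P: "prime_in A P" "ideal_generated A {a \<in> A0. h0 a = 0} \<subseteq> P"
    using exists_prime_in[OF A] by metis
  have PI: "ideal_in A P" "1 \<notin> P" using P(1) by (auto simp: prime_in_def)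
  have ker: "a \<in> P" if "a \<in> A0" "h0 a = 0" for a
    using subset_trans[OF ideal_generated_superset[OF A] P(2)] that by auto
  \<comment> \<open>By surjectivity \<open>p\<close> would have an inverse \<open>a\<close> modulo
    the kernel of \<open>h0\<close>. The kernel lies in \<open>P\<close>, so
    \<open>1 - a * p\<close> and then 1 would lie in \<open>P\<close>.\<close>
  have kill: "h0 p = 0" if p: "p \<in> A0" "p \<in> P" for p
  proof (rule ccontr)
    assume "h0 p \<noteq> 0"
    obtain a where a: "a \<in> A0" "h0 a = 1 / h0 p" using surj by blast
    have "h0 (1 - a * p) = 0"
      using a p \<open>h0 p \<noteq> 0\<close> subring_onD[OF A0] ring_hom_onD[OF h0 A0] by simp
    then have "1 - a * p \<in> P" using a p by (intro ker) (auto intro: subring_onD[OF A0])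
    then have "(1 - a * p) + a * p \<in> P" using a p A0A by (intro ideal_inD(3)[OF PI(1)] ideal_inD(4)[OF PI(1)]) auto
    then show False using PI(2) by simp
  qed
  \<comment> \<open>The generators are added one at a time. The freedom to prescribe an element
    \<open>b\<close> outside \<open>P\<close> at which the extension does not vanish is what carries
    the induction.\<close>
  have ext: "\<exists>h. hom_extending A0 h0 P (generated_subring (A0 \<union> Y)) h \<and> h b \<noteq> 0"
    if "Y \<subseteq> X" "b \<in> generated_subring (A0 \<union> Y) - P" for Y b
    using finite_subset[OF that(1) X] that
  proof (induction Y arbitrary: b)
    case empty
    have gen: "generated_subring (A0 \<union> {}) = A0"
      using generated_subring_minimal[OF A0 subset_refl] by (auto intro: generated_subring.gen)
    have "hom_extending A0 h0 P A0 h0" using h0 kill by (simp add: hom_extending_def)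
    moreover have "h0 b \<noteq> 0" using empty.prems(2) ker[of b] unfolding gen by blast
    ultimately show ?case unfolding gen by blast
  next
    case (insert x Y)
    let ?B = "generated_subring (A0 \<union> Y)"
    have eq: "generated_subring (A0 \<union> insert x Y) = {poly c x | c. coeffs_in ?B c}"
      by (simp only: generated_subring_Un_insert generated_subring_insert[OF subring_on_generated])
    have 1: "?B \<subseteq> A" unfolding A_def using insert.prems by (intro generated_subring_mono) auto
    have 2: "A0 \<subseteq> ?B" by (auto intro: generated_subring.gen)
    have 3: "x \<in> A" unfolding A_def using insert.prems by (auto intro: generated_subring.gen)
    have 4: "Y \<subseteq> X" using insert.prems by simp
    show ?case
      unfolding eq
      by (rule hom_extension_step[OF A P(1) subring_on_generated 1 2 3 insert.IH[OF 4] insert.prems(2)[unfolded eq]])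
  qed
  have "1 \<in> A - P" using PI(2) subring_onD(1)[OF A] by simp
  from ext[OF subset_refl this[unfolded A_def]] show ?thesis
    unfolding hom_extending_def by blast
qed

section \<open>Relations in differential modules\<close>

lemma derivationD:
  assumes "derivation d"
  shows "d (x + y) = d x + d y" "d (x * y) = d x * y + x * d y" "d 0 = 0" "d 1 = 0" "d (- x) = - d x"
    "d (x - y) = d x - d y"
proof -
  show *: "d (x + y) = d x + d y" "d (x * y) = d x * y + x * d y" for x y
    using assms by (auto simp: derivation_def)
  show 0: "d 0 = 0" using *(1)[of 0 0] by simp
  show "d 1 = 0" using *(2)[of 1 1] by simp
  show m: "d (- x) = - d x" for x using *(1)[of x "- x"] 0 by (simp add: eq_neg_iff_add_eq_0 add.commute)
  show "d (x - y) = d x - d y" using *(1)[of x "- y"] m[of y] by simp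
qed

lemma derivation_sum: "derivation d \<Longrightarrow> d (\<Sum>i\<in>I. f i) = (\<Sum>i\<in>I. d (f i))"
  by (induction I rule: infinite_finite_induct) (auto simp: derivationD)

text \<open>The \<open>B\<close>-submodule spanned by \<open>W\<close>; it is of use only for finite
  \<open>W\<close>, as the sum over an infinite set is zero.\<close>

definition lincombs :: "('f \<Rightarrow> 'e::comm_ring_1) \<Rightarrow> 'f set \<Rightarrow> 'e set \<Rightarrow> 'e set" where
  "lincombs \<iota> B W = {\<Sum>w\<in>W. \<iota> (f w) * w | f. \<forall>w. f w \<in> B}"

text \<open>The coefficients range over the whole field and are zero outside \<open>W\<close>, so
  for finite \<open>W\<close> this is a subspace of a finite-dimensional space.\<close>

definition relations :: "('f \<Rightarrow> 'e::comm_ring_1) \<Rightarrow> 'e set \<Rightarrow> ('e \<Rightarrow> 'f::field) set" where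
  "relations \<iota> W = {f. (\<forall>w. w \<notin> W \<longrightarrow> f w = 0) \<and> (\<Sum>w\<in>W. \<iota> (f w) * w) = 0}"

locale diff_algebra =
  fixes dF :: "'f::field \<Rightarrow> 'f" and dE :: "'e::comm_ring_1 \<Rightarrow> 'e" and \<iota> :: "'f \<Rightarrow> 'e"
  assumes dF: "derivation dF" and dE: "derivation dE" and \<iota>: "diff_ring_hom_on UNIV dF dE \<iota>"
begin

lemma \<iota>_simps: "\<iota> 1 = 1" "\<iota> (x + y) = \<iota> x + \<iota> y" "\<iota> (x * y) = \<iota> x * \<iota> y" "\<iota> (dF x) = dE (\<iota> x)"
  "\<iota> 0 = 0" "\<iota> (- x) = - \<iota> x" "\<iota> (x - y) = \<iota> x - \<iota> y" "\<iota> (\<Sum>i\<in>I. f i) = (\<Sum>i\<in>I. \<iota> (f i))"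
proof -
  have h: "ring_hom_on UNIV \<iota>" and U: "subring_on (UNIV :: 'f set)"
    using \<iota> by (auto simp: ring_hom_on_def diff_ring_hom_on_def subring_on_def)
  note * = ring_hom_onD[OF h U, simplified]
  show "\<iota> (dF x) = dE (\<iota> x)" using \<iota> by (auto simp: diff_ring_hom_on_def)
  show "\<iota> 1 = 1" "\<iota> (x + y) = \<iota> x + \<iota> y" "\<iota> (x * y) = \<iota> x * \<iota> y"
    "\<iota> 0 = 0" "\<iota> (- x) = - \<iota> x" "\<iota> (x - y) = \<iota> x - \<iota> y"
    by (rule *)+
  show "\<iota> (\<Sum>i\<in>I. f i) = (\<Sum>i\<in>I. \<iota> (f i))" by (rule ring_hom_on_sum[OF h U]) simp
qed

lemma \<iota>_eq_0_iff [simp]: "\<iota> x = 0 \<longleftrightarrow> x = 0"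
proof
  assume "\<iota> x = 0"
  show "x = 0"
  proof (rule ccontr)
    assume "x \<noteq> 0"
    then have "\<iota> (inverse x * x) = 1" by (simp add: \<iota>_simps(1))
    with \<open>\<iota> x = 0\<close> show False by (simp only: \<iota>_simps) simp
  qed
qed (simp add: \<iota>_simps)

lemma \<iota>_inj: "\<iota> x = \<iota> y \<longleftrightarrow> x = y"
  using \<iota>_eq_0_iff[of "x - y"] by (simp only: \<iota>_simps) simp

context
  fixes B :: "'f set"
  assumes B: "subring_on B"
begin

lemma lincombs_closed:
  "0 \<in> lincombs \<iota> B W"
  "\<lbrakk>x \<in> lincombs \<iota> B W; y \<in> lincombs \<iota> B W\<rbrakk> \<Longrightarrow> x + y \<in> lincombs \<iota> B W"
  "\<lbrakk>a \<in> B; x \<in> lincombs \<iota> B W\<rbrakk> \<Longrightarrow> \<iota> a * x \<in> lincombs \<iota> B W"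
  "x \<in> lincombs \<iota> B W \<Longrightarrow> - x \<in> lincombs \<iota> B W"
proof -
  show "0 \<in> lincombs \<iota> B W"
    unfolding lincombs_def mem_Collect_eq
    by (rule exI[of _ "\<lambda>_. 0"]) (simp add: \<iota>_simps subring_onD[OF B])
  show "x + y \<in> lincombs \<iota> B W" if "x \<in> lincombs \<iota> B W" "y \<in> lincombs \<iota> B W"
  proof -
    obtain f g where "x = (\<Sum>w\<in>W. \<iota> (f w) * w)" "y = (\<Sum>w\<in>W. \<iota> (g w) * w)" "\<forall>w. f w \<in> B" "\<forall>w. g w \<in> B"
      using \<open>x \<in> _\<close> \<open>y \<in> _\<close> by (auto simp: lincombs_def)
    then show ?thesis unfolding lincombs_def mem_Collect_eq
      by (intro exI[of _ "\<lambda>w. f w + g w"])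
        (auto simp: \<iota>_simps distrib_right sum.distrib intro: subring_onD[OF B])
  qed
  show smult: "\<iota> a * x \<in> lincombs \<iota> B W" if a: "a \<in> B" and x: "x \<in> lincombs \<iota> B W" for a
  proof -
    obtain f where "x = (\<Sum>w\<in>W. \<iota> (f w) * w)" "\<forall>w. f w \<in> B"
      using x unfolding lincombs_def by blast
    then show ?thesis unfolding lincombs_def mem_Collect_eq using a
      by (intro exI[of _ "\<lambda>w. a * f w"])
        (auto simp: \<iota>_simps sum_distrib_left mult.assoc intro: subring_onD[OF B])
  qed
  show "- x \<in> lincombs \<iota> B W" if "x \<in> lincombs \<iota> B W"
    using smult[of "- 1"] that subring_onD(1,2)[OF B] by (simp add: \<iota>_simps)
qed

lemma lincombs_sum: "(\<And>i. i \<in> I \<Longrightarrow> g i \<in> lincombs \<iota> B W) \<Longrightarrow> (\<Sum>i\<in>I. g i) \<in> lincombs \<iota> B W"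
  by (induction I rule: infinite_finite_induct) (auto intro: lincombs_closed)

lemma lincombs_base:
  assumes "finite W" "w \<in> W"
  shows "w \<in> lincombs \<iota> B W"
proof -
  have "(\<Sum>v\<in>W. \<iota> (if v = w then 1 else 0) * v) = (\<Sum>v\<in>W. if v = w then v else 0)"
    by (intro sum.cong) (auto simp: \<iota>_simps)
  also have "\<dots> = w" using assms by simp
  finally show ?thesis
    unfolding lincombs_def mem_Collect_eq
    by (intro exI[of _ "\<lambda>v. if v = w then 1 else 0"]) (auto simp: subring_onD[OF B])
qed

lemma lincombs_minimal:
  assumes "\<And>w. w \<in> W \<Longrightarrow> w \<in> lincombs \<iota> B W'" "x \<in> lincombs \<iota> B W"
  shows "x \<in> lincombs \<iota> B W'"
  using assms by (auto simp: lincombs_def[of _ _ W] intro!: lincombs_sum lincombs_closed)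

lemma lincombs_mono: "\<lbrakk>finite W'; W \<subseteq> W'; x \<in> lincombs \<iota> B W\<rbrakk> \<Longrightarrow> x \<in> lincombs \<iota> B W'"
  by (rule lincombs_minimal[of W]) (auto intro: lincombs_base)

lemma lincombs_mult:
  assumes "finite W" "finite W'" "x \<in> lincombs \<iota> B W" "y \<in> lincombs \<iota> B W'"
  shows "x * y \<in> lincombs \<iota> B ((\<lambda>(w, w'). w * w') ` (W \<times> W'))"
proof -
  let ?V = "(\<lambda>(w, w'). w * w') ` (W \<times> W')"
  obtain f g where fg: "x = (\<Sum>w\<in>W. \<iota> (f w) * w)" "y = (\<Sum>w\<in>W'. \<iota> (g w) * w)" "\<forall>w. f w \<in> B" "\<forall>w. g w \<in> B"
    using assms(3,4) by (auto simp: lincombs_def)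
  have "x * y = (\<Sum>w\<in>W. \<Sum>w'\<in>W'. \<iota> (f w * g w') * (w * w'))"
    by (simp add: fg sum_product \<iota>_simps mult_ac)
  also have "\<dots> \<in> lincombs \<iota> B ?V"
    using fg assms(1,2) by (intro lincombs_sum lincombs_closed lincombs_base subring_onD(4)[OF B]) auto
  finally show ?thesis .
qed

lemma dE_lincombs:
  assumes "dF ` B \<subseteq> B" "\<And>w. w \<in> W \<Longrightarrow> dE w \<in> lincombs \<iota> B W" "finite W" "x \<in> lincombs \<iota> B W"
  shows "dE x \<in> lincombs \<iota> B W"
proof -
  obtain f where f: "x = (\<Sum>w\<in>W. \<iota> (f w) * w)" "\<forall>w. f w \<in> B"
    using assms(4) by (auto simp: lincombs_def)
  have "dE x = (\<Sum>w\<in>W. \<iota> (dF (f w)) * w + \<iota> (f w) * dE w)"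
    by (simp add: f derivation_sum[OF dE] derivationD[OF dE] \<iota>_simps)
  also have "\<dots> \<in> lincombs \<iota> B W"
  proof (intro lincombs_sum lincombs_closed(2,3))
    fix w assume w: "w \<in> W"
    show "w \<in> lincombs \<iota> B W" "dE w \<in> lincombs \<iota> B W" "f w \<in> B" "dF (f w) \<in> B"
      using w f(2) assms lincombs_base by auto
  qed
  finally show ?thesis .
qed

lemma lincombs_subset_subring:
  assumes "subring_on A" "\<iota> ` B \<subseteq> A" "W \<subseteq> A"
  shows "lincombs \<iota> B W \<subseteq> A"
  using assms(2,3) by (auto simp: lincombs_def intro!: subring_on_sum[OF assms(1)] subring_onD(4)[OF assms(1)])

text \<open>Finitely generated differential submodules containing 1 are closed under sums, by the
  union of the generators, and under products, by the pairwise products and the Leibniz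
  rule.\<close>

lemma locally_finite:
  assumes dB: "dF ` B \<subseteq> B" and X: "finite X" "\<And>x. x \<in> X \<Longrightarrow> dE x \<in> lincombs \<iota> B X"
    and u: "u \<in> generated_subring (\<iota> ` B \<union> X)"
  shows "\<exists>W. finite W \<and> 1 \<in> W \<and> W \<subseteq> generated_subring (\<iota> ` B \<union> X) \<and>
    (\<forall>w\<in>W. dE w \<in> lincombs \<iota> B W) \<and> u \<in> lincombs \<iota> B W"
  using u
proof induction
  case (gen x)
  let ?A = "generated_subring (\<iota> ` B \<union> X)"
  have 1: "1 \<in> ?A" by (rule generated_subring.one)
  show ?case
  proof (cases "x \<in> X")
    case True
    have "insert 1 X \<subseteq> ?A" using 1 by (auto intro: generated_subring.gen)
    moreover have "dE w \<in> lincombs \<iota> B (insert 1 X)" if "w \<in> insert 1 X" for w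
      using that X lincombs_mono[of "insert 1 X" X] lincombs_closed(1)
      by (cases "w = 1") (auto simp: derivationD[OF dE])
    ultimately show ?thesis
      using X True by (intro exI[of _ "insert 1 X"]) (auto intro: lincombs_base)
  next
    case False
    then obtain b where b: "x = \<iota> b" "b \<in> B" using gen by auto
    have "\<iota> b * 1 \<in> lincombs \<iota> B {1}" using b by (intro lincombs_closed lincombs_base) auto
    then show ?thesis using 1 b
      by (intro exI[of _ "{1}"]) (auto simp: derivationD[OF dE] intro: lincombs_closed)
  qed
next
  case one
  show ?case using generated_subring.one[of "\<iota> ` B \<union> X"]
    by (intro exI[of _ "{1}"]) (auto simp: derivationD[OF dE] intro: lincombs_closed lincombs_base)
next
  case (neg x)
  then show ?case using lincombs_closed(4) by blast
next
  case (add x y)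
  then obtain W W' where W: "finite W" "1 \<in> W" "W \<subseteq> generated_subring (\<iota> ` B \<union> X)"
    "\<forall>w\<in>W. dE w \<in> lincombs \<iota> B W" "x \<in> lincombs \<iota> B W"
    "finite W'" "W' \<subseteq> generated_subring (\<iota> ` B \<union> X)"
    "\<forall>w\<in>W'. dE w \<in> lincombs \<iota> B W'" "y \<in> lincombs \<iota> B W'" by blast
  have m: "z \<in> lincombs \<iota> B (W \<union> W')" if "z \<in> lincombs \<iota> B W \<or> z \<in> lincombs \<iota> B W'" for z
    using that W(1,6) lincombs_mono[of "W \<union> W'"] by blast
  show ?case
    using W m lincombs_closed(2) by (intro exI[of _ "W \<union> W'"]) auto
next
  case (mult x y)
  then obtain W W' where W: "finite W" "1 \<in> W" "W \<subseteq> generated_subring (\<iota> ` B \<union> X)"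
    "\<forall>w\<in>W. dE w \<in> lincombs \<iota> B W" "x \<in> lincombs \<iota> B W"
    "finite W'" "1 \<in> W'" "W' \<subseteq> generated_subring (\<iota> ` B \<union> X)"
    "\<forall>w\<in>W'. dE w \<in> lincombs \<iota> B W'" "y \<in> lincombs \<iota> B W'" by blast
  let ?V = "(\<lambda>(w, w'). w * w') ` (W \<times> W')"
  have "dE (w * w') \<in> lincombs \<iota> B ?V" if w: "w \<in> W" "w' \<in> W'" for w w'
    unfolding derivationD(2)[OF dE]
  proof (rule lincombs_closed(2))
    show "dE w * w' \<in> lincombs \<iota> B ?V"
      by (rule lincombs_mult[OF W(1,6) bspec[OF W(4) w(1)] lincombs_base[OF W(6) w(2)]])
    show "w * dE w' \<in> lincombs \<iota> B ?V"
      by (rule lincombs_mult[OF W(1,6) lincombs_base[OF W(1) w(1)] bspec[OF W(9) w(2)]])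
  qed
  then have "dE v \<in> lincombs \<iota> B ?V" if "v \<in> ?V" for v using that by auto
  moreover have "1 \<in> ?V" by (rule image_eqI[of _ _ "(1, 1)"]) (simp_all add: W)
  moreover have "?V \<subseteq> generated_subring (\<iota> ` B \<union> X)"
  proof safe
    fix w w' assume "w \<in> W" "w' \<in> W'"
    then show "w * w' \<in> generated_subring (\<iota> ` B \<union> X)"
      using W(3,8) by (intro generated_subring.mult) blast+
  qed
  moreover have "finite ?V" using W(1,6) by simp
  moreover have "x * y \<in> lincombs \<iota> B ?V" by (rule lincombs_mult[OF W(1,6) W(5,10)])
  ultimately show ?case by (intro exI[of _ ?V] conjI ballI)
qed

end

section \<open>Spaces of relations and derivations acting on them\<close>

lemma relations_closed:
  "f \<in> relations \<iota> W \<Longrightarrow> g \<in> relations \<iota> W \<Longrightarrow> (\<lambda>w. f w + g w) \<in> relations \<iota> W"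
  "f \<in> relations \<iota> W \<Longrightarrow> (\<lambda>w. a * f w) \<in> relations \<iota> W"
proof -
  show "f \<in> relations \<iota> W \<Longrightarrow> g \<in> relations \<iota> W \<Longrightarrow> (\<lambda>w. f w + g w) \<in> relations \<iota> W"
    by (auto simp: relations_def \<iota>_simps distrib_right sum.distrib)
  have "(\<Sum>w\<in>W. \<iota> (a * f w) * w) = \<iota> a * (\<Sum>w\<in>W. \<iota> (f w) * w)"
    by (simp add: \<iota>_simps sum_distrib_left mult.assoc)
  then show "f \<in> relations \<iota> W \<Longrightarrow> (\<lambda>w. a * f w) \<in> relations \<iota> W"
    by (auto simp: relations_def)
qed

lemma relations_diff:
  "f \<in> relations \<iota> W \<Longrightarrow> g \<in> relations \<iota> W \<Longrightarrow> (\<lambda>w. f w - g w) \<in> relations \<iota> W"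
  using relations_closed(1)[of f W "\<lambda>w. - 1 * g w"] relations_closed(2)[of g W "- 1"] by simp

text \<open>Differentiate the relation and expand each \<open>dE w\<close> through the structure
  constants \<open>c\<close>; collecting the coefficients of each generator gives the displayed
  family.\<close>

lemma relations_dF:
  assumes W: "finite W" and c: "\<And>w. w \<in> W \<Longrightarrow> dE w = (\<Sum>v\<in>W. \<iota> (c w v) * v)" and f: "f \<in> relations \<iota> W"
  shows "(\<lambda>v. if v \<in> W then dF (f v) + (\<Sum>w\<in>W. f w * c w v) else 0) \<in> relations \<iota> W"
proof -
  have "0 = dE (\<Sum>w\<in>W. \<iota> (f w) * w)" using f by (simp add: relations_def derivationD[OF dE])
  also have "\<dots> = (\<Sum>w\<in>W. \<iota> (dF (f w)) * w) + (\<Sum>w\<in>W. \<iota> (f w) * (\<Sum>v\<in>W. \<iota> (c w v) * v))"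
    by (simp add: derivation_sum[OF dE] derivationD[OF dE] \<iota>_simps sum.distrib c)
  also have "(\<Sum>w\<in>W. \<iota> (f w) * (\<Sum>v\<in>W. \<iota> (c w v) * v)) = (\<Sum>v\<in>W. \<Sum>w\<in>W. \<iota> (f w * c w v) * v)"
    by (subst sum.swap) (simp add: sum_distrib_left \<iota>_simps mult.assoc)
  also have "(\<Sum>w\<in>W. \<iota> (dF (f w)) * w) + (\<Sum>v\<in>W. \<Sum>w\<in>W. \<iota> (f w * c w v) * v) =
    (\<Sum>v\<in>W. \<iota> (if v \<in> W then dF (f v) + (\<Sum>w\<in>W. f w * c w v) else 0) * v)"
    unfolding sum.distrib[symmetric]
    by (intro sum.cong) (auto simp: \<iota>_simps distrib_right sum_distrib_right)
  finally show ?thesis by (simp add: relations_def)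
qed

end

text \<open>A subspace of a finite-dimensional space has a finite basis, and all but finitely many
  members of a locally finite family of derivations kill that basis.\<close>

lemma eventually_stable_subspace:
  fixes K :: "('e \<Rightarrow> 'f::field) set" and \<delta> :: "'i \<Rightarrow> nat \<Rightarrow> 'f \<Rightarrow> 'f"
  assumes \<delta>: "\<And>i j. derivation (\<delta> i j)" and fin: "\<And>x. \<exists>J. \<forall>i. \<forall>j\<ge>J. \<delta> i j x = 0"
    and W: "finite W"
    and K: "\<And>f w. f \<in> K \<Longrightarrow> w \<notin> W \<Longrightarrow> f w = 0" "\<And>f g. f \<in> K \<Longrightarrow> g \<in> K \<Longrightarrow> (\<lambda>w. f w + g w) \<in> K"
      "\<And>a f. f \<in> K \<Longrightarrow> (\<lambda>w. a * f w) \<in> K"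
  shows "\<exists>J. \<forall>i. \<forall>j\<ge>J. \<forall>f\<in>K. (\<lambda>w. \<delta> i j (f w)) \<in> K"
  using W K
proof (induction W arbitrary: K)
  case empty
  have "(\<lambda>w. \<delta> i j (f w)) = f" if "f \<in> K" for f i j
    using empty(1)[OF that] by (auto simp: derivationD(3)[OF \<delta>])
  then show ?case by auto
next
  case (insert w0 W)
  define K' where "K' = {f \<in> K. f w0 = 0}"
  have "\<exists>J. \<forall>i. \<forall>j\<ge>J. \<forall>f\<in>K'. (\<lambda>w. \<delta> i j (f w)) \<in> K'"
  proof (rule insert.IH)
    show "f w = 0" if "f \<in> K'" "w \<notin> W" for f w
      using insert.prems(1)[of f w] that by (cases "w = w0") (auto simp: K'_def)
  qed (use insert.prems(2,3) in \<open>auto simp: K'_def\<close>)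
  then obtain J1 where J1: "\<And>i j f. j \<ge> J1 \<Longrightarrow> f \<in> K' \<Longrightarrow> (\<lambda>w. \<delta> i j (f w)) \<in> K'" by blast
  show ?case
  proof (cases "K' = K")
    case True
    then show ?thesis using J1 by blast
  next
    case False
    then obtain b1 where b1: "b1 \<in> K" "b1 w0 \<noteq> 0" by (auto simp: K'_def)
    \<comment> \<open>A vector of \<open>K\<close> with entry 1 at \<open>w0\<close>; together with
      \<open>K'\<close> it spans \<open>K\<close>.\<close>
    define b where "b = (\<lambda>w. inverse (b1 w0) * b1 w)"
    have b: "b \<in> K" "b w0 = 1" using b1 insert.prems(3) by (auto simp: b_def)
    have "\<forall>w. \<exists>J. \<forall>i. \<forall>j\<ge>J. \<delta> i j (b w) = 0" using fin by blast
    from choice[OF this] obtain J where J: "\<And>w i j. j \<ge> J w \<Longrightarrow> \<delta> i j (b w) = 0" by blast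
    define J2 where "J2 = Max (J ` insert w0 W)"
    have kill: "\<delta> i j (b w) = 0" if "j \<ge> J2" for i j w
    proof (cases "w \<in> insert w0 W")
      case True
      then have "J w \<le> J2" unfolding J2_def using insert.hyps by (intro Max_ge) auto
      then show ?thesis using J that by auto
    next
      case False
      then show ?thesis using insert.prems(1)[OF b(1), of w] by (simp add: derivationD(3)[OF \<delta>])
    qed
    have "(\<lambda>w. \<delta> i j (f w)) \<in> K" if j: "j \<ge> max J1 J2" and f: "f \<in> K" for i j f
    proof -
      \<comment> \<open>The component of \<open>f\<close> in \<open>K'\<close>. Once
        \<open>\<delta> i j\<close> kills the entries of \<open>b\<close>, its value on
        \<open>f\<close> is its value on \<open>g\<close> plus a scalar multiple of
        \<open>b\<close>.\<close>
      define g where "g = (\<lambda>w. f w + (- f w0) * b w)"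
      have "g \<in> K" unfolding g_def using f b(1) by (intro insert.prems(2,3))
      then have "g \<in> K'" using b(2) by (simp add: K'_def g_def)
      then have "(\<lambda>w. \<delta> i j (g w)) \<in> K" using J1[of j g i] j by (simp add: K'_def)
      then have "(\<lambda>w. \<delta> i j (g w) + \<delta> i j (f w0) * b w) \<in> K"
        using b(1) by (intro insert.prems(2,3))
      moreover have "\<delta> i j (g w) + \<delta> i j (f w0) * b w = \<delta> i j (f w)" for w
        using kill[of j i w] j by (simp add: g_def derivationD[OF \<delta>])
      ultimately show ?thesis by simp
    qed
    then show ?thesis by blast
  qed
qed

text \<open>The model case is a localization of the differential polynomials, where \<open>\<delta> i j\<close> is the
  partial derivative with respect to the \<open>j\<close>-th derivative of the \<open>i\<close>-th indeterminate.\<close>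

locale diff_base =
  fixes dF :: "'f::field \<Rightarrow> 'f" and B :: "'f set" and \<delta> :: "'i \<Rightarrow> nat \<Rightarrow> 'f \<Rightarrow> 'f"
  assumes derivation_dF: "derivation dF" and derivation_\<delta>: "\<And>i j. derivation (\<delta> i j)"
    and B: "subring_on B" and dF_B: "dF ` B \<subseteq> B" and \<delta>_B: "\<And>i j. \<delta> i j ` B \<subseteq> B"
    and comm: "\<And>i j x. \<delta> i (Suc j) (dF x) = dF (\<delta> i (Suc j) x) + \<delta> i j x"
    and \<delta>_fin: "\<And>x. \<exists>J. \<forall>i. \<forall>j\<ge>J. \<delta> i j x = 0"
    and simple: "\<And>I. \<lbrakk>ideal_in B I; I \<noteq> {0}; dF ` I \<subseteq> I; \<And>i j. \<delta> i j ` I \<subseteq> I\<rbrakk> \<Longrightarrow> 1 \<in> I"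
    and denom: "\<And>x. \<exists>p\<in>B. p \<noteq> 0 \<and> p * x \<in> B"
begin

lemma \<delta>_fin_finite:
  assumes "finite X"
  shows "\<exists>J. \<forall>i. \<forall>j\<ge>J. \<forall>x\<in>X. \<delta> i j x = 0"
  using assms
proof induction
  case (insert x X)
  then obtain J where "\<forall>i. \<forall>j\<ge>J. \<forall>x\<in>X. \<delta> i j x = 0" by blast
  moreover obtain J' where "\<forall>i. \<forall>j\<ge>J'. \<delta> i j x = 0" using \<delta>_fin by blast
  ultimately show ?case by (intro exI[of _ "max J J'"]) auto
qed auto

text \<open>The commutator of \<open>\<delta> i (Suc j)\<close> with \<open>dF\<close> is
  \<open>\<delta> i j\<close>, so stability of \<open>I\<close> descends from order
  \<open>Suc j\<close> to order \<open>j\<close> until all orders are reached.\<close>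

lemma simple_eventually:
  assumes I: "ideal_in B I" "x \<in> I" "x \<noteq> 0" "dF ` I \<subseteq> I" and k: "\<And>i j. j \<ge> k \<Longrightarrow> \<delta> i j ` I \<subseteq> I"
  shows "1 \<in> I"
proof -
  have "\<delta> i j ` I \<subseteq> I" if "k \<le> j + m" for i j m
    using that
  proof (induction m arbitrary: j)
    case (Suc m)
    then have IH: "\<delta> i (Suc j) ` I \<subseteq> I" by simp
    have "\<delta> i j x = \<delta> i (Suc j) (dF x) - dF (\<delta> i (Suc j) x)" for x by (simp add: comm)
    moreover have "\<delta> i (Suc j) (dF x) \<in> I" "dF (\<delta> i (Suc j) x) \<in> I" if "x \<in> I" for x
      using IH I(4) that by blast+
    ultimately show ?case using ideal_in_minus(2)[OF I(1) B] by auto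
  qed (use k in simp)
  from this[of _ k] show ?thesis using I by (intro simple) auto
qed

lemma common_denom:
  assumes "finite W"
  shows "\<exists>p\<in>B. p \<noteq> 0 \<and> (\<forall>w\<in>W. p * f w \<in> B)"
  using assms
proof induction
  case empty
  then show ?case using subring_onD(1)[OF B] by (intro bexI[of _ 1]) auto
next
  case (insert w W)
  then obtain p where p: "p \<in> B" "p \<noteq> 0" "\<And>w. w \<in> W \<Longrightarrow> p * f w \<in> B" by blast
  obtain q where q: "q \<in> B" "q \<noteq> 0" "q * f w \<in> B" using denom by blast
  have "p * q * f v \<in> B" if "v \<in> insert w W" for v
  proof (cases "v = w")
    case True
    then show ?thesis using p q subring_onD(4)[OF B, of p "q * f w"] by (simp add: mult.assoc)
  next
    case False
    then show ?thesis using p q that subring_onD(4)[OF B, of q "p * f v"] by (simp add: mult_ac)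
  qed
  then show ?case using p q by (intro bexI[of _ "p * q"]) (auto intro: subring_onD[OF B])
qed

end

locale diff_base_algebra = diff_base dF B \<delta> + diff_algebra dF dE \<iota>
  for dF :: "'f::field \<Rightarrow> 'f" and B \<delta> and dE :: "'e::comm_ring_1 \<Rightarrow> 'e" and \<iota>
begin

text \<open>For large \<open>j\<close> this is finite-dimensionality; the commutator of \<open>\<delta> i (j + 1)\<close> with the
  derivation of the algebra then carries it down to every \<open>j\<close> from which on the structure
  constants are killed.\<close>

lemma relations_\<delta>:
  assumes W: "finite W" and c: "\<And>w. w \<in> W \<Longrightarrow> dE w = (\<Sum>v\<in>W. \<iota> (c w v) * v)"
    and k: "\<And>i j w v. j \<ge> k \<Longrightarrow> w \<in> W \<Longrightarrow> v \<in> W \<Longrightarrow> \<delta> i j (c w v) = 0"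
    and j: "j \<ge> k" and f: "f \<in> relations \<iota> W"
  shows "(\<lambda>w. \<delta> i j (f w)) \<in> relations \<iota> W"
proof -
  let ?K = "relations \<iota> W"
  have "\<exists>J. \<forall>i. \<forall>j\<ge>J. \<forall>f\<in>?K. (\<lambda>w. \<delta> i j (f w)) \<in> ?K"
    by (rule eventually_stable_subspace[of \<delta>, OF derivation_\<delta> \<delta>_fin W _ relations_closed])
      (simp add: relations_def)
  then obtain J where J: "\<And>i j f. j \<ge> J \<Longrightarrow> f \<in> ?K \<Longrightarrow> (\<lambda>w. \<delta> i j (f w)) \<in> ?K" by blast
  have "(\<lambda>w. \<delta> i j (f w)) \<in> ?K" if "j \<ge> k" "J \<le> j + m" "f \<in> ?K" for j m f
    using that
  proof (induction m arbitrary: j f)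
    case (Suc m)
    have IH: "(\<lambda>w. \<delta> i (Suc j) (f w)) \<in> ?K" if "f \<in> ?K" for f
      using Suc.IH[of "Suc j" f] Suc.prems that by simp
    \<comment> \<open>The action of the algebra's derivation on coefficient families. Its commutator
      with \<open>\<delta> i (Suc j)\<close> is \<open>\<delta> i j\<close>, because the structure
      constants are killed from order \<open>k\<close> on.\<close>
    let ?D = "\<lambda>f v. if v \<in> W then dF (f v) + (\<Sum>w\<in>W. f w * c w v) else 0"
    have D: "?D f \<in> ?K" if "f \<in> ?K" for f using W c that by (rule relations_dF)
    have "(\<lambda>v. \<delta> i (Suc j) (?D f v) - ?D (\<lambda>w. \<delta> i (Suc j) (f w)) v) \<in> ?K"
      by (intro relations_diff D IH Suc.prems)
    moreover have "\<delta> i (Suc j) (?D f v) - ?D (\<lambda>w. \<delta> i (Suc j) (f w)) v = \<delta> i j (f v)" for v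
    proof (cases "v \<in> W")
      case True
      have "\<delta> i (Suc j) (\<Sum>w\<in>W. f w * c w v) = (\<Sum>w\<in>W. \<delta> i (Suc j) (f w) * c w v)"
        using k[of "Suc j" _ v i] Suc.prems(1) True
        by (simp add: derivation_sum[OF derivation_\<delta>] derivationD[OF derivation_\<delta>])
      then show ?thesis using True by (simp add: derivationD[OF derivation_\<delta>] comm)
    next
      case False
      then have "f v = 0" using Suc.prems(3) by (simp add: relations_def)
      then show ?thesis using False by (simp add: derivationD[OF derivation_\<delta>])
    qed
    ultimately show ?case by simp
  qed (use J in simp)
  then show ?thesis using j f by (meson le_add2)
qed

lemma structure_constants:
  assumes "finite W" "\<forall>w\<in>W. dE w \<in> lincombs \<iota> B W"
  shows "\<exists>c k. (\<forall>w\<in>W. \<forall>v. c w v \<in> B) \<and> (\<forall>w\<in>W. dE w = (\<Sum>v\<in>W. \<iota> (c w v) * v)) \<and>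
    (\<forall>i. \<forall>j\<ge>k. \<forall>w\<in>W. \<forall>v\<in>W. \<delta> i j (c w v) = 0)"
proof -
  have "\<forall>w\<in>W. \<exists>f. dE w = (\<Sum>v\<in>W. \<iota> (f v) * v) \<and> (\<forall>v. f v \<in> B)"
    using assms(2) by (auto simp: lincombs_def)
  then obtain c where c: "\<And>w. w \<in> W \<Longrightarrow> dE w = (\<Sum>v\<in>W. \<iota> (c w v) * v)" "\<And>w v. w \<in> W \<Longrightarrow> c w v \<in> B"
    by metis
  obtain k where k: "\<forall>i. \<forall>j\<ge>k. \<forall>x\<in>(\<lambda>(w, v). c w v) ` (W \<times> W). \<delta> i j x = 0"
    using \<delta>_fin_finite[of "(\<lambda>(w, v). c w v) ` (W \<times> W)"] assms(1) by blast
  show ?thesis by (intro exI[of _ c] exI[of _ k]) (use c k in auto)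
qed

text \<open>As a nonzero vector, 1 is linearly independent over the field, and a linear functional
  can be prescribed on it.\<close>

lemma exists_functional: "\<exists>g. (\<forall>x y. g (x + y) = g x + g y) \<and> (\<forall>a x. g (\<iota> a * x) = a * g x) \<and> g 1 = 1"
proof -
  interpret vector_space_pair "\<lambda>a x. \<iota> a * x" "(*) :: 'f \<Rightarrow> 'f \<Rightarrow> 'f"
    by unfold_locales (auto simp: \<iota>_simps algebra_simps)
  have "vs1.independent {1}" by (simp add: vs1.independent_insert vs1.span_empty)
  from linear_independent_extend[OF this, of "\<lambda>_. 1"] obtain g
    where g: "Vector_Spaces.linear (\<lambda>a x. \<iota> a * x) (*) g" "g 1 = 1" by auto
  then show ?thesis
    by (intro exI[of _ g]) (auto simp: Vector_Spaces.linear_iff)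
qed

text \<open>The values at \<open>1\<close> of the \<open>B\<close>-valued functionals on a finitely generated differential
  submodule form an ideal that is stable under all derivations, hence the unit ideal.\<close>

lemma exists_retraction:
  assumes W: "finite W" "1 \<in> W" "\<And>w. w \<in> W \<Longrightarrow> dE w \<in> lincombs \<iota> B W"
  shows "\<exists>l. (\<forall>w\<in>W. l w \<in> B) \<and> l 1 = 1 \<and> (\<forall>f\<in>relations \<iota> W. (\<Sum>w\<in>W. f w * l w) = 0)"
proof -
  let ?K = "relations \<iota> W"
  have "\<forall>w\<in>W. dE w \<in> lincombs \<iota> B W" using W(3) by blast
  from structure_constants[OF W(1) this] obtain c k where
    ck: "(\<forall>w\<in>W. \<forall>v. c w v \<in> B) \<and> (\<forall>w\<in>W. dE w = (\<Sum>v\<in>W. \<iota> (c w v) * v)) \<and>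
      (\<forall>i. \<forall>j\<ge>k. \<forall>w\<in>W. \<forall>v\<in>W. \<delta> i j (c w v) = 0)" by (elim exE)
  then have c: "\<And>w v. w \<in> W \<Longrightarrow> c w v \<in> B" "\<And>w. w \<in> W \<Longrightarrow> dE w = (\<Sum>v\<in>W. \<iota> (c w v) * v)"
    and k: "\<And>i j w v. j \<ge> k \<Longrightarrow> w \<in> W \<Longrightarrow> v \<in> W \<Longrightarrow> \<delta> i j (c w v) = 0" by blast+
  \<comment> \<open>The \<open>B\<close>-valued functionals on the span of \<open>W\<close>, given
    by their values on the generators; annihilating all relations is what makes them well
    defined.\<close>
  define L where "L = {l. (\<forall>w\<in>W. l w \<in> B) \<and> (\<forall>f\<in>?K. (\<Sum>w\<in>W. f w * l w) = 0)}"
  define I where "I = {l 1 | l. l \<in> L}"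
  have II: "ideal_in B I"
    unfolding ideal_in_def
  proof (intro conjI ballI)
    show "I \<subseteq> B" using W(2) by (auto simp: I_def L_def)
    have "(\<lambda>_. 0) \<in> L" by (auto simp: L_def subring_onD[OF B])
    then show "0 \<in> I" by (force simp: I_def)
    fix x assume "x \<in> I"
    then obtain l where l: "x = l 1" "l \<in> L" by (auto simp: I_def)
    have "(\<lambda>w. a * l w) \<in> L" if a: "a \<in> B" for a
    proof -
      have "(\<Sum>w\<in>W. f w * (a * l w)) = a * (\<Sum>w\<in>W. f w * l w)" for f
        by (simp add: sum_distrib_left mult_ac)
      then show ?thesis using l a by (auto simp: L_def intro: subring_onD[OF B])
    qed
    then show "a * x \<in> I" if "a \<in> B" for a using that l by (force simp: I_def)
    fix y assume "y \<in> I"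
    then obtain m where m: "y = m 1" "m \<in> L" by (auto simp: I_def)
    have "(\<lambda>w. l w + m w) \<in> L"
      using l m by (auto simp: L_def distrib_left sum.distrib intro: subring_onD[OF B])
    then show "x + y \<in> I" using l m by (force simp: I_def)
  qed
  \<comment> \<open>A field-valued functional with value 1 at 1. Multiplying it by a common
    denominator \<open>p\<close> of its values on \<open>W\<close> shows that \<open>I\<close>
    contains the nonzero element \<open>p\<close>.\<close>
  obtain g where g: "\<And>x y. g (x + y) = g x + g y" "\<And>a x. g (\<iota> a * x) = a * g x" "g 1 = 1"
    using exists_functional by blast
  obtain p where p: "p \<in> B" "p \<noteq> 0" "\<And>w. w \<in> W \<Longrightarrow> p * g w \<in> B"
    using common_denom[OF W(1), of g] by blast
  have g0: "g 0 = 0" using g(2)[of 0 0] by (simp add: \<iota>_simps)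
  have gsum: "g (\<Sum>w\<in>W. h w) = (\<Sum>w\<in>W. g (h w))" for h :: "'e \<Rightarrow> 'e"
    using W(1) by (induction W) (auto simp: g g0)
  have "(\<lambda>w. p * g w) \<in> L"
  proof -
    have "(\<Sum>w\<in>W. f w * (p * g w)) = 0" if f: "f \<in> ?K" for f
    proof -
      have "(\<Sum>w\<in>W. f w * (p * g w)) = p * g (\<Sum>w\<in>W. \<iota> (f w) * w)"
        by (simp add: gsum g(2) sum_distrib_left mult.left_commute[of _ p])
      then show ?thesis using f by (simp add: relations_def g0)
    qed
    then show ?thesis using p by (auto simp: L_def)
  qed
  then have pI: "p \<in> I" unfolding I_def mem_Collect_eq using g(3) by (intro exI[of _ "\<lambda>w. p * g w"]) simp
  have "1 \<in> I"
  proof (rule simple_eventually[OF II pI p(2)])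
    show "dF ` I \<subseteq> I"
    proof safe
      fix x assume "x \<in> I"
      then obtain l where l: "x = l 1" "l \<in> L" by (auto simp: I_def)
      have lK: "(\<Sum>w\<in>W. f w * l w) = 0" if "f \<in> ?K" for f
        using l(2) that unfolding L_def by blast
      \<comment> \<open>The dual derivative of the functional: \<open>dF\<close> after
        \<open>l\<close> minus \<open>l\<close> after \<open>dE\<close>, evaluated on the
        generators.\<close>
      define m where "m w = dF (l w) - (\<Sum>v\<in>W. c w v * l v)" for w
      have "m w \<in> B" if "w \<in> W" for w
        unfolding m_def using l dF_B that c(1)
        by (intro subring_onD(6)[OF B] subring_on_sum[OF B] subring_onD(4)[OF B]) (auto simp: L_def)
      moreover have "(\<Sum>w\<in>W. f w * m w) = 0" if f: "f \<in> ?K" for f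
      proof -
        have "0 = (\<Sum>v\<in>W. (if v \<in> W then dF (f v) + (\<Sum>w\<in>W. f w * c w v) else 0) * l v)"
          by (rule lK[OF relations_dF[OF W(1) c(2) f], symmetric])
        also have "\<dots> = (\<Sum>v\<in>W. dF (f v) * l v) + (\<Sum>v\<in>W. \<Sum>w\<in>W. f w * c w v * l v)"
          by (simp add: distrib_right sum.distrib sum_distrib_right)
        also have "(\<Sum>v\<in>W. \<Sum>w\<in>W. f w * c w v * l v) = (\<Sum>w\<in>W. f w * (\<Sum>v\<in>W. c w v * l v))"
          by (subst sum.swap) (simp add: sum_distrib_left mult.assoc)
        finally have 1: "(\<Sum>w\<in>W. f w * (\<Sum>v\<in>W. c w v * l v)) = - (\<Sum>v\<in>W. dF (f v) * l v)"
          by (simp add: eq_neg_iff_add_eq_0 add.commute)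
        have "0 = dF (\<Sum>w\<in>W. f w * l w)" using l f by (simp add: L_def derivationD[OF dF])
        also have "\<dots> = (\<Sum>w\<in>W. dF (f w) * l w) + (\<Sum>w\<in>W. f w * dF (l w))"
          by (simp add: derivation_sum[OF dF] derivationD[OF dF] sum.distrib)
        finally show ?thesis using 1 by (simp add: m_def right_diff_distrib sum_subtractf add.commute)
      qed
      ultimately have "m \<in> L" by (simp add: L_def)
      moreover have "m 1 = dF x"
      proof -
        \<comment> \<open>The structure constants of \<open>dE 1\<close> form a relation because
          \<open>dE 1 = 0\<close>; hence the correction term of \<open>m\<close> vanishes at
          1.\<close>
        have "(\<lambda>v. if v \<in> W then c 1 v else 0) \<in> ?K"
          using c(2)[OF W(2)] by (simp add: relations_def derivationD[OF dE])
        then have "(\<Sum>v\<in>W. (if v \<in> W then c 1 v else 0) * l v) = 0" by (rule lK)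
        then show ?thesis by (simp add: m_def l)
      qed
      ultimately show "dF x \<in> I" unfolding I_def mem_Collect_eq by (intro exI[of _ m]) simp
    qed
    show "\<delta> i j ` I \<subseteq> I" if j: "j \<ge> k" for i j
    proof safe
      fix x assume "x \<in> I"
      then obtain l where l: "x = l 1" "l \<in> L" by (auto simp: I_def)
      have lK: "(\<Sum>w\<in>W. f w * l w) = 0" if "f \<in> ?K" for f
        using l(2) that unfolding L_def by blast
      have "(\<Sum>w\<in>W. f w * \<delta> i j (l w)) = 0" if f: "f \<in> ?K" for f
      proof -
        \<comment> \<open>In the Leibniz expansion the terms with \<open>\<delta> i j (f w)\<close>
          sum to zero, as they come from another relation.\<close>
        have "0 = \<delta> i j (\<Sum>w\<in>W. f w * l w)" using l f by (simp add: L_def derivationD[OF derivation_\<delta>])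
        also have "\<dots> = (\<Sum>w\<in>W. \<delta> i j (f w) * l w) + (\<Sum>w\<in>W. f w * \<delta> i j (l w))"
          by (simp add: derivation_sum[OF derivation_\<delta>] derivationD[OF derivation_\<delta>] sum.distrib)
        also have "(\<Sum>w\<in>W. \<delta> i j (f w) * l w) = 0"
          by (rule lK[OF relations_\<delta>[OF W(1) c(2) k j f]])
        finally show ?thesis by simp
      qed
      moreover have "\<delta> i j (l w) \<in> B" if "w \<in> W" for w
        using subsetD[OF \<delta>_B imageI, of "l w" i j] l(2) that by (simp add: L_def)
      ultimately have "(\<lambda>w. \<delta> i j (l w)) \<in> L" by (simp add: L_def)
      then show "\<delta> i j x \<in> I"
        unfolding I_def mem_Collect_eq using l(1) by (intro exI[of _ "\<lambda>w. \<delta> i j (l w)"]) simp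
    qed
  qed
  then show ?thesis by (auto simp: I_def L_def)
qed

text \<open>Here the ideal consists of the \<open>q\<close> for which \<open>q e\<close> lies in a fixed finitely generated
  differential submodule.\<close>

lemma constant_in_base:
  assumes X: "finite X" "\<And>x. x \<in> X \<Longrightarrow> dE x \<in> lincombs \<iota> B X"
    and e: "dE e = 0" and p: "p \<noteq> 0" "\<iota> p * e \<in> generated_subring (\<iota> ` B \<union> X)" "p \<in> B"
  shows "e \<in> generated_subring (\<iota> ` B \<union> X)"
proof -
  let ?A = "generated_subring (\<iota> ` B \<union> X)"
  obtain W where W: "finite W" "W \<subseteq> ?A" "\<And>w. w \<in> W \<Longrightarrow> dE w \<in> lincombs \<iota> B W" "\<iota> p * e \<in> lincombs \<iota> B W"
    using locally_finite[OF B dF_B X p(2)] by blast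
  show ?thesis
  proof (cases "e \<in> W")
    case True
    then show ?thesis using W by blast
  next
    case False
    \<comment> \<open>Adjoining \<open>e\<close> keeps the submodule differential since
      \<open>dE e = 0\<close>.\<close>
    let ?V = "insert e W"
    have V: "finite ?V" "\<And>w. w \<in> ?V \<Longrightarrow> dE w \<in> lincombs \<iota> B ?V"
      using W lincombs_mono[OF B, of ?V W] e lincombs_closed(1)[OF B] by auto
    have "\<forall>w\<in>?V. dE w \<in> lincombs \<iota> B ?V" using V(2) by blast
    from structure_constants[OF V(1) this] obtain c k where
      ck: "(\<forall>w\<in>?V. \<forall>v. c w v \<in> B) \<and> (\<forall>w\<in>?V. dE w = (\<Sum>v\<in>?V. \<iota> (c w v) * v)) \<and>
        (\<forall>i. \<forall>j\<ge>k. \<forall>w\<in>?V. \<forall>v\<in>?V. \<delta> i j (c w v) = 0)" by (elim exE)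
    then have c: "\<And>w. w \<in> ?V \<Longrightarrow> dE w = (\<Sum>v\<in>?V. \<iota> (c w v) * v)"
      and k: "\<And>i j w v. j \<ge> k \<Longrightarrow> w \<in> ?V \<Longrightarrow> v \<in> ?V \<Longrightarrow> \<delta> i j (c w v) = 0" by blast+
    define I where "I = {q \<in> B. \<iota> q * e \<in> lincombs \<iota> B W}"
    have II: "ideal_in B I"
      unfolding ideal_in_def
    proof (intro conjI ballI)
      show "I \<subseteq> B" by (auto simp: I_def)
      show "0 \<in> I" using lincombs_closed(1)[OF B] subring_onD(5)[OF B] by (simp add: I_def \<iota>_simps)
      fix x assume x: "x \<in> I"
      show "x + y \<in> I" if "y \<in> I" for y
        using x that lincombs_closed(2)[OF B] subring_onD(3)[OF B] by (simp add: I_def \<iota>_simps distrib_right)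
      show "a * x \<in> I" if "a \<in> B" for a
        using x that lincombs_closed(3)[OF B] subring_onD(4)[OF B] by (simp add: I_def \<iota>_simps mult.assoc)
    qed
    have pI: "p \<in> I" using W p by (simp add: I_def)
    have "1 \<in> I"
    proof (rule simple_eventually[OF II pI p(1)])
      show "dF ` I \<subseteq> I"
      proof safe
        fix q assume q: "q \<in> I"
        have "\<iota> (dF q) * e = dE (\<iota> q * e)" by (simp add: derivationD[OF dE] e \<iota>_simps)
        also have "\<dots> \<in> lincombs \<iota> B W"
          using q by (intro dE_lincombs[OF B dF_B W(3) W(1)]) (simp_all add: I_def)
        finally show "dF q \<in> I" using q dF_B by (auto simp: I_def)
      qed
      show "\<delta> i j ` I \<subseteq> I" if j: "j \<ge> k" for i j
      proof safe
        fix q assume q: "q \<in> I"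
        then obtain f where f: "\<iota> q * e = (\<Sum>w\<in>W. \<iota> (f w) * w)" "\<And>w. f w \<in> B"
          by (auto simp: I_def lincombs_def)
        \<comment> \<open>Membership of \<open>q\<close> in \<open>I\<close>, written as a relation
          between \<open>e\<close> and the generators in \<open>W\<close>. Since \<open>e\<close> is
          not in \<open>W\<close>, applying \<open>\<delta> i j\<close> to this relation expresses
          \<open>\<delta> i j q\<close> times \<open>e\<close> through \<open>W\<close>.\<close>
        define h where "h w = (if w = e then - q else if w \<in> W then f w else 0)" for w
        have hW: "(\<Sum>w\<in>W. \<iota> (F (h w)) * w) = (\<Sum>w\<in>W. \<iota> (F (f w)) * w)" for F :: "'f \<Rightarrow> 'f"
          using False by (intro sum.cong) (auto simp: h_def)
        have "h \<in> relations \<iota> ?V"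
          unfolding relations_def using W(1) False f(1) hW[of "\<lambda>x. x"]
          by (auto simp: h_def \<iota>_simps)
        from relations_\<delta>[OF V(1) c k j this, of i]
        have "\<iota> (\<delta> i j (h e)) * e + (\<Sum>w\<in>W. \<iota> (\<delta> i j (h w)) * w) = 0"
          using W(1) False by (simp add: relations_def)
        then have "\<iota> (\<delta> i j q) * e = (\<Sum>w\<in>W. \<iota> (\<delta> i j (f w)) * w)"
          by (simp add: hW) (simp add: h_def derivationD[OF derivation_\<delta>] \<iota>_simps)
        also have "\<dots> \<in> lincombs \<iota> B W"
        proof -
          have "\<forall>w. \<delta> i j (f w) \<in> B" using f(2) \<delta>_B by blast
          then show ?thesis unfolding lincombs_def mem_Collect_eq by (intro exI[of _ "\<lambda>w. \<delta> i j (f w)"]) simp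
        qed
        finally show "\<delta> i j q \<in> I" using q \<delta>_B by (auto simp: I_def)
      qed
    qed
    then have "e \<in> lincombs \<iota> B W" by (simp add: I_def \<iota>_simps)
    moreover have "lincombs \<iota> B W \<subseteq> ?A"
      using W(2) by (intro lincombs_subset_subring[OF B]) (auto intro: subring_on_generated generated_subring.gen)
    ultimately show ?thesis by blast
  qed
qed

text \<open>By the relative Nullstellensatz it suffices that the kernel of \<open>ev\<close>
  generates a proper ideal. If 1 were a combination with coefficients in the kernel, a retraction
  onto \<open>B\<close> would turn it into an equation in \<open>B\<close> that \<open>ev\<close>
  maps to \<open>1 = 0\<close>.\<close>

lemma extend_point:
  fixes ev :: "'f \<Rightarrow> 'c::{alg_closed_field, field_char_0}"
  assumes ev: "ring_hom_on B ev" and surj: "\<And>c. \<exists>b\<in>B. ev b = c"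
    and X: "finite X" "\<And>x. x \<in> X \<Longrightarrow> dE x \<in> lincombs \<iota> B X"
  shows "\<exists>h. ring_hom_on (generated_subring (\<iota> ` B \<union> X)) h \<and> (\<forall>b\<in>B. h (\<iota> b) = ev b)"
proof -
  let ?A = "generated_subring (\<iota> ` B \<union> X)"
  \<comment> \<open>The point transported to the image of \<open>B\<close>; the preimage is unique
    since \<iota> is injective.\<close>
  define h0 where "h0 y = ev (THE b. \<iota> b = y)" for y
  have h0: "h0 (\<iota> b) = ev b" for b by (simp add: h0_def \<iota>_inj)
  have sub: "subring_on (\<iota> ` B)"
    unfolding subring_on_def using subring_onD[OF B]
    by (auto simp flip: \<iota>_simps(1-3) \<iota>_simps(6))
  have hom: "ring_hom_on (\<iota> ` B) h0"
    using ring_hom_onD[OF ev B] h0[of 1]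
    by (auto simp: ring_hom_on_def h0 \<iota>_simps(1) simp flip: \<iota>_simps(2,3))
  have evsum: "ev (\<Sum>i\<in>I. g i) = (\<Sum>i\<in>I. ev (g i))" if "\<And>i. i \<in> I \<Longrightarrow> g i \<in> B" for g :: "'e \<Rightarrow> 'f" and I
    using ring_hom_on_sum[OF ev B that] .
  \<comment> \<open>Elements of the extended ideal have coefficients in the kernel of
    \<open>ev\<close> with respect to some finite differential generating set containing 1, as a
    retraction requires.\<close>
  have rep: "\<exists>W f. finite W \<and> 1 \<in> W \<and> (\<forall>w\<in>W. dE w \<in> lincombs \<iota> B W) \<and>
      (\<forall>w. f w \<in> B \<and> ev (f w) = 0) \<and> u = (\<Sum>w\<in>W. \<iota> (f w) * w)"
    if "u \<in> ideal_generated ?A {a \<in> \<iota> ` B. h0 a = 0}" for u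
    using that
  proof induction
    case zero
    show ?case using lincombs_closed(1)[OF B]
      by (intro exI[of _ "{1}"] exI[of _ "\<lambda>_. 0"])
        (auto simp: \<iota>_simps derivationD[OF dE] subring_onD[OF B] ring_hom_onD[OF ev B])
  next
    case (step u a m)
    from step.IH obtain W f where Wf: "finite W \<and> 1 \<in> W \<and> (\<forall>w\<in>W. dE w \<in> lincombs \<iota> B W) \<and>
      (\<forall>w. f w \<in> B \<and> ev (f w) = 0) \<and> u = (\<Sum>w\<in>W. \<iota> (f w) * w)" by (elim exE)
    then have W: "finite W" "1 \<in> W" "\<And>w. w \<in> W \<Longrightarrow> dE w \<in> lincombs \<iota> B W"
      and f: "\<And>w. f w \<in> B" "\<And>w. ev (f w) = 0" "u = (\<Sum>w\<in>W. \<iota> (f w) * w)" by simp_all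
    obtain b where b: "m = \<iota> b" "b \<in> B" "ev b = 0" using step by (auto simp: h0)
    obtain W' where W': "finite W'" "\<And>w. w \<in> W' \<Longrightarrow> dE w \<in> lincombs \<iota> B W'" "a \<in> lincombs \<iota> B W'"
      using locally_finite[OF B dF_B X \<open>a \<in> ?A\<close>] by blast
    then obtain g where g: "a = (\<Sum>w\<in>W'. \<iota> (g w) * w)" "\<And>w. g w \<in> B" by (auto simp: lincombs_def)
    define F where "F w = (if w \<in> W then f w else 0) + (if w \<in> W' then g w * b else 0)" for w
    have "(\<Sum>w\<in>W \<union> W'. \<iota> (F w) * w) =
        (\<Sum>w\<in>W \<union> W'. if w \<in> W then \<iota> (f w) * w else 0) + (\<Sum>w\<in>W \<union> W'. if w \<in> W' then \<iota> (g w * b) * w else 0)"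
      unfolding sum.distrib[symmetric] by (intro sum.cong) (auto simp: F_def \<iota>_simps algebra_simps)
    also have "\<dots> = (\<Sum>w\<in>W. \<iota> (f w) * w) + (\<Sum>w\<in>W'. \<iota> (g w * b) * w)"
      using W(1) W'(1) by (simp add: sum.inter_restrict[symmetric] Int_absorb1 Int_absorb2)
    also have "(\<Sum>w\<in>W'. \<iota> (g w * b) * w) = a * m"
      by (simp add: g b \<iota>_simps sum_distrib_left sum_distrib_right mult_ac)
    finally have "u + a * m = (\<Sum>w\<in>W \<union> W'. \<iota> (F w) * w)" using f by simp
    moreover have "F w \<in> B" "ev (F w) = 0" for w
      using f(1,2) g(2) b subring_onD[OF B] ring_hom_onD[OF ev B] by (auto simp: F_def)
    moreover have "dE w \<in> lincombs \<iota> B (W \<union> W')" if "w \<in> W \<union> W'" for w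
      using that W W' lincombs_mono[OF B, of "W \<union> W'"] by blast
    ultimately show ?case using W(1,2) W'(1) by (intro exI[of _ "W \<union> W'"] exI[of _ F]) auto
  qed
  have "1 \<notin> ideal_generated ?A {a \<in> \<iota> ` B. h0 a = 0}"
  proof
    assume "1 \<in> ideal_generated ?A {a \<in> \<iota> ` B. h0 a = 0}"
    from rep[OF this] obtain W f where Wf: "finite W \<and> 1 \<in> W \<and> (\<forall>w\<in>W. dE w \<in> lincombs \<iota> B W) \<and>
      (\<forall>w. f w \<in> B \<and> ev (f w) = 0) \<and> 1 = (\<Sum>w\<in>W. \<iota> (f w) * w)" by (elim exE)
    then have W: "finite W" "1 \<in> W" "\<And>w. w \<in> W \<Longrightarrow> dE w \<in> lincombs \<iota> B W"
      and f: "\<And>w. f w \<in> B" "\<And>w. ev (f w) = 0" "1 = (\<Sum>w\<in>W. \<iota> (f w) * w)" by simp_all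
    obtain l where l: "\<And>w. w \<in> W \<Longrightarrow> l w \<in> B" "l 1 = 1"
      "\<And>f. f \<in> relations \<iota> W \<Longrightarrow> (\<Sum>w\<in>W. f w * l w) = 0"
      using exists_retraction[OF W] by blast
    \<comment> \<open>The equation \<open>1 = (\<Sum>w\<in>W. \<iota> (f w) * w)\<close> brought to
      one side; 1 is itself a generator.\<close>
    define F where "F w = (if w \<in> W then f w - (if w = 1 then 1 else 0) else 0)" for w
    have "(\<Sum>w\<in>W. \<iota> (F w) * w) = (\<Sum>w\<in>W. \<iota> (f w) * w) - (\<Sum>w\<in>W. if w = 1 then 1 else 0)"
      unfolding sum_subtractf[symmetric] by (intro sum.cong) (auto simp: F_def \<iota>_simps algebra_simps)
    also have "\<dots> = 0" using W f(3) by simp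
    finally have "F \<in> relations \<iota> W" by (simp add: relations_def F_def)
    from l(3)[OF this] have "0 = (\<Sum>w\<in>W. F w * l w)" by simp
    also have "\<dots> = (\<Sum>w\<in>W. f w * l w) - (\<Sum>w\<in>W. if w = 1 then l w else 0)"
      unfolding sum_subtractf[symmetric] by (intro sum.cong) (auto simp: F_def algebra_simps)
    finally have "(\<Sum>w\<in>W. f w * l w) = 1" using W l(2) by simp
    then have "ev (\<Sum>w\<in>W. f w * l w) = 1" by (simp add: ring_hom_onD[OF ev B])
    moreover have "ev (\<Sum>w\<in>W. f w * l w) = (\<Sum>w\<in>W. ev (f w * l w))"
      using f(1) l(1) by (intro evsum) (auto intro: subring_onD[OF B])
    moreover have "\<dots> = 0" using f l(1) by (intro sum.neutral) (auto simp: ring_hom_onD[OF ev B])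
    ultimately show False by simp
  qed
  from hom_extension[OF sub hom _ X(1) this] surj obtain h where
    "ring_hom_on ?A h" "\<forall>a\<in>\<iota> ` B. h a = h0 a" using h0 by (metis imageI)
  then show ?thesis using h0 by auto
qed

end

section \<open>Localizations of polynomial rings\<close>

lemma derivation_fract_deriv:
  fixes d :: "'a::idom \<Rightarrow> 'a"
  assumes d: "derivation d"
  shows "derivation (fract_deriv d)"
  unfolding derivation_def
proof (intro conjI allI)
  fix x y :: "'a fract"
  obtain a b where x: "x = Fract a b" "b \<noteq> 0" by (cases x)
  obtain u v where y: "y = Fract u v" "v \<noteq> 0" by (cases y)
  show "fract_deriv d (x + y) = fract_deriv d x + fract_deriv d y"
    using x(2) y(2) unfolding x(1) y(1)
    by (simp add: fract_deriv_Fract[OF d] eq_fract derivationD[OF d]) (simp add: algebra_simps)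
  show "fract_deriv d (x * y) = fract_deriv d x * y + x * fract_deriv d y"
    using x(2) y(2) unfolding x(1) y(1)
    by (simp add: fract_deriv_Fract[OF d] eq_fract derivationD[OF d]) (simp add: algebra_simps)
qed

lemma fract_deriv_to_fract: "derivation d \<Longrightarrow> fract_deriv d (to_fract p) = to_fract (d p)"
  by (simp add: to_fract_def fract_deriv_Fract derivationD)

text \<open>Differentiating \<open>x * to_fract b = to_fract a\<close> determines the value at
  \<open>x\<close> from the values at numerator and denominator.\<close>

lemma derivation_fract_eqI:
  fixes e e' :: "'a::idom fract \<Rightarrow> 'a fract"
  assumes e: "derivation e" "derivation e'" and eq: "\<And>p. e (to_fract p) = e' (to_fract p)"
  shows "e x = e' x"
proof -
  obtain a b where x: "x = Fract a b" "b \<noteq> 0" by (cases x)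
  have b: "to_fract b \<noteq> 0" using x(2) by (simp add: to_fract_def Zero_fract_def eq_fract)
  have ab: "x * to_fract b = to_fract a"
    using x(2) by (simp add: x(1) to_fract_def eq_fract)
  have "d x * to_fract b = d (to_fract a) - x * d (to_fract b)" if "derivation d" for d
    using derivationD(2)[OF that, of x "to_fract b"] by (simp add: ab)
  from this[OF e(1)] this[OF e(2)] have "e x * to_fract b = e' x * to_fract b" by (simp add: eq)
  then show ?thesis using b by simp
qed

lemma derivation_commutator:
  assumes "derivation d" "derivation e"
  shows "derivation (\<lambda>x. d (e x) - e (d x))"
  unfolding derivation_def by (simp add: derivationD[OF assms(1)] derivationD[OF assms(2)] algebra_simps)

definition multiplicative_set :: "'a::idom set \<Rightarrow> bool" where
  "multiplicative_set M \<longleftrightarrow> 1 \<in> M \<and> 0 \<notin> M \<and> (\<forall>x\<in>M. \<forall>y\<in>M. x * y \<in> M)"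

lemma multiplicative_setD:
  assumes "multiplicative_set M"
  shows "1 \<in> M" "x \<in> M \<Longrightarrow> x \<noteq> 0" "x \<in> M \<Longrightarrow> y \<in> M \<Longrightarrow> x * y \<in> M"
  using assms by (auto simp: multiplicative_set_def)

lemma localizationI: "s \<in> M \<Longrightarrow> Fract p s \<in> localization M"
  by (auto simp: localization_def)

lemma to_fract_in_localization: "multiplicative_set M \<Longrightarrow> to_fract p \<in> localization M"
  by (auto simp: to_fract_def multiplicative_set_def intro: localizationI)

lemma subring_on_localization:
  assumes M: "multiplicative_set M"
  shows "subring_on (localization M)"
  unfolding subring_on_def
proof (intro conjI ballI)
  show "1 \<in> localization M" using to_fract_in_localization[OF M, of 1] by simp
  fix x assume "x \<in> localization M"
  then obtain p s where x: "x = Fract p s" "s \<in> M" by (auto simp: localization_def)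
  then show "- x \<in> localization M" by (auto intro: localizationI)
  fix y assume "y \<in> localization M"
  then obtain q t where y: "y = Fract q t" "t \<in> M" by (auto simp: localization_def)
  have "s \<noteq> 0" "t \<noteq> 0" "s * t \<in> M" using x y multiplicative_setD[OF M] by auto
  then show "x + y \<in> localization M" "x * y \<in> localization M"
    unfolding x y by (auto intro: localizationI)
qed

lemma fract_deriv_localization:
  assumes M: "multiplicative_set M" and d: "derivation d"
  shows "fract_deriv d ` localization M \<subseteq> localization M"
proof safe
  fix x assume "x \<in> localization M"
  then obtain p s where x: "x = Fract p s" "s \<in> M" by (auto simp: localization_def)
  then show "fract_deriv d x \<in> localization M"
    using multiplicative_setD[OF M] by (auto simp: fract_deriv_Fract[OF d] intro: localizationI)
qed

text \<open>The commutator identity passes to fractions because both sides are derivations. A stable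
  ideal of the localization contracts to a stable ideal of the ring, which is nonzero after clearing
  a denominator.\<close>

lemma diff_base_localization:
  fixes d :: "'a::idom \<Rightarrow> 'a" and \<delta> :: "'i \<Rightarrow> nat \<Rightarrow> 'a \<Rightarrow> 'a"
  assumes M: "multiplicative_set M" and d: "derivation d" and \<delta>: "\<And>i j. derivation (\<delta> i j)"
    and comm: "\<And>i j p. \<delta> i (Suc j) (d p) = d (\<delta> i (Suc j) p) + \<delta> i j p"
    and fin: "\<And>p. \<exists>J. \<forall>i. \<forall>j\<ge>J. \<delta> i j p = 0"
    and simple: "\<And>I. \<lbrakk>ideal_in UNIV I; I \<noteq> {0}; d ` I \<subseteq> I; \<And>i j. \<delta> i j ` I \<subseteq> I\<rbrakk> \<Longrightarrow> 1 \<in> I"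
  shows "diff_base (fract_deriv d) (localization M) (\<lambda>i j. fract_deriv (\<delta> i j))"
proof
  note fd = derivation_fract_deriv[OF d] and f\<delta> = derivation_fract_deriv[OF \<delta>]
  show "derivation (fract_deriv d)" by (rule fd)
  show "derivation (fract_deriv (\<delta> i j))" for i j by (rule f\<delta>)
  show B: "subring_on (localization M)" by (rule subring_on_localization[OF M])
  show "fract_deriv d ` localization M \<subseteq> localization M" by (rule fract_deriv_localization[OF M d])
  show "fract_deriv (\<delta> i j) ` localization M \<subseteq> localization M" for i j
    by (rule fract_deriv_localization[OF M \<delta>])
  show "fract_deriv (\<delta> i (Suc j)) (fract_deriv d x) =
      fract_deriv d (fract_deriv (\<delta> i (Suc j)) x) + fract_deriv (\<delta> i j) x" for i j x
    using derivation_fract_eqI[OF derivation_commutator[OF f\<delta> fd] f\<delta>, of i "Suc j" i j x]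
    by (simp add: fract_deriv_to_fract[OF d] fract_deriv_to_fract[OF \<delta>] comm algebra_simps)
  show "\<exists>J. \<forall>i. \<forall>j\<ge>J. fract_deriv (\<delta> i j) x = 0" for x
  proof -
    obtain a b where x: "x = Fract a b" "b \<noteq> 0" by (cases x)
    obtain J where J: "\<forall>i. \<forall>j\<ge>J. \<delta> i j a = 0" using fin by blast
    obtain J' where J': "\<forall>i. \<forall>j\<ge>J'. \<delta> i j b = 0" using fin by blast
    have "fract_deriv (\<delta> i j) x = 0" if "j \<ge> max J J'" for i j
      using that J J' x(2) by (simp add: x(1) fract_deriv_Fract[OF \<delta>] fract_collapse)
    then show ?thesis by blast
  qed
  show "\<exists>p\<in>localization M. p \<noteq> 0 \<and> p * x \<in> localization M" for x
  proof -
    obtain a b where x: "x = Fract a b" "b \<noteq> 0" by (cases x)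
    have "to_fract b * x = to_fract a" using x by (simp add: to_fract_def eq_fract)
    moreover have "to_fract b \<noteq> 0" using x(2) by (simp add: to_fract_def Zero_fract_def eq_fract)
    ultimately show ?thesis using to_fract_in_localization[OF M] by metis
  qed
  fix I assume I: "ideal_in (localization M) I" "I \<noteq> {0}" "fract_deriv d ` I \<subseteq> I"
    "\<And>i j. fract_deriv (\<delta> i j) ` I \<subseteq> I"
  define J where "J = {p. to_fract p \<in> I}"
  have "1 \<in> J"
  proof (rule simple)
    show "ideal_in UNIV J"
      unfolding ideal_in_def J_def
      using ideal_inD(2)[OF I(1)] ideal_inD(3)[OF I(1)] ideal_inD(4)[OF I(1) to_fract_in_localization[OF M]]
      by simp
    show "d ` J \<subseteq> J" using I(3) by (auto simp: J_def simp flip: fract_deriv_to_fract[OF d])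
    show "\<delta> i j ` J \<subseteq> J" for i j
      using I(4)[of i j] by (auto simp: J_def simp flip: fract_deriv_to_fract[OF \<delta>])
    obtain x where x: "x \<in> I" "x \<noteq> 0" using I(2) ideal_inD(2)[OF I(1)] by blast
    then obtain p s where ps: "x = Fract p s" "s \<in> M"
      using ideal_inD(1)[OF I(1) x(1)] by (auto simp: localization_def)
    have s: "s \<noteq> 0" using multiplicative_setD(2)[OF M ps(2)] .
    have "to_fract s * x = to_fract p" using ps s by (simp add: to_fract_def eq_fract)
    then have "p \<in> J" using ideal_inD(4)[OF I(1) to_fract_in_localization[OF M] x(1), of s] by (simp add: J_def)
    moreover have "p \<noteq> 0" using x(2) ps(1) by (auto simp: fract_collapse)
    ultimately show "J \<noteq> {0}" by blast
  qed
  then show "1 \<in> I" by (simp add: J_def)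
qed

text \<open>In characteristic zero repeated differentiation takes a nonzero polynomial down to a
  nonzero constant.\<close>

lemma pderiv_simple:
  fixes I :: "'c::field_char_0 poly set"
  assumes I: "ideal_in UNIV I" "I \<noteq> {0}" "pderiv ` I \<subseteq> I"
  shows "1 \<in> I"
proof -
  have "1 \<in> I" if "p \<in> I" "p \<noteq> 0" for p
    using that
  proof (induction "degree p" arbitrary: p)
    case 0
    then obtain c where c: "p = [:c:]" by (metis degree_eq_zeroE)
    then have "[:inverse c:] * p = 1" using 0 by simp
    then show ?case using ideal_inD(4)[OF I(1), of "[:inverse c:]" p] 0 by simp
  next
    case (Suc n)
    have "pderiv p \<noteq> 0" using Suc.hyps(2) by (simp add: pderiv_eq_0_iff)
    moreover have "n = degree (pderiv p)" using Suc.hyps(2) by (simp add: degree_pderiv)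
    moreover have "pderiv p \<in> I" using Suc.prems(1) I(3) by blast
    ultimately show ?case using Suc.hyps(1) by blast
  qed
  moreover obtain p where "p \<in> I" "p \<noteq> 0" using I(2) ideal_inD(2)[OF I(1)] by blast
  ultimately show ?thesis by blast
qed

text \<open>Since \<open>pderiv\<close> alone has no proper nonzero stable ideal, the family
  \<delta> is taken to be zero and the commutator identity becomes \<open>0 = 0\<close>.\<close>

lemma diff_base_poly:
  assumes "multiplicative_set (M :: 'c::field_char_0 poly set)"
  shows "diff_base (fract_deriv pderiv) (localization M) (\<lambda>(i::unit) j. fract_deriv (\<lambda>_. 0))"
proof (rule diff_base_localization[OF assms derivation_pderiv])
  show "derivation (\<lambda>_::'c poly. 0::'c poly)" by (simp add: derivation_def)
qed (auto simp: pderiv_simple)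

section \<open>Partial derivatives of differential polynomials\<close>

definition monom_degree :: "('a \<Rightarrow>\<^sub>0 nat) \<Rightarrow> nat" where
  "monom_degree m = (\<Sum>v\<in>Poly_Mapping.keys m. Poly_Mapping.lookup m v)"

lemma monom_degree_superset:
  "\<lbrakk>finite V; Poly_Mapping.keys m \<subseteq> V\<rbrakk> \<Longrightarrow> monom_degree m = (\<Sum>v\<in>V. Poly_Mapping.lookup m v)"
  unfolding monom_degree_def by (intro sum.mono_neutral_left) (auto simp: in_keys_iff)

lemma monom_degree_add_single: "monom_degree (m + Poly_Mapping.single v 1) = Suc (monom_degree m)"
proof -
  let ?V = "insert v (Poly_Mapping.keys m)"
  have "Poly_Mapping.keys (m + Poly_Mapping.single v 1) \<subseteq> ?V"
    using keys_add[of m "Poly_Mapping.single v 1"] by auto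
  then have "monom_degree (m + Poly_Mapping.single v 1) =
      (\<Sum>w\<in>?V. Poly_Mapping.lookup (m + Poly_Mapping.single v 1) w)"
    by (intro monom_degree_superset) auto
  also have "\<dots> = (\<Sum>w\<in>?V. Poly_Mapping.lookup m w) + (\<Sum>w\<in>?V. if v = w then 1 else 0)"
    by (simp add: lookup_add lookup_single when_def sum.distrib)
  also have "(\<Sum>w\<in>?V. Poly_Mapping.lookup m w) = monom_degree m"
    by (rule monom_degree_superset[symmetric]) auto
  also have "(\<Sum>w\<in>?V. if v = w then 1 else (0::nat)) = 1"
    by (subst sum.delta') auto
  finally show ?thesis by simp
qed

lemma monom_split:
  assumes "Poly_Mapping.lookup (m :: 'a \<Rightarrow>\<^sub>0 nat) v \<noteq> 0"
  shows "m = (m - Poly_Mapping.single v 1) + Poly_Mapping.single v 1"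
  using assms by (intro poly_mapping_eqI) (auto simp: lookup_add lookup_minus lookup_single when_def)

lemma poly_mapping_sum_singles:
  "p = (\<Sum>m\<in>Poly_Mapping.keys p. Poly_Mapping.single m (Poly_Mapping.lookup p m))"
  by (intro poly_mapping_eqI) (simp add: lookup_sum lookup_single when_def in_keys_iff)

lemma poly_mapping_add_induct:
  assumes single: "\<And>m c. P (Poly_Mapping.single m c)" and add: "\<And>p q. P p \<Longrightarrow> P q \<Longrightarrow> P (p + q)"
  shows "P (p :: 'a \<Rightarrow>\<^sub>0 'b::comm_monoid_add)"
proof -
  have 0: "P 0" using single[of undefined 0] by simp
  have "P (\<Sum>m\<in>A. Poly_Mapping.single m (Poly_Mapping.lookup p m))" for A
    by (induction A rule: infinite_finite_induct) (auto intro: assms simp: 0)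
  then show ?thesis by (subst poly_mapping_sum_singles)
qed

text \<open>A monomial is built up by splitting off one variable at a time, with the total degree as
  measure.\<close>

lemma dpoly_induct [case_names const var add mult]:
  fixes p :: "('l, 'c::comm_ring_1) dpoly"
  assumes const: "\<And>c. P (dpoly_const c)" and var: "\<And>i j. P (dpoly_var i j)"
    and add: "\<And>p q. P p \<Longrightarrow> P q \<Longrightarrow> P (p + q)" and mult: "\<And>p q. P p \<Longrightarrow> P q \<Longrightarrow> P (p * q)"
  shows "P p"
proof (induction p rule: poly_mapping_add_induct)
  case (1 m c)
  have "P (Poly_Mapping.single m 1)"
  proof (induction "monom_degree m" arbitrary: m)
    case 0
    then have "m = 0"
      by (intro poly_mapping_eqI) (auto simp: monom_degree_def in_keys_iff)
    then show ?case using const[of 1] by (simp add: dpoly_const_def)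
  next
    case (Suc n)
    then obtain v where v: "Poly_Mapping.lookup m v \<noteq> 0"
      by (metis Suc.hyps(2) monom_degree_def nat.distinct(1) sum.neutral)
    let ?k = "m - Poly_Mapping.single v 1"
    have "n = monom_degree ?k"
      using Suc.hyps(2) monom_degree_add_single[of ?k v] monom_split[OF v] by simp
    then have "P (Poly_Mapping.single ?k 1)" by (rule Suc.hyps(1))
    then have "P (Poly_Mapping.single ?k 1 * dpoly_var (indet v) (dord v))" by (rule mult[OF _ var])
    also have "Poly_Mapping.single ?k 1 * dpoly_var (indet v) (dord v) =
        (Poly_Mapping.single (?k + Poly_Mapping.single v 1) 1 :: ('l, 'c) dpoly)"
      by (simp add: dpoly_var_def mult_single)
    finally show ?case using monom_split[OF v] by simp
  qed
  then have "P (dpoly_const c * Poly_Mapping.single m 1)" by (rule mult[OF const])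
  then show ?case by (simp add: dpoly_const_def mult_single)
qed (rule add)

text \<open>The partial derivative with respect to \<open>v\<close>. In a monomial without
  \<open>v\<close> the truncated subtraction leaves the exponents unchanged, but the coefficient is
  then zero.\<close>

definition dpoly_partial :: "'l dvar \<Rightarrow> ('l, 'c::comm_ring_1) dpoly \<Rightarrow> ('l, 'c) dpoly" where
  "dpoly_partial v p = (\<Sum>m\<in>Poly_Mapping.keys p.
     Poly_Mapping.single (m - Poly_Mapping.single v 1)
       (Poly_Mapping.lookup p m * of_nat (Poly_Mapping.lookup m v)))"

lemma dpoly_partial_superset:
  assumes "finite M" "Poly_Mapping.keys p \<subseteq> M"
  shows "dpoly_partial v p = (\<Sum>m\<in>M. Poly_Mapping.single (m - Poly_Mapping.single v 1)
       (Poly_Mapping.lookup p m * of_nat (Poly_Mapping.lookup m v)))"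
  unfolding dpoly_partial_def using assms
  by (intro sum.mono_neutral_left) (auto simp: in_keys_iff)

lemma dpoly_partial_add: "dpoly_partial v (p + q) = dpoly_partial v p + dpoly_partial v q"
proof -
  let ?M = "Poly_Mapping.keys p \<union> Poly_Mapping.keys q"
  show ?thesis
    using keys_add[of p q]
    by (simp add: dpoly_partial_superset[of ?M] lookup_add distrib_right single_add sum.distrib)
qed

lemma dpoly_partial_single:
  "dpoly_partial v (Poly_Mapping.single m c) =
     Poly_Mapping.single (m - Poly_Mapping.single v 1) (c * of_nat (Poly_Mapping.lookup m v))"
  by (cases "c = 0") (simp_all add: dpoly_partial_def)

lemma derivation_dpoly_partial: "derivation (dpoly_partial v :: ('l, 'c::comm_ring_1) dpoly \<Rightarrow> _)"
  unfolding derivation_def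
proof (intro conjI allI)
  fix p q :: "('l, 'c) dpoly"
  show "dpoly_partial v (p * q) = dpoly_partial v p * q + p * dpoly_partial v q"
  proof (induction p rule: poly_mapping_add_induct)
    case (1 m a)
    show ?case
    proof (induction q rule: poly_mapping_add_induct)
      case (1 n b)
      let ?e = "Poly_Mapping.single v 1 :: _ \<Rightarrow>\<^sub>0 nat"
      have "Poly_Mapping.single (m - ?e) (a * of_nat (Poly_Mapping.lookup m v)) * Poly_Mapping.single n b =
        (Poly_Mapping.single (m + n - ?e) (a * b * of_nat (Poly_Mapping.lookup m v)) :: ('l, 'c) dpoly)"
        using monom_shift[of m v n]
        by (cases "Poly_Mapping.lookup m v = 0") (simp_all add: mult_single ac_simps)
      moreover have "Poly_Mapping.single m a * Poly_Mapping.single (n - ?e) (b * of_nat (Poly_Mapping.lookup n v)) =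
        (Poly_Mapping.single (m + n - ?e) (a * b * of_nat (Poly_Mapping.lookup n v)) :: ('l, 'c) dpoly)"
        using monom_shift[of n v m]
        by (cases "Poly_Mapping.lookup n v = 0") (simp_all add: mult_single ac_simps)
      ultimately show ?case
        by (simp add: mult_single dpoly_partial_single lookup_add distrib_left single_add)
    qed (simp add: dpoly_partial_add algebra_simps)
  qed (simp add: dpoly_partial_add algebra_simps)
qed (rule dpoly_partial_add)

lemma dpoly_partial_const: "dpoly_partial v (dpoly_const c) = 0"
  by (simp add: dpoly_const_def dpoly_partial_single)

lemma dpoly_partial_var: "dpoly_partial v (dpoly_var i j) = (if v = Dvar i j then 1 else 0)"
  by (simp add: dpoly_var_def dpoly_partial_single lookup_single when_def)

lemma lookup_dpoly_partial:
  "Poly_Mapping.lookup (dpoly_partial v p) k =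
     Poly_Mapping.lookup p (k + Poly_Mapping.single v 1) * of_nat (Suc (Poly_Mapping.lookup k v))"
proof (induction p rule: poly_mapping_add_induct)
  case (1 m c)
  let ?e = "Poly_Mapping.single v 1 :: _ \<Rightarrow>\<^sub>0 nat"
  show ?case
  proof (cases "Poly_Mapping.lookup m v = 0")
    case True
    then have "m \<noteq> k + ?e" by (auto simp: lookup_add)
    then show ?thesis using True by (simp add: dpoly_partial_single lookup_single)
  next
    case False
    have "m - ?e = k \<longleftrightarrow> m = k + ?e" using monom_split[OF False] by auto
    moreover have "Poly_Mapping.lookup m v = Suc (Poly_Mapping.lookup k v)" if "m = k + ?e"
      using that by (simp add: lookup_add)
    ultimately show ?thesis by (simp add: dpoly_partial_single lookup_single when_def)
  qed
qed (simp add: dpoly_partial_add lookup_add distrib_right)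

lemma dpoly_derivation_eqI:
  fixes d e :: "('l, 'c::comm_ring_1) dpoly \<Rightarrow> ('l, 'c) dpoly"
  assumes d: "derivation d" "derivation e"
    and const: "\<And>c. d (dpoly_const c) = e (dpoly_const c)" and var: "\<And>i j. d (dpoly_var i j) = e (dpoly_var i j)"
  shows "d p = e p"
  by (induction p rule: dpoly_induct) (simp_all add: const var derivationD[OF d(1)] derivationD[OF d(2)])

text \<open>A commutator of derivations is a derivation, so it is enough to compare both sides on
  constants and on variables.\<close>

lemma dpoly_partial_deriv:
  "dpoly_partial (Dvar i (Suc j)) (dpoly_deriv p) =
     dpoly_deriv (dpoly_partial (Dvar i (Suc j)) p) + dpoly_partial (Dvar i j) p"
proof -
  note D = derivation_dpoly_deriv and P = derivation_dpoly_partial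
  have "dpoly_partial (Dvar i (Suc j)) (dpoly_deriv p) - dpoly_deriv (dpoly_partial (Dvar i (Suc j)) p) =
      dpoly_partial (Dvar i j) p"
    by (rule dpoly_derivation_eqI[OF derivation_commutator[OF P D] P])
      (auto simp: dpoly_partial_const dpoly_partial_var dpoly_deriv_const dpoly_deriv_var
        derivationD[OF P] derivationD[OF D])
  then show ?thesis by (simp add: algebra_simps)
qed

lemma dpoly_partial_eventually: "\<exists>J. \<forall>i. \<forall>j\<ge>J. dpoly_partial (Dvar i j) p = 0"
proof (induction p rule: dpoly_induct)
  case (var k l)
  show ?case by (intro exI[of _ "Suc l"]) (simp add: dpoly_partial_var)
next
  case (add p q)
  then obtain J J' where "\<forall>i. \<forall>j\<ge>J. dpoly_partial (Dvar i j) p = 0" "\<forall>i. \<forall>j\<ge>J'. dpoly_partial (Dvar i j) q = 0"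
    by blast
  then show ?case by (intro exI[of _ "max J J'"]) (simp add: dpoly_partial_add)
next
  case (mult p q)
  then obtain J J' where "\<forall>i. \<forall>j\<ge>J. dpoly_partial (Dvar i j) p = 0" "\<forall>i. \<forall>j\<ge>J'. dpoly_partial (Dvar i j) q = 0"
    by blast
  then show ?case by (intro exI[of _ "max J J'"]) (simp add: derivationD[OF derivation_dpoly_partial])
qed (simp add: dpoly_partial_const)

text \<open>A partial derivative with respect to a variable that occurs lowers the total degree;
  repeating this ends in a nonzero constant of the ideal.\<close>

lemma dpoly_partial_simple:
  fixes I :: "('l::countable, 'c::field_char_0) dpoly set"
  assumes I: "ideal_in UNIV I" "I \<noteq> {0}" "\<And>v. dpoly_partial v ` I \<subseteq> I"
  shows "1 \<in> I"
proof -
  have unit: "1 \<in> I" if p: "p \<in> I" "p \<noteq> 0" "\<And>m. m \<in> Poly_Mapping.keys p \<Longrightarrow> m = 0" for p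
  proof -
    define c where "c = Poly_Mapping.lookup p 0"
    have "p = Poly_Mapping.single 0 c"
      using p(3) by (intro poly_mapping_eqI) (auto simp: lookup_single when_def c_def in_keys_iff)
    moreover have "c \<noteq> 0" using p(2) calculation by auto
    ultimately have "dpoly_const (inverse c) * p = 1" by (simp add: dpoly_const_def mult_single)
    then show ?thesis using ideal_inD(4)[OF I(1), of "dpoly_const (inverse c)" p] p(1) by simp
  qed
  have "1 \<in> I" if "p \<in> I" "p \<noteq> 0" "\<And>m. m \<in> Poly_Mapping.keys p \<Longrightarrow> monom_degree m \<le> n" for p n
    using that
  proof (induction n arbitrary: p)
    case 0
    have "m = 0" if "m \<in> Poly_Mapping.keys p" for m
      using 0(3)[OF that] by (intro poly_mapping_eqI) (auto simp: monom_degree_def in_keys_iff)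
    with 0 show ?case by (intro unit)
  next
    case (Suc n)
    show ?case
    proof (cases "\<forall>m\<in>Poly_Mapping.keys p. m = 0")
      case True
      with Suc.prems show ?thesis by (intro unit) auto
    next
      case False
      then obtain m where m: "m \<in> Poly_Mapping.keys p" "m \<noteq> 0" by blast
      then obtain v where v: "Poly_Mapping.lookup m v \<noteq> 0"
        by (metis poly_mapping_eqI lookup_zero)
      let ?q = "dpoly_partial v p"
      \<comment> \<open>This coefficient is that of \<open>m\<close> in \<open>p\<close> times a
        positive integer, hence nonzero in characteristic zero.\<close>
      have "Poly_Mapping.lookup ?q (m - Poly_Mapping.single v 1) \<noteq> 0"
        using m(1) unfolding lookup_dpoly_partial monom_split[OF v, symmetric]
        by (simp add: in_keys_iff del: of_nat_Suc)
      then have "?q \<noteq> 0" by auto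
      moreover have "?q \<in> I" using I(3) Suc.prems(1) by blast
      moreover have "monom_degree k \<le> n" if k: "k \<in> Poly_Mapping.keys ?q" for k
      proof -
        have "k + Poly_Mapping.single v 1 \<in> Poly_Mapping.keys p"
          using k by (auto simp: in_keys_iff lookup_dpoly_partial)
        from Suc.prems(3)[OF this] show ?thesis by (simp only: monom_degree_add_single Suc_le_mono)
      qed
      ultimately show ?thesis by (intro Suc.IH)
    qed
  qed
  note main = this
  obtain p where p: "p \<in> I" "p \<noteq> 0" using I(2) ideal_inD(2)[OF I(1)] by blast
  show ?thesis
    by (rule main[OF p, of "Max (monom_degree ` Poly_Mapping.keys p)"]) simp
qed

lemma diff_base_dpoly:
  assumes "multiplicative_set (M :: ('l::countable, 'c::field_char_0) dpoly set)"
  shows "diff_base (fract_deriv dpoly_deriv) (localization M) (\<lambda>i j. fract_deriv (dpoly_partial (Dvar i j)))"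
proof (rule diff_base_localization[OF assms derivation_dpoly_deriv derivation_dpoly_partial
      dpoly_partial_deriv dpoly_partial_eventually])
  fix I :: "('l, 'c) dpoly set"
  assume I: "ideal_in UNIV I" "I \<noteq> {0}" "\<And>i j. dpoly_partial (Dvar i j) ` I \<subseteq> I"
  show "1 \<in> I" by (rule dpoly_partial_simple[OF I(1,2)]) (metis I(3) dvar.exhaust)
qed

section \<open>Taylor expansion of Picard-Vessiot rings\<close>

text \<open>The Taylor series of \<open>u\<close> along the derivation at the point
  \<open>h\<close>. For polynomials in z and evaluation at a, the formal variable stands for z -
  a.\<close>

definition taylor :: "('e \<Rightarrow> 'c::field_char_0) \<Rightarrow> ('e \<Rightarrow> 'e) \<Rightarrow> 'e \<Rightarrow> 'c fps" where
  "taylor h d u = Abs_fps (\<lambda>k. h ((d ^^ k) u) / fact k)"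

lemma taylor_nth: "fps_nth (taylor h d u) k = h ((d ^^ k) u) / fact k"
  by (simp add: taylor_def)

lemma taylor_deriv: "taylor h d (d u) = fps_deriv (taylor h d u)"
  by (rule fps_ext) (simp add: taylor_nth funpow_swap1 field_simps del: of_nat_Suc)

text \<open>Multiplicativity follows by induction on the coefficient: both sides obey the product
  rule and have the same constant term, and \<open>Suc n\<close> can be cancelled in characteristic
  zero.\<close>

lemma taylor_hom:
  fixes h :: "'e::comm_ring_1 \<Rightarrow> 'c::field_char_0"
  assumes h: "ring_hom_on A h" and A: "subring_on A" and d: "derivation d" "d ` A \<subseteq> A"
  shows "ring_hom_on A (taylor h d)"
  unfolding ring_hom_on_def
proof (intro conjI ballI)
  have pow: "(d ^^ k) u \<in> A" if "u \<in> A" for u k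
    using that d(2) by (induction k) auto
  have 0: "(d ^^ k) 1 = (if k = 0 then 1 else 0)" for k
  proof (induction k)
    case (Suc k)
    then show ?case by (cases k) (simp_all add: derivationD[OF d(1)])
  qed simp
  show "taylor h d 1 = 1"
    by (rule fps_ext) (simp add: taylor_nth 0 ring_hom_onD[OF h A])
  have add: "(d ^^ k) (u + v) = (d ^^ k) u + (d ^^ k) v" for u v k
    by (induction k) (simp_all add: derivationD[OF d(1)])
  show tadd: "taylor h d (u + v) = taylor h d u + taylor h d v" if "u \<in> A" "v \<in> A" for u v
    by (rule fps_ext) (simp add: taylor_nth add ring_hom_onD[OF h A] pow that add_divide_distrib)
  have "fps_nth (taylor h d (u * v)) n = fps_nth (taylor h d u * taylor h d v) n"
    if "u \<in> A" "v \<in> A" for u v n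
    using that
  proof (induction n arbitrary: u v)
    case 0
    then show ?case by (simp add: taylor_nth fps_mult_nth ring_hom_onD[OF h A])
  next
    case (Suc n)
    have dA: "d u \<in> A" "d v \<in> A" using Suc.prems d(2) by auto
    have "of_nat (Suc n) * fps_nth (taylor h d (u * v)) (Suc n) = fps_nth (taylor h d (d (u * v))) n"
      by (simp add: taylor_deriv del: of_nat_Suc)
    also have "\<dots> = fps_nth (taylor h d (d u * v)) n + fps_nth (taylor h d (u * d v)) n"
      using Suc.prems dA by (simp add: derivationD[OF d(1)] tadd subring_onD(4)[OF A])
    also have "\<dots> = fps_nth (fps_deriv (taylor h d u * taylor h d v)) n"
      using Suc.prems dA by (simp add: Suc.IH taylor_deriv mult.commute add.commute)
    also have "\<dots> = of_nat (Suc n) * fps_nth (taylor h d u * taylor h d v) (Suc n)"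
      by (simp only: fps_deriv_nth Suc_eq_plus1)
    finally show ?case by (simp del: of_nat_Suc)
  qed
  then show "taylor h d (u * v) = taylor h d u * taylor h d v" if "u \<in> A" "v \<in> A" for u v
    using that by (intro fps_ext) blast
qed

lemma taylor_const: "d u = 0 \<Longrightarrow> d 0 = 0 \<Longrightarrow> h 0 = 0 \<Longrightarrow> taylor h d u = fps_const (h u)"
proof -
  assume d: "d u = 0" "d 0 = 0" "h 0 = 0"
  have "(d ^^ k) u = (if k = 0 then u else 0)" for k
  proof (induction k)
    case (Suc k)
    then show ?case by (cases k) (simp_all add: d)
  qed simp
  then show ?thesis by (intro fps_ext) (simp add: taylor_nth d)
qed

text \<open>The equation expresses the coefficient of index \<open>Suc m\<close> through those of
  index at most \<open>m\<close>.\<close>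

lemma fps_linear_ode_unique:
  fixes Y Y' :: "('c::field_char_0 fps) ^ 'n ^ 'n"
  assumes Y: "\<And>i j. fps_deriv (Y $ i $ j) = (\<Sum>k\<in>UNIV. A $ i $ k * Y $ k $ j)"
    and Y': "\<And>i j. fps_deriv (Y' $ i $ j) = (\<Sum>k\<in>UNIV. A $ i $ k * Y' $ k $ j)"
    and init: "\<And>i j. fps_nth (Y $ i $ j) 0 = fps_nth (Y' $ i $ j) 0"
  shows "Y = Y'"
proof -
  have "fps_nth (Y $ i $ j) n = fps_nth (Y' $ i $ j) n" for i j n
  proof (induction n arbitrary: i j rule: less_induct)
    case (less n)
    show ?case
    proof (cases n)
      case 0
      then show ?thesis by (simp add: init)
    next
      case (Suc m)
      have "of_nat (Suc m) * fps_nth (Y $ i $ j) (Suc m) = fps_nth (fps_deriv (Y $ i $ j)) m"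
        by (simp del: of_nat_Suc)
      also have "\<dots> = fps_nth (fps_deriv (Y' $ i $ j)) m"
        unfolding Y Y' fps_sum_nth fps_mult_nth
        using Suc by (intro sum.cong refl arg_cong2[of _ _ _ _ "(*)"] less.IH) auto
      also have "\<dots> = of_nat (Suc m) * fps_nth (Y' $ i $ j) (Suc m)"
        by (simp del: of_nat_Suc)
      finally show ?thesis using Suc by (simp del: of_nat_Suc)
    qed
  qed
  then show ?thesis by (simp add: vec_eq_iff fps_eq_iff)
qed

section \<open>Matrices with entries in a subring and solution matrices\<close>

lemma entries_matrix_mult:
  assumes "subring_on A" "entries X \<subseteq> A" "entries Y \<subseteq> A"
  shows "entries (X ** Y) \<subseteq> A"
  using assms(2,3)
  by (fastforce simp: entries_def matrix_matrix_mult_def intro!: subring_on_sum[OF assms(1)] subring_onD(4)[OF assms(1)])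

lemma map_matrix_mult_on:
  assumes "ring_hom_on A f" "subring_on A" "entries X \<subseteq> A" "entries Y \<subseteq> A"
  shows "map_matrix f (X ** Y) = map_matrix f X ** map_matrix f Y"
proof -
  have "X $ i $ k \<in> A" "Y $ k $ j \<in> A" for i j k using assms(3,4) by (auto simp: entries_def)
  then show ?thesis
    by (simp add: vec_eq_iff map_matrix_def matrix_matrix_mult_def ring_hom_on_sum[OF assms(1,2)]
        ring_hom_onD(4)[OF assms(1,2)] subring_onD(4)[OF assms(2)])
qed

lemma map_matrix_one_on: "ring_hom_on A f \<Longrightarrow> subring_on A \<Longrightarrow> map_matrix f (mat 1) = mat 1"
  using ring_hom_onD(1,2)[of A f] by (simp add: vec_eq_iff map_matrix_def mat_def)

lemma matrix_inverse_unique: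
  fixes X :: "'a::comm_ring_1 ^ 'n ^ 'n"
  assumes "Y ** X = mat 1" "X ** Y' = mat 1"
  shows "Y = Y'"
  by (metis assms matrix_mul_assoc matrix_mul_lid matrix_mul_rid)

lemma finite_entries: "finite (entries (X :: 'a ^ 'n ^ 'm::finite))"
proof -
  have "entries X = (\<lambda>(i, j). X $ i $ j) ` (UNIV \<times> UNIV)" by (auto simp: entries_def)
  then show ?thesis by simp
qed

context diff_algebra
begin

text \<open>Differentiate \<open>Z ** Z' = mat 1\<close> and multiply by \<open>Z'\<close> from the
  left.\<close>

lemma dE_inverse_matrix:
  fixes A :: "'f ^ 'n::finite ^ 'n" and Z :: "'e ^ 'n ^ 'n"
  assumes Z: "\<And>i j. dE (Z $ i $ j) = (\<Sum>k\<in>UNIV. \<iota> (A $ i $ k) * Z $ k $ j)"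
    and Z': "Z ** Z' = mat 1" "Z' ** Z = mat 1"
  shows "dE (Z' $ i $ j) = - (\<Sum>k\<in>UNIV. \<iota> (A $ k $ j) * Z' $ i $ k)"
proof -
  let ?A = "map_matrix \<iota> A"
  have "map_matrix dE (Z ** Z') = map_matrix dE Z ** Z' + Z ** map_matrix dE Z'"
    by (simp add: vec_eq_iff map_matrix_def matrix_matrix_mult_def derivation_sum[OF dE]
        derivationD[OF dE] sum.distrib)
  moreover have "map_matrix dE Z = ?A ** Z"
    by (simp add: vec_eq_iff map_matrix_def matrix_matrix_mult_def Z)
  moreover have "map_matrix dE (mat 1 :: 'e ^ 'n ^ 'n) = 0"
    by (simp add: vec_eq_iff map_matrix_def mat_def derivationD[OF dE])
  ultimately have "?A + Z ** map_matrix dE Z' = 0"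
    using Z'(1) by (simp add: matrix_mul_assoc[symmetric])
  then have "Z' ** (?A + Z ** map_matrix dE Z') = 0"
    by (simp add: vec_eq_iff matrix_matrix_mult_def)
  then have "Z' ** ?A + map_matrix dE Z' = 0"
    by (simp add: matrix_add_ldistrib matrix_mul_assoc Z'(2))
  then have "(Z' ** ?A + map_matrix dE Z') $ i $ j = 0" by simp
  then show ?thesis
    by (simp add: map_matrix_def matrix_matrix_mult_def mult.commute eq_neg_iff_add_eq_0 add.commute)
qed

text \<open>Makes the entries of a solution matrix and of its inverse a finite differential
  generating set, to which the module results apply.\<close>

lemma linear_generators:
  fixes A :: "'f ^ 'n::finite ^ 'n" and Z Z' :: "'e ^ 'n ^ 'n"
  assumes B: "subring_on B" and A: "entries A \<subseteq> B"
    and Z: "\<And>i j. dE (Z $ i $ j) = (\<Sum>k\<in>UNIV. \<iota> (A $ i $ k) * Z $ k $ j)"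
    and Z': "\<And>i j. dE (Z' $ i $ j) = - (\<Sum>k\<in>UNIV. \<iota> (A $ k $ j) * Z' $ i $ k)"
    and x: "x \<in> entries Z \<union> entries Z'"
  shows "dE x \<in> lincombs \<iota> B (entries Z \<union> entries Z')"
proof -
  let ?X = "entries Z \<union> entries Z'"
  have fin: "finite ?X" by (simp add: finite_entries)
  have base: "Z $ i $ j \<in> lincombs \<iota> B ?X" "Z' $ i $ j \<in> lincombs \<iota> B ?X" for i j
    by (rule lincombs_base[OF B fin]; auto simp: entries_def)+
  have AB: "A $ i $ j \<in> B" for i j using A by (auto simp: entries_def)
  from x consider i j where "x = Z $ i $ j" | i j where "x = Z' $ i $ j" by (auto simp: entries_def)
  then show ?thesis
  proof cases
    case 1
    then show ?thesis using base AB by (auto simp: Z intro!: lincombs_sum[OF B] lincombs_closed(3)[OF B])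
  next
    case 2
    then show ?thesis
      using base AB by (auto simp: Z' intro!: lincombs_closed(4)[OF B] lincombs_sum[OF B] lincombs_closed(3)[OF B])
  qed
qed

lemma dE_generated:
  assumes B: "subring_on B" "dF ` B \<subseteq> B" and X: "finite X" "\<And>x. x \<in> X \<Longrightarrow> dE x \<in> lincombs \<iota> B X"
  shows "dE ` generated_subring (\<iota> ` B \<union> X) \<subseteq> generated_subring (\<iota> ` B \<union> X)"
proof safe
  let ?A = "generated_subring (\<iota> ` B \<union> X)"
  note A = subring_on_generated[of "\<iota> ` B \<union> X"]
  fix u assume "u \<in> ?A"
  then show "dE u \<in> ?A"
  proof induction
    case (gen x)
    show ?case
    proof (cases "x \<in> X")
      case True
      have "lincombs \<iota> B X \<subseteq> ?A"
        by (rule lincombs_subset_subring[OF B(1) A]) (auto intro: generated_subring.gen)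
      with X(2)[OF True] show ?thesis by blast
    next
      case False
      then obtain b where b: "x = \<iota> b" "b \<in> B" using gen by auto
      then have "\<iota> (dF b) \<in> ?A" using B(2) by (intro generated_subring.gen) auto
      then show ?thesis by (simp add: b \<iota>_simps)
    qed
  next
    case (mult x y)
    then show ?case unfolding derivationD(2)[OF dE]
      by (intro subring_onD(3)[OF A] subring_onD(4)[OF A])
  next
    case (add x y)
    then show ?case unfolding derivationD(1)[OF dE] by (intro subring_onD(3)[OF A])
  next
    case (neg x)
    then show ?case unfolding derivationD(5)[OF dE] by (intro subring_onD(2)[OF A])
  qed (simp add: derivationD(4)[OF dE] subring_onD(5)[OF A])
qed

end

section \<open>The Taylor map on a Picard-Vessiot ring\<close>

context diff_base_algebra
begin

lemma clear_denominators:
  assumes "u \<in> generated_subring (range \<iota> \<union> X)"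
  shows "\<exists>p\<in>B. p \<noteq> 0 \<and> \<iota> p * u \<in> generated_subring (\<iota> ` B \<union> X)"
  using assms
proof induction
  case (gen x)
  show ?case
  proof (cases "x \<in> X")
    case True
    then have "\<iota> 1 * x \<in> generated_subring (\<iota> ` B \<union> X)"
      by (simp add: \<iota>_simps generated_subring.gen)
    then show ?thesis using subring_onD(1)[OF B] zero_neq_one by metis
  next
    case False
    then obtain a where a: "x = \<iota> a" using gen by auto
    obtain p where p: "p \<in> B" "p \<noteq> 0" "p * a \<in> B" using denom by blast
    then have "\<iota> (p * a) \<in> generated_subring (\<iota> ` B \<union> X)" by (intro generated_subring.gen) auto
    then show ?thesis using p by (auto simp: a \<iota>_simps)
  qed
next
  case one
  have "\<iota> 1 * 1 \<in> generated_subring (\<iota> ` B \<union> X)"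
    by (simp add: \<iota>_simps generated_subring.one)
  then show ?case using subring_onD(1)[OF B] zero_neq_one by metis
next
  case (neg x)
  then obtain p where p: "p \<in> B" "p \<noteq> 0" "\<iota> p * x \<in> generated_subring (\<iota> ` B \<union> X)" by blast
  from generated_subring.neg[OF p(3)] show ?case using p(1,2) by (intro bexI[of _ p]) auto
next
  case (add x y)
  then obtain p q where pq: "p \<in> B" "p \<noteq> 0" "\<iota> p * x \<in> generated_subring (\<iota> ` B \<union> X)"
    "q \<in> B" "q \<noteq> 0" "\<iota> q * y \<in> generated_subring (\<iota> ` B \<union> X)" by blast
  have "\<iota> q * (\<iota> p * x) + \<iota> p * (\<iota> q * y) \<in> generated_subring (\<iota> ` B \<union> X)"
    using pq by (intro generated_subring.add generated_subring.mult pq) (auto intro: generated_subring.gen)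
  then have "\<iota> (p * q) * (x + y) \<in> generated_subring (\<iota> ` B \<union> X)"
    by (simp add: \<iota>_simps algebra_simps)
  then show ?case using pq by (intro bexI[of _ "p * q"]) (auto intro: subring_onD(4)[OF B])
next
  case (mult x y)
  then obtain p q where pq: "p \<in> B" "p \<noteq> 0" "\<iota> p * x \<in> generated_subring (\<iota> ` B \<union> X)"
    "q \<in> B" "q \<noteq> 0" "\<iota> q * y \<in> generated_subring (\<iota> ` B \<union> X)" by blast
  have "(\<iota> p * x) * (\<iota> q * y) \<in> generated_subring (\<iota> ` B \<union> X)"
    by (intro generated_subring.mult pq)
  then have "\<iota> (p * q) * (x * y) \<in> generated_subring (\<iota> ` B \<union> X)"
    by (simp add: \<iota>_simps algebra_simps)
  then show ?case using pq by (intro bexI[of _ "p * q"]) (auto intro: subring_onD(4)[OF B])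
qed

text \<open>With zero \<delta> the base is differentially simple, so \<tau> is injective on it. The
  kernel, extended by denominators, is then a differential ideal without 1 of a simple ring.\<close>

lemma taylor_injective:
  fixes \<tau> :: "'e \<Rightarrow> 'c::field_char_0 fps"
  assumes \<delta>0: "\<And>i j x. \<delta> i j x = 0" and simpleE: "diff_simple dE"
    and R0: "R0 = generated_subring (\<iota> ` B \<union> X)" "dE ` R0 \<subseteq> R0"
    and gen: "generated_subring (range \<iota> \<union> X) = UNIV"
    and \<tau>: "ring_hom_on R0 \<tau>" "\<And>u. u \<in> R0 \<Longrightarrow> \<tau> (dE u) = fps_deriv (\<tau> u)"
    and u: "u \<in> R0" "\<tau> u = 0"
  shows "u = 0"
proof -
  have R0s: "subring_on R0" unfolding R0(1) by (rule subring_on_generated)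
  have \<iota>R0: "\<iota> b \<in> R0" if "b \<in> B" for b using that unfolding R0(1) by (auto intro: generated_subring.gen)
  note hom = ring_hom_onD[OF \<tau>(1) R0s]
  note R0D = subring_onD[OF R0s]
  have inj: "p = 0" if p: "p \<in> B" "\<tau> (\<iota> p) = 0" for p
  proof (rule ccontr)
    assume p0: "p \<noteq> 0"
    define J where "J = {p \<in> B. \<tau> (\<iota> p) = 0}"
    have "1 \<in> J"
    proof (rule simple)
      show "ideal_in B J"
        unfolding ideal_in_def J_def
        by (auto simp: \<iota>_simps hom \<iota>R0 intro: subring_onD[OF B])
      show "J \<noteq> {0}" using p p0 by (auto simp: J_def)
      show "dF ` J \<subseteq> J" using dF_B \<iota>R0 by (auto simp: J_def \<iota>_simps \<tau>(2))
      show "\<delta> i j ` J \<subseteq> J" for i j by (auto simp: \<delta>0 J_def \<iota>_simps hom subring_onD[OF B])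
    qed
    then show False by (simp add: J_def \<iota>_simps hom)
  qed
  \<comment> \<open>The ideal of the full ring spanned by the kernel: \<tau> is controlled only on
    \<open>R0\<close>, which a nonzero multiple from \<open>B\<close> reaches.\<close>
  define I where "I = {u. \<exists>p\<in>B. p \<noteq> 0 \<and> \<iota> p * u \<in> R0 \<and> \<tau> (\<iota> p * u) = 0}"
  have "differential_ideal dE I"
    unfolding differential_ideal_def
  proof (intro conjI ballI allI)
    show "0 \<in> I" unfolding I_def using subring_onD(1)[OF B] R0D(5) by (auto simp: hom intro!: bexI[of _ 1])
    fix x assume "x \<in> I"
    then obtain p where p: "p \<in> B" "p \<noteq> 0" "\<iota> p * x \<in> R0" "\<tau> (\<iota> p * x) = 0" by (auto simp: I_def)
    show "x + y \<in> I" if y: "y \<in> I" for y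
    proof -
      obtain q where q: "q \<in> B" "q \<noteq> 0" "\<iota> q * y \<in> R0" "\<tau> (\<iota> q * y) = 0" using y unfolding I_def by blast
      have eq: "\<iota> (p * q) * (x + y) = \<iota> q * (\<iota> p * x) + \<iota> p * (\<iota> q * y)" by (simp add: \<iota>_simps algebra_simps)
      have "\<iota> (p * q) * (x + y) \<in> R0" unfolding eq
        by (rule R0D(3)[OF R0D(4)[OF \<iota>R0[OF q(1)] p(3)] R0D(4)[OF \<iota>R0[OF p(1)] q(3)]])
      moreover have "\<tau> (\<iota> (p * q) * (x + y)) = 0"
        unfolding eq using p q \<iota>R0 by (simp add: hom R0D(4))
      ultimately show ?thesis unfolding I_def
        using p q subring_onD(4)[OF B] by (intro CollectI bexI[of _ "p * q"]) auto
    qed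
    show "r * x \<in> I" for r
    proof -
      obtain q where q: "q \<in> B" "q \<noteq> 0" "\<iota> q * r \<in> R0"
        using clear_denominators[of r X] gen unfolding R0(1) by auto
      have eq: "\<iota> (p * q) * (r * x) = (\<iota> q * r) * (\<iota> p * x)" by (simp add: \<iota>_simps algebra_simps)
      have "\<iota> (p * q) * (r * x) \<in> R0" unfolding eq by (rule R0D(4)[OF q(3) p(3)])
      moreover have "\<tau> (\<iota> (p * q) * (r * x)) = 0" unfolding eq using p q by (simp add: hom)
      ultimately show ?thesis unfolding I_def
        using p q subring_onD(4)[OF B] by (intro CollectI bexI[of _ "p * q"]) auto
    qed
    show "dE x \<in> I"
    proof -
      have eq: "\<iota> (p * p) * dE x = \<iota> p * dE (\<iota> p * x) - \<iota> (dF p) * (\<iota> p * x)"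
        by (simp add: \<iota>_simps derivationD[OF dE] algebra_simps)
      have d: "dE (\<iota> p * x) \<in> R0" "\<tau> (dE (\<iota> p * x)) = 0" using p R0(2) by (auto simp: \<tau>(2))
      have dp: "\<iota> (dF p) \<in> R0" using p(1) dF_B by (intro \<iota>R0) auto
      have "\<iota> (p * p) * dE x \<in> R0" unfolding eq
        by (rule R0D(6)[OF R0D(4)[OF \<iota>R0[OF p(1)] d(1)] R0D(4)[OF dp p(3)]])
      moreover have "\<tau> (\<iota> (p * p) * dE x) = 0" unfolding eq using p d dp \<iota>R0 by (simp add: hom R0D(4))
      ultimately show ?thesis unfolding I_def
        using p subring_onD(4)[OF B] by (intro CollectI bexI[of _ "p * p"]) auto
    qed
  qed
  then have "I = {0} \<or> I = UNIV" using simpleE by (simp add: diff_simple_def)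
  moreover have "1 \<notin> I" using inj by (auto simp: I_def)
  moreover have "u \<in> I" unfolding I_def
    using u subring_onD(1)[OF B] by (auto simp: \<iota>_simps intro!: bexI[of _ 1])
  ultimately show ?thesis by auto
qed

text \<open>Extend the point \<open>ev\<close> to the subalgebra over \<open>B\<close> and compose
  with Taylor expansion. Compatibility with derivations is a shift of Taylor coefficients, so it
  holds for every \<open>u\<close>.\<close>

lemma picard_vessiot_taylor:
  fixes ev :: "'f \<Rightarrow> 'c::{alg_closed_field, field_char_0}" and A :: "'f ^ 'n::finite ^ 'n"
  assumes ev: "ring_hom_on B ev" "\<And>c. \<exists>b\<in>B. ev b = c" and A: "entries A \<subseteq> B"
    and pv: "picard_vessiot_ring dF \<iota> dE A"
  shows "\<exists>(Z :: 'e ^ 'n ^ 'n) Z' \<tau>. Z ** Z' = mat 1 \<and> Z' ** Z = mat 1 \<and>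
    (\<forall>i j. dE (Z $ i $ j) = (\<Sum>k\<in>UNIV. \<iota> (A $ i $ k) * Z $ k $ j)) \<and>
    generated_subring (range \<iota> \<union> (entries Z \<union> entries Z')) = UNIV \<and>
    ring_hom_on (generated_subring (\<iota> ` B \<union> (entries Z \<union> entries Z'))) \<tau> \<and>
    (\<forall>u. \<tau> (dE u) = fps_deriv (\<tau> u)) \<and>
    (\<forall>b\<in>B. \<tau> (\<iota> b) = taylor ev dF b)"
proof -
  obtain Z where Z: "fundamental_matrix \<iota> dE A Z"
    and gen: "generated_subring (range \<iota> \<union> entries Z \<union> {w. w * det Z = 1}) = UNIV"
    using pv by (auto simp: picard_vessiot_ring_def)
  obtain Z' where Z': "Z ** Z' = mat 1" "Z' ** Z = mat 1"
    using Z by (auto simp: fundamental_matrix_def invertible_def)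
  let ?X = "entries Z \<union> entries Z'"
  have dZ: "dE (Z $ i $ j) = (\<Sum>k\<in>UNIV. \<iota> (A $ i $ k) * Z $ k $ j)" for i j
  proof -
    have "map_matrix dE Z = map_matrix \<iota> A ** Z" using Z by (simp add: fundamental_matrix_def)
    then have "map_matrix dE Z $ i $ j = (map_matrix \<iota> A ** Z) $ i $ j" by simp
    then show ?thesis by (simp add: map_matrix_def matrix_matrix_mult_def)
  qed
  have lin: "dE x \<in> lincombs \<iota> B ?X" if "x \<in> ?X" for x
    using linear_generators[OF B A dZ dE_inverse_matrix[OF dZ Z'] that] .
  have fin: "finite ?X" by (simp add: finite_entries)
  \<comment> \<open>The generator inverse to \<open>det Z\<close> is \<open>det Z'\<close>, a
    polynomial in the entries of the inverse matrix.\<close>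
  have "w \<in> generated_subring (range \<iota> \<union> ?X)" if w: "w * det Z = 1" for w
  proof -
    have "det Z' * det Z = 1" using arg_cong[OF Z'(2), of det] by (simp add: det_mul)
    then have "w = det Z'" using w by (metis mult.assoc mult.commute mult_1)
    moreover have "Z' $ i $ j \<in> generated_subring (range \<iota> \<union> ?X)" for i j
      by (rule generated_subring.gen) (auto simp: entries_def)
    \<comment> \<open>Integers occur as the signs in \<open>det_def\<close>.\<close>
    moreover have nat: "of_nat m \<in> generated_subring (range \<iota> \<union> ?X)" for m
      by (induction m) (auto intro: subring_onD[OF subring_on_generated])
    have "of_int m \<in> generated_subring (range \<iota> \<union> ?X)" for m
      using nat by (cases m rule: int_cases2) (auto intro: subring_onD(2)[OF subring_on_generated])
    with calculation show ?thesis unfolding det_def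
      by (auto intro!: subring_on_sum[OF subring_on_generated] subring_onD(4)[OF subring_on_generated]
          subring_on_prod[OF subring_on_generated])
  qed
  then have gen': "generated_subring (range \<iota> \<union> ?X) = UNIV"
    using generated_subring_minimal[OF subring_on_generated,
        of "range \<iota> \<union> entries Z \<union> {w. w * det Z = 1}" "range \<iota> \<union> ?X"] gen
    by (auto intro: generated_subring.gen)
  obtain h where h: "ring_hom_on (generated_subring (\<iota> ` B \<union> ?X)) h" "\<And>b. b \<in> B \<Longrightarrow> h (\<iota> b) = ev b"
    using extend_point[OF ev fin lin] by blast
  have hom: "ring_hom_on (generated_subring (\<iota> ` B \<union> ?X)) (taylor h dE)"
    by (rule taylor_hom[OF h(1) subring_on_generated dE dE_generated[OF B dF_B fin lin]])
  have base: "taylor h dE (\<iota> b) = taylor ev dF b" if "b \<in> B" for b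
  proof -
    have "(dE ^^ k) (\<iota> b) = \<iota> ((dF ^^ k) b)" for k by (induction k) (simp_all add: \<iota>_simps)
    moreover have "(dF ^^ k) b \<in> B" for k using that dF_B by (induction k) auto
    ultimately show ?thesis by (intro fps_ext) (simp add: taylor_nth h(2))
  qed
  show ?thesis
    by (rule exI[of _ Z], rule exI[of _ Z'], rule exI[of _ "taylor h dE"])
      (simp add: Z' dZ gen' hom base taylor_deriv)
qed

end

section \<open>Comparison of the Galois groups\<close>

lemma sum_fun_apply: "(\<Sum>i\<in>I. f i) x = (\<Sum>i\<in>I. f i x)"
  by (induction I rule: infinite_finite_induct) auto

lemma ring_hom_on_diff_automorphism:
  assumes "\<gamma> \<in> diff_automorphisms \<iota> d"
  shows "ring_hom_on UNIV \<gamma>" "\<gamma> (\<iota> a) = \<iota> a"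
  using assms by (auto simp: diff_automorphisms_def diff_ring_hom_on_def ring_hom_on_def)

lemma subring_on_UNIV: "subring_on UNIV"
  by (simp add: subring_on_def)

context diff_algebra
begin

lemma mult_constant_matrix:
  fixes A :: "'f ^ 'n::finite ^ 'n" and Z C :: "'e ^ 'n ^ 'n"
  assumes Z: "\<And>i j. dE (Z $ i $ j) = (\<Sum>k\<in>UNIV. \<iota> (A $ i $ k) * Z $ k $ j)"
    and C: "\<And>i j. dE (C $ i $ j) = 0"
  shows "dE ((Z ** C) $ i $ j) = (\<Sum>k\<in>UNIV. \<iota> (A $ i $ k) * (Z ** C) $ k $ j)"
proof -
  have "dE ((Z ** C) $ i $ j) = (\<Sum>l\<in>UNIV. (\<Sum>k\<in>UNIV. \<iota> (A $ i $ k) * Z $ k $ l) * C $ l $ j)"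
    by (simp add: matrix_matrix_mult_def derivation_sum[OF dE] derivationD[OF dE] Z C)
  also have "\<dots> = (\<Sum>k\<in>UNIV. \<iota> (A $ i $ k) * (Z ** C) $ k $ j)"
    unfolding sum_distrib_right matrix_matrix_mult_def
    by (subst sum.swap) (simp add: sum_distrib_left mult.assoc)
  finally show ?thesis .
qed

text \<open>The kernel of either projection is a differential ideal of the other factor, hence zero or
  everything by simplicity; in the latter case the subring contains \<open>(1, 0)\<close>. The product of
  the ring with itself is modelled by functions on \<open>bool\<close>.\<close>

lemma graph_of_automorphism:
  fixes G :: "(bool \<Rightarrow> 'e) set"
  assumes G: "subring_on G" and dG: "\<And>u. u \<in> G \<Longrightarrow> (\<lambda>b. dE (u b)) \<in> G"
    and \<iota>G: "\<And>a. (\<lambda>_. \<iota> a) \<in> G" and surj: "\<And>b r. \<exists>u\<in>G. u b = r" and simpleE: "diff_simple dE"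
    and idem: "(\<lambda>b. if b then 1 else 0) \<notin> G"
  shows "\<exists>\<gamma>\<in>diff_automorphisms \<iota> dE. \<forall>u\<in>G. \<gamma> (u True) = u False"
proof -
  have kernel: "u b = 0" if u: "u \<in> G" "u (\<not> b) = 0" for u b
  proof -
    define I where "I = {u b | u. u \<in> G \<and> u (\<not> b) = 0}"
    have II: "x \<in> I" if "u \<in> G" "u (\<not> b) = 0" "x = u b" for x u using that by (auto simp: I_def)
    have "differential_ideal dE I"
      unfolding differential_ideal_def
    proof (intro conjI ballI allI)
      show "0 \<in> I" by (rule II[OF subring_onD(5)[OF G]]) auto
      fix x assume "x \<in> I"
      then obtain u where u: "x = u b" "u \<in> G" "u (\<not> b) = 0" by (auto simp: I_def)
      show "x + y \<in> I" if y: "y \<in> I" for y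
      proof -
        obtain v where v: "y = v b" "v \<in> G" "v (\<not> b) = 0" using y by (auto simp: I_def)
        show ?thesis by (rule II[OF subring_onD(3)[OF G u(2) v(2)]]) (simp_all add: u v)
      qed
      show "r * x \<in> I" for r
      proof -
        obtain v where v: "v \<in> G" "v b = r" using surj by blast
        show ?thesis by (rule II[OF subring_onD(4)[OF G v(1) u(2)]]) (simp_all add: u v)
      qed
      show "dE x \<in> I" by (rule II[OF dG[OF u(2)]]) (simp_all add: u derivationD[OF dE])
    qed
    then have "I = {0} \<or> I = UNIV" using simpleE by (simp add: diff_simple_def)
    moreover have "1 \<notin> I"
    proof
      \<comment> \<open>The element of \<open>G\<close> with coordinate 1 at \<open>b\<close> and 0
        at the other place is \<open>(1, 0)\<close> or its complement \<open>(0, 1)\<close>.\<close>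
      assume "1 \<in> I"
      then obtain u where u: "u b = 1" "u \<in> G" "u (\<not> b) = 0" by (auto simp: I_def)
      have "(\<lambda>b. if b then 1 else 0) = (if b then u else 1 - u)"
        using u by (cases b) (auto simp: fun_eq_iff)
      moreover have "1 - u \<in> G" by (intro subring_onD(6)[OF G] subring_onD(1)[OF G] u)
      ultimately show False using idem u by (cases b) auto
    qed
    moreover have "u b \<in> I" using II[OF u] by simp
    ultimately show "u b = 0" by auto
  qed
  have uniq: "u = v" if "u \<in> G" "v \<in> G" "u b = v b" for u v b
  proof -
    have d: "u - v \<in> G" using that by (intro subring_onD(6)[OF G])
    have "(u - v) (\<not> b) = 0" using kernel[OF d, of "\<not> b"] that by simp
    then have "u x = v x" for x using that(3) by (cases "x = b") auto
    then show ?thesis by blast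
  qed
  \<comment> \<open>An element of \<open>G\<close> is determined by either coordinate, so
    \<open>G\<close> is the graph of a bijection from the coordinate \<open>True\<close> to the
    coordinate \<open>False\<close>.\<close>
  define \<gamma> where "\<gamma> r = (THE u. u \<in> G \<and> u True = r) False" for r
  have \<gamma>: "\<gamma> (u True) = u False" if "u \<in> G" for u
  proof -
    have "(THE v. v \<in> G \<and> v True = u True) = u"
      using that uniq[of _ u True] by (intro the_equality) auto
    then show ?thesis by (simp add: \<gamma>_def)
  qed
  have \<gamma>I: "\<exists>u\<in>G. r = u True \<and> \<gamma> r = u False" for r
    using surj[of True r] \<gamma> by metis
  have "inj \<gamma>"
  proof (rule injI)
    fix r r' assume eq: "\<gamma> r = \<gamma> r'"
    obtain u v where uv: "u \<in> G" "v \<in> G" "r = u True" "\<gamma> r = u False" "r' = v True" "\<gamma> r' = v False"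
      using \<gamma>I by metis
    then show "r = r'" using uniq[of u v False] eq by simp
  qed
  moreover have "surj \<gamma>" unfolding surj_def using surj[of False] \<gamma> by metis
  moreover have "diff_ring_hom_on UNIV dE dE \<gamma>"
    unfolding diff_ring_hom_on_def
  proof (intro conjI ballI)
    show "\<gamma> 1 = 1" using \<gamma>[OF subring_onD(1)[OF G]] by simp
    fix x y
    obtain u v where uv: "u \<in> G" "v \<in> G" "x = u True" "\<gamma> x = u False" "y = v True" "\<gamma> y = v False"
      using \<gamma>I by metis
    show "\<gamma> (x + y) = \<gamma> x + \<gamma> y" using \<gamma>[OF subring_onD(3)[OF G uv(1,2)]] uv by simp
    show "\<gamma> (x * y) = \<gamma> x * \<gamma> y" using \<gamma>[OF subring_onD(4)[OF G uv(1,2)]] uv by simp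
    show "\<gamma> (dE x) = dE (\<gamma> x)" using \<gamma>[OF dG[OF uv(1)]] uv by simp
  qed
  moreover have "\<gamma> (\<iota> a) = \<iota> a" for a using \<gamma>[OF \<iota>G[of a]] by simp
  ultimately show ?thesis using \<gamma> by (auto simp: diff_automorphisms_def bij_def)
qed

lemma product_algebra: "diff_algebra dF (\<lambda>u (b::bool). dE (u b)) (\<lambda>a _. \<iota> a)"
proof
  show "derivation (\<lambda>u (b::bool). dE (u b))"
    by (simp add: derivation_def fun_eq_iff derivationD[OF dE])
  show "diff_ring_hom_on UNIV dF (\<lambda>u (b::bool). dE (u b)) (\<lambda>a _. \<iota> a)"
    by (simp add: diff_ring_hom_on_def fun_eq_iff \<iota>_simps)
qed (rule dF)

end

text \<open>As a section of \<open>ev\<close>, \<kappa> makes the point surjective onto the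
  constants, and embedded constants have constant Taylor series.\<close>

definition constants_embedding :: "('c::field \<Rightarrow> 'f::field) \<Rightarrow> ('f \<Rightarrow> 'f) \<Rightarrow> 'f set \<Rightarrow> ('f \<Rightarrow> 'c) \<Rightarrow> bool" where
  "constants_embedding \<kappa> d B ev \<longleftrightarrow>
     ring_hom_on UNIV \<kappa> \<and> (\<forall>c. \<kappa> c \<in> B \<and> d (\<kappa> c) = 0 \<and> ev (\<kappa> c) = c)"

text \<open>Specialization is abstracted to a differential map \<open>s\<close> between two bases
  with compatible points; both Picard-Vessiot rings then have Taylor maps into the same power series
  ring.\<close>

theorem galois_group_specialization:
  fixes \<kappa>G :: "'c::{alg_closed_field, field_char_0} \<Rightarrow> 'f::field" and \<kappa>H :: "'c \<Rightarrow> 'k::field"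
    and \<iota>G :: "'f \<Rightarrow> 'r::comm_ring_1" and \<iota>H :: "'k \<Rightarrow> 's::comm_ring_1" and A :: "'f ^ 'n::finite ^ 'n"
  assumes G: "diff_base_algebra dF BG \<delta>G dG \<iota>G" and H: "diff_base_algebra dK BH \<delta>H dH \<iota>H"
    and \<delta>H: "\<And>i j x. \<delta>H i j x = 0"
    and evG: "ring_hom_on BG evG" and evH: "ring_hom_on BH evH"
    and \<kappa>G: "constants_embedding \<kappa>G dF BG evG" and \<kappa>H: "constants_embedding \<kappa>H dK BH evH"
    and s: "s ` BG \<subseteq> BH" "\<And>x. x \<in> BG \<Longrightarrow> s (dF x) = dK (s x)" "\<And>x. x \<in> BG \<Longrightarrow> evG x = evH (s x)"
    and A: "entries A \<subseteq> BG"
    and pvG: "picard_vessiot_ring dF \<iota>G dG A" and pvH: "picard_vessiot_ring dK \<iota>H dH (map_matrix s A)"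
  shows "\<exists>ZG ZH. fundamental_matrix \<iota>G dG A ZG \<and> fundamental_matrix \<iota>H dH (map_matrix s A) ZH \<and>
    galois_group \<kappa>H \<iota>H dH ZH \<subseteq> galois_group \<kappa>G \<iota>G dG ZG"
proof -
  interpret G: diff_base_algebra dF BG \<delta>G dG \<iota>G by (rule G)
  interpret H: diff_base_algebra dK BH \<delta>H dH \<iota>H by (rule H)
  have A': "entries (map_matrix s A) \<subseteq> BH" using A s(1) by (auto simp: entries_def)
  have \<kappa>G': "ring_hom_on UNIV \<kappa>G" "\<kappa>G c \<in> BG" "dF (\<kappa>G c) = 0" "evG (\<kappa>G c) = c" for c
    using \<kappa>G by (auto simp: constants_embedding_def)
  have \<kappa>H': "ring_hom_on UNIV \<kappa>H" "\<kappa>H c \<in> BH" "dK (\<kappa>H c) = 0" "evH (\<kappa>H c) = c" for c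
    using \<kappa>H by (auto simp: constants_embedding_def)
  have surjG: "\<exists>b\<in>BG. evG b = c" and surjH: "\<exists>b\<in>BH. evH b = c" for c
    using \<kappa>G'(2,4) \<kappa>H'(2,4) by blast+
  obtain Z Z' :: "'r ^ 'n ^ 'n" and \<tau>G where Z: "Z ** Z' = mat 1" "Z' ** Z = mat 1"
    and dZ: "\<And>i j. dG (Z $ i $ j) = (\<Sum>k\<in>UNIV. \<iota>G (A $ i $ k) * Z $ k $ j)"
    and genG: "generated_subring (range \<iota>G \<union> (entries Z \<union> entries Z')) = UNIV"
    and \<tau>G: "ring_hom_on (generated_subring (\<iota>G ` BG \<union> (entries Z \<union> entries Z'))) \<tau>G"
      "\<And>u. \<tau>G (dG u) = fps_deriv (\<tau>G u)" "\<And>b. b \<in> BG \<Longrightarrow> \<tau>G (\<iota>G b) = taylor evG dF b"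
    using G.picard_vessiot_taylor[OF evG surjG A pvG] by blast
  obtain W W' :: "'s ^ 'n ^ 'n" and \<tau>H where W: "W ** W' = mat 1" "W' ** W = mat 1"
    and dW: "\<And>i j. dH (W $ i $ j) = (\<Sum>k\<in>UNIV. \<iota>H (map_matrix s A $ i $ k) * W $ k $ j)"
    and genH: "generated_subring (range \<iota>H \<union> (entries W \<union> entries W')) = UNIV"
    and \<tau>H: "ring_hom_on (generated_subring (\<iota>H ` BH \<union> (entries W \<union> entries W'))) \<tau>H"
      "\<And>u. \<tau>H (dH u) = fps_deriv (\<tau>H u)" "\<And>b. b \<in> BH \<Longrightarrow> \<tau>H (\<iota>H b) = taylor evH dK b"
    using H.picard_vessiot_taylor[OF evH surjH A' pvH] by blast
  have simpleG: "diff_simple dG" and simpleH: "diff_simple dH"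
    using pvG pvH by (auto simp: picard_vessiot_ring_def)
  define RG where "RG = generated_subring (\<iota>G ` BG \<union> (entries Z \<union> entries Z'))"
  define RH where "RH = generated_subring (\<iota>H ` BH \<union> (entries W \<union> entries W'))"
  have RG: "subring_on RG" and RH: "subring_on RH" unfolding RG_def RH_def by (rule subring_on_generated)+
  note homG = \<tau>G(1)[folded RG_def] and homH = \<tau>H(1)[folded RH_def]
  have inRG: "\<iota>G b \<in> RG" if "b \<in> BG" for b
    using that by (auto simp: RG_def intro: generated_subring.gen)
  have inRH: "\<iota>H b \<in> RH" if "b \<in> BH" for b
    using that by (auto simp: RH_def intro: generated_subring.gen)
  have ZR: "entries Z \<subseteq> RG" "entries Z' \<subseteq> RG" and WR: "entries W \<subseteq> RH" "entries W' \<subseteq> RH"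
    by (auto simp: RG_def RH_def intro: generated_subring.gen)

  \<comment> \<open>Constant matrices in both rings and in the power series\<close>
  define cG :: "'c ^ 'n ^ 'n \<Rightarrow> _ ^ 'n ^ 'n" where "cG = map_matrix (\<lambda>c. \<iota>G (\<kappa>G c))"
  define cH :: "'c ^ 'n ^ 'n \<Rightarrow> _ ^ 'n ^ 'n" where "cH = map_matrix (\<lambda>c. \<iota>H (\<kappa>H c))"
  define cS :: "'c ^ 'n ^ 'n \<Rightarrow> 'c fps ^ 'n ^ 'n" where "cS = map_matrix fps_const"
  have hG: "ring_hom_on UNIV (\<lambda>c. \<iota>G (\<kappa>G c))" and hH: "ring_hom_on UNIV (\<lambda>c. \<iota>H (\<kappa>H c))"
    and hS: "ring_hom_on UNIV (fps_const :: 'c \<Rightarrow> 'c fps)"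
    using \<kappa>G'(1) \<kappa>H'(1) by (auto simp: ring_hom_on_def G.\<iota>_simps H.\<iota>_simps)
  have U: "entries X \<subseteq> UNIV" for X :: "'x ^ 'n ^ 'n" by simp
  have cmult: "cG (M ** M') = cG M ** cG M'" "cH (M ** M') = cH M ** cH M'" "cS (M ** M') = cS M ** cS M'" for M M'
    unfolding cG_def cH_def cS_def
    by (rule map_matrix_mult_on[OF hG subring_on_UNIV] map_matrix_mult_on[OF hH subring_on_UNIV]
        map_matrix_mult_on[OF hS subring_on_UNIV]; simp)+
  have cone: "cG (mat 1) = mat 1" "cH (mat 1) = mat 1" "cS (mat 1) = mat 1"
    unfolding cG_def cH_def cS_def
    using map_matrix_one_on[OF hG subring_on_UNIV] map_matrix_one_on[OF hH subring_on_UNIV]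
      map_matrix_one_on[OF hS subring_on_UNIV] by auto
  have cR: "entries (cG M) \<subseteq> RG" "entries (cH M) \<subseteq> RH" for M
    using inRG \<kappa>G'(2) inRH \<kappa>H'(2) by (auto simp: cG_def cH_def entries_def)
  have \<tau>c: "map_matrix \<tau>G (cG M) = cS M" "map_matrix \<tau>H (cH M) = cS M" for M
    using \<kappa>G' \<kappa>H' derivationD(3)[OF G.dF] derivationD(3)[OF H.dF]
      ring_hom_onD(2)[OF evG G.B] ring_hom_onD(2)[OF evH H.B]
    by (simp_all add: vec_eq_iff cG_def cH_def cS_def \<tau>G(3) \<tau>H(3) taylor_const)
  have dc: "dG (cG M $ i $ j) = 0" "dH (cH M $ i $ j) = 0" for M i j
    using \<kappa>G'(3) \<kappa>H'(3) by (simp_all add: cG_def cH_def G.\<iota>_simps H.\<iota>_simps flip: G.\<iota>_simps(4) H.\<iota>_simps(4))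
  \<comment> \<open>The Taylor coefficients of \<open>b\<close> are values of its derivatives at the
    point, and \<open>s\<close> respects both derivations and points.\<close>
  have \<tau>s: "\<tau>G (\<iota>G b) = \<tau>H (\<iota>H (s b))" if b: "b \<in> BG" for b
  proof -
    have "(dF ^^ k) b \<in> BG \<and> s ((dF ^^ k) b) = (dK ^^ k) (s b)" for k
      using b s(2) G.dF_B by (induction k) auto
    then have "taylor evG dF b = taylor evH dK (s b)"
      by (intro fps_ext) (simp add: taylor_nth s(3))
    moreover have "s b \<in> BH" using b s(1) by blast
    ultimately show ?thesis using b by (simp add: \<tau>G(3) \<tau>H(3))
  qed
  have AB: "A $ i $ j \<in> BG" "s (A $ i $ j) \<in> BH" for i j using A s(1) by (auto simp: entries_def)

  \<comment> \<open>Matching the fundamental matrices over the power series\<close>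
  define S where "S = map_matrix (\<lambda>a. \<tau>G (\<iota>G a)) A"
  define Y where "Y = map_matrix \<tau>G Z"
  define Y' where "Y' = map_matrix \<tau>G Z'"
  have YY': "Y ** Y' = mat 1" "Y' ** Y = mat 1"
    unfolding Y_def Y'_def
    using map_matrix_mult_on[OF homG RG ZR] map_matrix_mult_on[OF homG RG ZR(2,1)] Z
      map_matrix_one_on[OF homG RG] by metis+
  define V where "V = map_matrix \<tau>H W"
  define V' where "V' = map_matrix \<tau>H W'"
  have VV': "V ** V' = mat 1" "V' ** V = mat 1"
    unfolding V_def V'_def
    using map_matrix_mult_on[OF homH RH WR] map_matrix_mult_on[OF homH RH WR(2,1)] W
      map_matrix_one_on[OF homH RH] by metis+
  define i0 :: "'c fps ^ 'n ^ 'n \<Rightarrow> 'c ^ 'n ^ 'n" where "i0 = map_matrix (\<lambda>f. fps_nth f 0)"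
  have h0: "ring_hom_on UNIV (\<lambda>f :: 'c fps. fps_nth f 0)" by (simp add: ring_hom_on_def)
  have i0mult: "i0 (X ** X') = i0 X ** i0 X'" for X X'
    unfolding i0_def by (rule map_matrix_mult_on[OF h0 subring_on_UNIV]; simp)
  have i0one: "i0 (mat 1) = mat 1" unfolding i0_def by (rule map_matrix_one_on[OF h0 subring_on_UNIV])
  \<comment> \<open>The constant change of basis that gives \<open>V ** cS N\<close> the same
    constant term as \<open>Y\<close>; it replaces \<open>W\<close> by \<open>X\<close>.\<close>
  define N where "N = i0 V' ** i0 Y"
  define N' where "N' = i0 Y' ** i0 V"
  have NN': "N ** N' = mat 1" "N' ** N = mat 1"
  proof -
    have "i0 Y ** i0 Y' = mat 1" "i0 Y' ** i0 Y = mat 1" "i0 V ** i0 V' = mat 1" "i0 V' ** i0 V = mat 1"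
      by (simp_all add: YY' VV' i0one flip: i0mult)
    then show "N ** N' = mat 1" "N' ** N = mat 1"
      unfolding N_def N'_def by (metis matrix_mul_assoc matrix_mul_rid)+
  qed
  define X where "X = W ** cH N"
  define X' where "X' = cH N' ** W'"
  have XX': "X ** X' = mat 1" "X' ** X = mat 1"
  proof -
    have "cH N ** cH N' = mat 1" "cH N' ** cH N = mat 1" by (simp_all add: NN' cone flip: cmult)
    then show "X ** X' = mat 1" "X' ** X = mat 1"
      unfolding X_def X'_def using W by (metis matrix_mul_assoc matrix_mul_rid)+
  qed
  have XR: "entries X \<subseteq> RH" "entries X' \<subseteq> RH"
    unfolding X_def X'_def by (intro entries_matrix_mult[OF RH] WR cR)+
  have dX: "dH (X $ i $ j) = (\<Sum>k\<in>UNIV. \<iota>H (map_matrix s A $ i $ k) * X $ k $ j)" for i j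
    unfolding X_def by (rule H.mult_constant_matrix[OF dW dc(2)])
  have \<tau>X: "map_matrix \<tau>H X = Y"
  proof (rule fps_linear_ode_unique)
    show "fps_deriv (Y $ i $ j) = (\<Sum>k\<in>UNIV. S $ i $ k * Y $ k $ j)" for i j
    proof -
      have "fps_deriv (Y $ i $ j) = \<tau>G (\<Sum>k\<in>UNIV. \<iota>G (A $ i $ k) * Z $ k $ j)"
        by (simp add: Y_def dZ flip: \<tau>G(2))
      also have "\<dots> = (\<Sum>k\<in>UNIV. S $ i $ k * Y $ k $ j)"
      proof -
        have "Z $ k $ j \<in> RG" "\<iota>G (A $ i $ k) \<in> RG" for k
          using ZR(1) inRG[OF AB(1)] by (auto simp: entries_def)
        then show ?thesis
          by (simp add: S_def Y_def ring_hom_on_sum[OF homG RG] ring_hom_onD(4)[OF homG RG] subring_onD(4)[OF RG])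
      qed
      finally show ?thesis .
    qed
    show "fps_deriv (map_matrix \<tau>H X $ i $ j) = (\<Sum>k\<in>UNIV. S $ i $ k * map_matrix \<tau>H X $ k $ j)" for i j
    proof -
      have "fps_deriv (map_matrix \<tau>H X $ i $ j) = \<tau>H (\<Sum>k\<in>UNIV. \<iota>H (s (A $ i $ k)) * X $ k $ j)"
        by (simp add: dX flip: \<tau>H(2))
      also have "\<dots> = (\<Sum>k\<in>UNIV. S $ i $ k * map_matrix \<tau>H X $ k $ j)"
      proof -
        have "X $ k $ j \<in> RH" "\<iota>H (s (A $ i $ k)) \<in> RH" for k
          using XR(1) inRH[OF AB(2)] by (auto simp: entries_def)
        then show ?thesis
          by (simp add: S_def \<tau>s[OF AB(1)] ring_hom_on_sum[OF homH RH] ring_hom_onD(4)[OF homH RH] subring_onD(4)[OF RH])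
      qed
      finally show ?thesis .
    qed
    have "map_matrix \<tau>H X = V ** cS N"
      unfolding X_def V_def by (simp add: map_matrix_mult_on[OF homH RH WR(1) cR(2)] \<tau>c)
    moreover have "i0 (cS N) = N" by (simp add: vec_eq_iff i0_def cS_def)
    ultimately have "i0 (map_matrix \<tau>H X) = i0 V ** N" by (simp add: i0mult)
    also have "\<dots> = i0 (V ** V') ** i0 Y" by (simp add: N_def i0mult matrix_mul_assoc)
    also have "\<dots> = i0 Y" by (simp add: VV' i0one)
    finally have "i0 (map_matrix \<tau>H X) $ i $ j = i0 Y $ i $ j" for i j by simp
    then show "fps_nth (map_matrix \<tau>H X $ i $ j) 0 = fps_nth (Y $ i $ j) 0" for i j by (simp add: i0_def)
  qed
  have \<tau>X': "map_matrix \<tau>H X' = Y'"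
  proof (rule matrix_inverse_unique)
    show "map_matrix \<tau>H X' ** Y = mat 1"
      using map_matrix_mult_on[OF homH RH XR(2,1)] XX'(2) map_matrix_one_on[OF homH RH] \<tau>X by metis
  qed (rule YY')
  \<comment> \<open>Allows equations between Taylor series to be pulled back to
    \<open>RH\<close>.\<close>
  have injH: "u = 0" if "u \<in> RH" "\<tau>H u = 0" for u
  proof (rule H.taylor_injective[OF \<delta>H simpleH RH_def _ genH homH _ that])
    have fin: "finite (entries W \<union> entries W')" by (simp add: finite_entries)
    show "dH ` RH \<subseteq> RH" unfolding RH_def
      by (rule H.dE_generated[OF H.B H.dF_B fin H.linear_generators[OF H.B A' dW H.dE_inverse_matrix[OF dW W]]])
  qed (rule \<tau>H(2))
  have "map_matrix dG Z = map_matrix \<iota>G A ** Z"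
    by (simp add: vec_eq_iff dZ matrix_matrix_mult_def)
  then have "fundamental_matrix \<iota>G dG A Z"
    unfolding fundamental_matrix_def invertible_def using Z by blast
  moreover have "map_matrix dH X = map_matrix \<iota>H (map_matrix s A) ** X"
    using dX by (simp add: vec_eq_iff matrix_matrix_mult_def)
  then have "fundamental_matrix \<iota>H dH (map_matrix s A) X"
    unfolding fundamental_matrix_def invertible_def using XX' by blast

  \<comment> \<open>Lifting an element of the specialized Galois group\<close>
  moreover have "M \<in> galois_group \<kappa>G \<iota>G dG Z" if M: "M \<in> galois_group \<kappa>H \<iota>H dH X" for M
  proof -
    obtain \<gamma> where \<gamma>: "\<gamma> \<in> diff_automorphisms \<iota>H dH" "map_matrix \<gamma> X = X ** cH M"
      using M by (auto simp: galois_group_def cH_def)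
    have inv: "invertible M" using M by (simp add: galois_group_def)
    then obtain M' where MM': "M ** M' = mat 1" "M' ** M = mat 1" by (auto simp: invertible_def)
    note hom\<gamma> = ring_hom_on_diff_automorphism(1)[OF \<gamma>(1)]
    have \<gamma>X': "map_matrix \<gamma> X' = cH M' ** X'"
    proof (rule matrix_inverse_unique)
      show "map_matrix \<gamma> X' ** (X ** cH M) = mat 1"
        using map_matrix_mult_on[OF hom\<gamma> subring_on_UNIV U U, of X' X] XX'(2)
          map_matrix_one_on[OF hom\<gamma> subring_on_UNIV] \<gamma>(2) by metis
      have "cH M ** cH M' = mat 1" by (simp add: MM' cone flip: cmult)
      then show "X ** cH M ** (cH M' ** X') = mat 1"
        using XX'(1) by (metis matrix_mul_assoc matrix_mul_rid)
    qed
    \<comment> \<open>The image that the desired automorphism must give to \<open>Z\<close>.\<close>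
    define Z1 where "Z1 = Z ** cG M"
    define Z1' where "Z1' = cG M' ** Z'"
    have cMM': "cG M ** cG M' = mat 1" "cG M' ** cG M = mat 1" by (simp_all add: MM' cone flip: cmult)
    have Z1Z1': "Z1 ** Z1' = mat 1" "Z1' ** Z1 = mat 1"
      unfolding Z1_def Z1'_def using Z cMM' by (metis matrix_mul_assoc matrix_mul_rid)+
    have dZ1: "dG (Z1 $ i $ j) = (\<Sum>k\<in>UNIV. \<iota>G (A $ i $ k) * Z1 $ k $ j)" for i j
      unfolding Z1_def by (rule G.mult_constant_matrix[OF dZ dc(1)])
    \<comment> \<open>The matrix with entries in the product ring whose coordinate matrices are
      \<open>Z\<close> at \<open>True\<close> and \<open>Z1\<close> at \<open>False\<close>;
      \<open>E'\<close> is its inverse.\<close>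
    define E :: "(bool \<Rightarrow> 'r) ^ 'n ^ 'n" where "E = (\<chi> i j. (\<lambda>b. if b then Z $ i $ j else Z1 $ i $ j))"
    define E' :: "(bool \<Rightarrow> 'r) ^ 'n ^ 'n" where "E' = (\<chi> i j. (\<lambda>b. if b then Z' $ i $ j else Z1' $ i $ j))"
    define dP where "dP u b = dG (u b)" for u and b :: bool
    define \<iota>P where "\<iota>P a b = \<iota>G a" for a and b :: bool
    \<comment> \<open>The product ring is a differential algebra over the same base, so the results
      on modules apply to it as well.\<close>
    interpret P: diff_base_algebra dF BG \<delta>G dP \<iota>P
      using G.product_algebra G.diff_base_axioms unfolding dP_def[abs_def] \<iota>P_def[abs_def]
      by (intro diff_base_algebra.intro)
    have EE': "E ** E' = mat 1" "E' ** E = mat 1"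
    proof -
      have 1: "(\<Sum>k\<in>UNIV. Z $ i $ k * Z' $ k $ j) = (if i = j then 1 else 0)"
        "(\<Sum>k\<in>UNIV. Z' $ i $ k * Z $ k $ j) = (if i = j then 1 else 0)"
        "(\<Sum>k\<in>UNIV. Z1 $ i $ k * Z1' $ k $ j) = (if i = j then 1 else 0)"
        "(\<Sum>k\<in>UNIV. Z1' $ i $ k * Z1 $ k $ j) = (if i = j then 1 else 0)" for i j
        using Z Z1Z1' by (simp_all add: vec_eq_iff matrix_matrix_mult_def mat_def)
      have "(E ** E') $ i $ j = mat 1 $ i $ j" "(E' ** E) $ i $ j = mat 1 $ i $ j" for i j
        by (rule ext; case_tac x; simp add: matrix_matrix_mult_def E_def E'_def mat_def sum_fun_apply 1)+
      then show "E ** E' = mat 1" "E' ** E = mat 1" by (simp_all add: vec_eq_iff)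
    qed
    have dE: "dP (E $ i $ j) = (\<Sum>k\<in>UNIV. \<iota>P (A $ i $ k) * E $ k $ j)" for i j
      by (rule ext, case_tac x) (simp_all add: E_def dP_def \<iota>P_def sum_fun_apply dZ dZ1)
    have lin: "dP x \<in> lincombs \<iota>P C (entries E \<union> entries E')"
      if "x \<in> entries E \<union> entries E'" "subring_on C" "entries A \<subseteq> C" for x C
      using P.linear_generators[OF that(2,3) dE P.dE_inverse_matrix[OF dE EE'] that(1)] .
    have finE: "finite (entries E \<union> entries E')" by (simp add: finite_entries)
    \<comment> \<open>The intended graph, over the field; \<open>\<Gamma>0\<close> is its
      counterpart over \<open>BG\<close>, on which the Taylor maps are homomorphisms.\<close>
    define \<Gamma> where "\<Gamma> = generated_subring (range \<iota>P \<union> (entries E \<union> entries E'))"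
    define \<Gamma>0 where "\<Gamma>0 = generated_subring (\<iota>P ` BG \<union> (entries E \<union> entries E'))"
    define e :: "bool \<Rightarrow> 'r" where "e = (\<lambda>b. if b then 1 else 0)"
    \<comment> \<open>Under the Taylor maps \<open>\<Gamma>0\<close> lands in the image of the graph
      of \<gamma>. The memberships in \<open>RG\<close> and \<open>RH\<close> are carried along
      because \<tau>G and \<tau>H are homomorphisms only there.\<close>
    have inv0: "u True \<in> RG \<and> u False \<in> RG \<and>
        (\<exists>v\<in>RH. \<gamma> v \<in> RH \<and> \<tau>G (u True) = \<tau>H v \<and> \<tau>G (u False) = \<tau>H (\<gamma> v))"
      if "u \<in> \<Gamma>0" for u
      using that unfolding \<Gamma>0_def
    proof induction
      case (gen u)
      have ent: "X $ i $ j \<in> RH" "(X ** cH M) $ i $ j \<in> RH" "X' $ i $ j \<in> RH" "(cH M' ** X') $ i $ j \<in> RH"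
        "Z $ i $ j \<in> RG" "Z1 $ i $ j \<in> RG" "Z' $ i $ j \<in> RG" "Z1' $ i $ j \<in> RG" for i j
        using XR ZR entries_matrix_mult[OF RH XR(1) cR(2)[of M]] entries_matrix_mult[OF RH cR(2)[of M'] XR(2)]
          entries_matrix_mult[OF RG ZR(1) cR(1)[of M]] entries_matrix_mult[OF RG cR(1)[of M'] ZR(2)]
        unfolding Z1_def Z1'_def entries_def by blast+
      have \<gamma>e: "\<gamma> (X $ i $ j) = (X ** cH M) $ i $ j" "\<gamma> (X' $ i $ j) = (cH M' ** X') $ i $ j" for i j
        by (simp_all flip: \<gamma>(2) \<gamma>X')
      have "map_matrix \<tau>G Z1 = map_matrix \<tau>H (X ** cH M)"
        unfolding Z1_def
        by (simp add: map_matrix_mult_on[OF homG RG ZR(1) cR(1)] map_matrix_mult_on[OF homH RH XR(1) cR(2)] \<tau>c \<tau>X)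
          (simp add: Y_def)
      moreover have "map_matrix \<tau>G Z1' = map_matrix \<tau>H (cH M' ** X')"
        unfolding Z1'_def
        by (simp add: map_matrix_mult_on[OF homG RG cR(1) ZR(2)] map_matrix_mult_on[OF homH RH cR(2) XR(2)] \<tau>c \<tau>X')
          (simp add: Y'_def)
      ultimately have \<tau>e: "\<tau>G (Z1 $ i $ j) = \<tau>H ((X ** cH M) $ i $ j)" "\<tau>G (Z1' $ i $ j) = \<tau>H ((cH M' ** X') $ i $ j)"
        "\<tau>G (Z $ i $ j) = \<tau>H (X $ i $ j)" "\<tau>G (Z' $ i $ j) = \<tau>H (X' $ i $ j)" for i j
        using \<tau>X \<tau>X' unfolding Y_def Y'_def vec_eq_iff nth_map_matrix by metis+
      from gen consider b where "b \<in> BG" "u = \<iota>P b" | i j where "u = E $ i $ j" | i j where "u = E' $ i $ j"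
        by (auto simp: entries_def)
      then show ?case
      proof cases
        case 1
        moreover have "s b \<in> BH" using 1 s(1) by blast
        ultimately show ?thesis
          using inRG inRH \<tau>s ring_hom_on_diff_automorphism(2)[OF \<gamma>(1)]
          by (auto simp: \<iota>P_def intro!: bexI[of _ "\<iota>H (s b)"])
      next
        case 2
        then show ?thesis using ent \<gamma>e \<tau>e by (auto simp: E_def intro!: bexI[of _ "X $ i $ j"])
      next
        case 3
        then show ?thesis using ent \<gamma>e \<tau>e by (auto simp: E'_def intro!: bexI[of _ "X' $ i $ j"])
      qed
    next
      case one
      show ?case
        using subring_onD(1)[OF RG] subring_onD(1)[OF RH] ring_hom_onD(1)[OF homG RG]
          ring_hom_onD(1)[OF homH RH] ring_hom_onD(1)[OF hom\<gamma> subring_on_UNIV]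
        by (auto intro!: bexI[of _ 1])
    next
      case (neg u)
      then obtain v where v: "v \<in> RH" "\<gamma> v \<in> RH" "\<tau>G (u True) = \<tau>H v" "\<tau>G (u False) = \<tau>H (\<gamma> v)" by blast
      have "\<tau>G ((- u) b) = - \<tau>G (u b)" for b
        using neg.IH by (cases b) (simp_all add: ring_hom_onD(5)[OF homG RG])
      then show ?case
        using neg.IH v subring_onD(2)[OF RG] subring_onD(2)[OF RH] ring_hom_onD(5)[OF homH RH]
          ring_hom_onD(5)[OF hom\<gamma> subring_on_UNIV]
        by (auto intro!: bexI[of _ "- v"])
    next
      case (add u u')
      then obtain v v' where v: "v \<in> RH" "\<gamma> v \<in> RH" "\<tau>G (u True) = \<tau>H v" "\<tau>G (u False) = \<tau>H (\<gamma> v)"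
        "v' \<in> RH" "\<gamma> v' \<in> RH" "\<tau>G (u' True) = \<tau>H v'" "\<tau>G (u' False) = \<tau>H (\<gamma> v')" by blast
      have "\<tau>G ((u + u') b) = \<tau>G (u b) + \<tau>G (u' b)" for b
        using add.IH by (cases b) (simp_all add: ring_hom_onD(3)[OF homG RG])
      then show ?case
        using add.IH v subring_onD(3)[OF RG] subring_onD(3)[OF RH] ring_hom_onD(3)[OF homH RH]
          ring_hom_onD(3)[OF hom\<gamma> subring_on_UNIV]
        by (auto intro!: bexI[of _ "v + v'"])
    next
      case (mult u u')
      then obtain v v' where v: "v \<in> RH" "\<gamma> v \<in> RH" "\<tau>G (u True) = \<tau>H v" "\<tau>G (u False) = \<tau>H (\<gamma> v)"
        "v' \<in> RH" "\<gamma> v' \<in> RH" "\<tau>G (u' True) = \<tau>H v'" "\<tau>G (u' False) = \<tau>H (\<gamma> v')" by blast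
      have "\<tau>G ((u * u') b) = \<tau>G (u b) * \<tau>G (u' b)" for b
        using mult.IH by (cases b) (simp_all add: ring_hom_onD(4)[OF homG RG])
      then show ?case
        using mult.IH v subring_onD(4)[OF RG] subring_onD(4)[OF RH] ring_hom_onD(4)[OF homH RH]
          ring_hom_onD(4)[OF hom\<gamma> subring_on_UNIV]
        by (auto intro!: bexI[of _ "v * v'"])
    qed
    \<comment> \<open>For \<open>e = (1, 0)\<close> injectivity of \<tau>H forces
      \<open>v = 1\<close> and so \<open>\<gamma> v = 1\<close>, while the second coordinate
      requires \<open>\<tau>H (\<gamma> v) = 0\<close>.\<close>
    have "e \<notin> \<Gamma>0"
    proof
      assume "e \<in> \<Gamma>0"
      from inv0[OF this] obtain v where v: "v \<in> RH" "\<tau>G 1 = \<tau>H v" "\<tau>G 0 = \<tau>H (\<gamma> v)" by (auto simp: e_def)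
      have "\<tau>H (v - 1) = 0"
        using v(1,2) subring_onD(1)[OF RH]
        by (simp add: ring_hom_onD(6)[OF homH RH] ring_hom_onD(1)[OF homG RG] ring_hom_onD(1)[OF homH RH] flip: v(2))
      then have "v - 1 = 0" using v(1) subring_onD(1)[OF RH] by (intro injH subring_onD(6)[OF RH])
      then have "\<gamma> v = 1" using ring_hom_onD(1)[OF hom\<gamma> subring_on_UNIV] by simp
      then show False
        using v(3) by (simp add: ring_hom_onD(2)[OF homG RG] ring_hom_onD(1)[OF homH RH])
    qed
    \<comment> \<open>The idempotent is constant and a nonzero multiple of it lies in
      \<open>\<Gamma>0\<close>, so \<open>constant_in_base\<close> would put \<open>e\<close> itself
      there.\<close>
    have "e \<notin> \<Gamma>"
    proof
      assume "e \<in> \<Gamma>"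
      then obtain p where p: "p \<in> BG" "p \<noteq> 0" "\<iota>P p * e \<in> \<Gamma>0"
        using P.clear_denominators[of e "entries E \<union> entries E'"] unfolding \<Gamma>_def \<Gamma>0_def by blast
      have "dP e = 0" by (auto simp: dP_def e_def derivationD[OF G.dE])
      then have "e \<in> \<Gamma>0"
        using P.constant_in_base[OF finE lin[OF _ G.B A] _ p(2) p(3)[unfolded \<Gamma>0_def] p(1)] unfolding \<Gamma>0_def by blast
      with \<open>e \<notin> \<Gamma>0\<close> show False ..
    qed

    \<comment> \<open>Projections of the subalgebra and the resulting automorphism\<close>
    have \<Gamma>: "subring_on \<Gamma>" unfolding \<Gamma>_def by (rule subring_on_generated)
    have proj: "subring_on ((\<lambda>u. u b) ` \<Gamma>)" for b
      unfolding subring_on_def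
    proof (intro conjI ballI)
      show "1 \<in> (\<lambda>u. u b) ` \<Gamma>" by (rule image_eqI[of _ _ 1]) (simp_all add: subring_onD(1)[OF \<Gamma>])
      fix x assume "x \<in> (\<lambda>u. u b) ` \<Gamma>"
      then obtain u where u: "x = u b" "u \<in> \<Gamma>" by blast
      show "- x \<in> (\<lambda>u. u b) ` \<Gamma>" by (rule image_eqI[of _ _ "- u"]) (simp_all add: u subring_onD(2)[OF \<Gamma>])
      fix y assume "y \<in> (\<lambda>u. u b) ` \<Gamma>"
      then obtain v where v: "y = v b" "v \<in> \<Gamma>" by blast
      show "x + y \<in> (\<lambda>u. u b) ` \<Gamma>" by (rule image_eqI[of _ _ "u + v"]) (simp_all add: u v subring_onD(3)[OF \<Gamma>])
      show "x * y \<in> (\<lambda>u. u b) ` \<Gamma>" by (rule image_eqI[of _ _ "u * v"]) (simp_all add: u v subring_onD(4)[OF \<Gamma>])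
    qed
    have \<iota>\<Gamma>: "\<iota>P a \<in> \<Gamma>" and E\<Gamma>: "E $ i $ j \<in> \<Gamma>" "E' $ i $ j \<in> \<Gamma>" for a i j
      unfolding \<Gamma>_def by (rule generated_subring.gen; auto simp: entries_def)+
    have \<iota>proj: "\<iota>G a \<in> (\<lambda>u. u b) ` \<Gamma>" for a b
      by (rule image_eqI[OF _ \<iota>\<Gamma>[of a]]) (simp add: \<iota>P_def)
    have projT: "entries Z \<subseteq> (\<lambda>u. u True) ` \<Gamma>" "entries Z' \<subseteq> (\<lambda>u. u True) ` \<Gamma>"
    proof -
      have "Z $ i $ j \<in> (\<lambda>u. u True) ` \<Gamma>" "Z' $ i $ j \<in> (\<lambda>u. u True) ` \<Gamma>" for i j
        by (rule image_eqI[OF _ E\<Gamma>(1)[of i j]], simp add: E_def)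
          (rule image_eqI[OF _ E\<Gamma>(2)[of i j]], simp add: E'_def)
      then show "entries Z \<subseteq> (\<lambda>u. u True) ` \<Gamma>" "entries Z' \<subseteq> (\<lambda>u. u True) ` \<Gamma>"
        unfolding entries_def by blast+
    qed
    \<comment> \<open>The second coordinates contain \<open>Z1\<close> and \<open>Z1'\<close>;
      multiplication by the constant matrices of \<open>M'\<close> and \<open>M\<close> recovers
      \<open>Z\<close> and \<open>Z'\<close>.\<close>
    have projF: "entries Z \<subseteq> (\<lambda>u. u False) ` \<Gamma>" "entries Z' \<subseteq> (\<lambda>u. u False) ` \<Gamma>"
    proof -
      have "Z1 $ i $ j \<in> (\<lambda>u. u False) ` \<Gamma>" "Z1' $ i $ j \<in> (\<lambda>u. u False) ` \<Gamma>" for i j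
        by (rule image_eqI[OF _ E\<Gamma>(1)[of i j]], simp add: E_def)
          (rule image_eqI[OF _ E\<Gamma>(2)[of i j]], simp add: E'_def)
      then have 1: "entries Z1 \<subseteq> (\<lambda>u. u False) ` \<Gamma>" "entries Z1' \<subseteq> (\<lambda>u. u False) ` \<Gamma>"
        unfolding entries_def by blast+
      have 2: "entries (cG M0) \<subseteq> (\<lambda>u. u False) ` \<Gamma>" for M0
        using \<iota>proj by (auto simp: entries_def cG_def)
      have "Z = Z1 ** cG M'" "Z' = cG M ** Z1'"
        unfolding Z1_def Z1'_def using cMM' by (metis matrix_mul_assoc matrix_mul_rid matrix_mul_lid)+
      then show "entries Z \<subseteq> (\<lambda>u. u False) ` \<Gamma>" "entries Z' \<subseteq> (\<lambda>u. u False) ` \<Gamma>"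
        using entries_matrix_mult[OF proj 1(1) 2] entries_matrix_mult[OF proj 2 1(2)] by metis+
    qed
    have "range \<iota>G \<union> (entries Z \<union> entries Z') \<subseteq> (\<lambda>u. u b) ` \<Gamma>" for b
      using \<iota>proj projT projF by (cases b) auto
    from generated_subring_minimal[OF proj this] have UN: "UNIV \<subseteq> (\<lambda>u. u b) ` \<Gamma>" for b
      unfolding genG .
    have surj: "\<exists>u\<in>\<Gamma>. u b = r" for b r
      using subsetD[OF UN UNIV_I, of r b] by auto
    \<comment> \<open>The coefficient ring is now the whole field, so the lemmas are used with
      \<open>UNIV\<close> in place of the base.\<close>
    have d\<Gamma>: "dP ` \<Gamma> \<subseteq> \<Gamma>"
      unfolding \<Gamma>_def using P.dE_generated[OF subring_on_UNIV _ finE lin[OF _ subring_on_UNIV]] by simp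
    have d\<Gamma>': "(\<lambda>b. dG (u b)) \<in> \<Gamma>" if "u \<in> \<Gamma>" for u
      using subsetD[OF d\<Gamma> imageI[OF that]] by (simp add: dP_def[abs_def])
    have "\<exists>\<gamma>\<in>diff_automorphisms \<iota>G dG. \<forall>u\<in>\<Gamma>. \<gamma> (u True) = u False"
      by (rule G.graph_of_automorphism[OF \<Gamma> d\<Gamma>' _ surj simpleG])
        (use \<iota>\<Gamma> \<open>e \<notin> \<Gamma>\<close> in \<open>simp_all add: \<iota>P_def[abs_def] e_def\<close>)
    then obtain \<gamma>' where \<gamma>': "\<gamma>' \<in> diff_automorphisms \<iota>G dG" "\<And>u. u \<in> \<Gamma> \<Longrightarrow> \<gamma>' (u True) = u False" by blast
    have "map_matrix \<gamma>' Z = Z1"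
      using \<gamma>'(2)[OF E\<Gamma>(1)] by (simp add: vec_eq_iff E_def)
    then show ?thesis using \<gamma>'(1) inv by (auto simp: galois_group_def Z1_def cG_def)
  qed
  ultimately show ?thesis by blast
qed

section \<open>Evaluation at a point avoiding the denominators\<close>

lemma multiplicative_set_mult_generated:
  fixes S :: "'a::idom set"
  assumes "0 \<notin> S"
  shows "multiplicative_set (mult_generated S)"
proof -
  have "x \<noteq> 0" if "x \<in> mult_generated S" for x
    using that by induction (use assms in auto)
  moreover have "x * y \<in> mult_generated S" if "x \<in> mult_generated S" "y \<in> mult_generated S" for x y
    using that by induction (auto simp: mult.assoc intro: mult_generated.mult)
  ultimately show ?thesis by (auto simp: multiplicative_set_def intro: mult_generated.one)
qed

text \<open>The value at a pole is unspecified.\<close>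

definition eval_fract :: "'c::field \<Rightarrow> 'c poly fract \<Rightarrow> 'c" where
  "eval_fract a x = (SOME c. \<exists>p q. x = Fract p q \<and> poly q a \<noteq> 0 \<and> c = poly p a / poly q a)"

lemma eval_fract_Fract:
  assumes "poly q a \<noteq> 0"
  shows "eval_fract a (Fract p q) = poly p a / poly q a"
  unfolding eval_fract_def
proof (rule some_equality)
  show "\<exists>p' q'. Fract p q = Fract p' q' \<and> poly q' a \<noteq> 0 \<and> poly p a / poly q a = poly p' a / poly q' a"
    using assms by blast
  fix c assume "\<exists>p' q'. Fract p q = Fract p' q' \<and> poly q' a \<noteq> 0 \<and> c = poly p' a / poly q' a"
  then obtain p' q' where *: "Fract p q = Fract p' q'" "poly q' a \<noteq> 0" "c = poly p' a / poly q' a" by blast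
  then have "p * q' = p' * q" using assms by (subst (asm) eq_fract) auto
  then have "poly p a * poly q' a = poly p' a * poly q a" by (metis poly_mult)
  then show "c = poly p a / poly q a" using * assms by (simp add: frac_eq_eq)
qed

lemma multiplicative_set_nonvanishing: "multiplicative_set {q. poly q (a :: 'a::idom) \<noteq> 0}"
  by (auto simp: multiplicative_set_def)

lemma ring_hom_on_eval_fract: "ring_hom_on (localization {q. poly q a \<noteq> 0}) (eval_fract a)"
  unfolding ring_hom_on_def
proof (intro conjI ballI)
  show "eval_fract a 1 = 1" using eval_fract_Fract[of 1 a 1] by (simp add: One_fract_def)
  fix x y assume "x \<in> localization {q. poly q a \<noteq> 0}" "y \<in> localization {q. poly q a \<noteq> 0}"
  then obtain p q p' q' where xy: "x = Fract p q" "y = Fract p' q'" "poly q a \<noteq> 0" "poly q' a \<noteq> 0"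
    by (auto simp: localization_def)
  then have q: "q \<noteq> 0" "q' \<noteq> 0" by auto
  show "eval_fract a (x + y) = eval_fract a x + eval_fract a y"
    using xy q by (simp add: eval_fract_Fract add_frac_eq)
  show "eval_fract a (x * y) = eval_fract a x * eval_fract a y"
    using xy by (simp add: eval_fract_Fract)
qed

theorem theorem0p1:
  fixes S :: "('l::finite, 'c::{alg_closed_field, field_char_0}) dpoly set"
    and A :: "('l, 'c) dpoly fract ^ 'n::finite ^ 'n"
    and \<sigma> :: "('l, 'c) dpoly \<Rightarrow> 'c poly"
    and \<sigma>' :: "('l, 'c) dpoly fract \<Rightarrow> 'c poly fract"
    and \<iota>\<^sub>G :: "('l, 'c) dpoly fract \<Rightarrow> 'r::comm_ring_1" and d\<^sub>G :: "'r \<Rightarrow> 'r"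
    and \<iota>\<^sub>H :: "'c poly fract \<Rightarrow> 's::comm_ring_1" and d\<^sub>H :: "'s \<Rightarrow> 's"
  defines "R\<^sub>1 \<equiv> localization (mult_generated S)"
    and "R\<^sub>2 \<equiv> localization (\<sigma> ` mult_generated S)"
  assumes "finite S" and "0 \<notin> S"
    and "entries A \<subseteq> R\<^sub>1"
    and "diff_ring_hom_on UNIV dpoly_deriv pderiv \<sigma>" and "\<forall>c. \<sigma> (dpoly_const c) = [:c:]"
    and "diff_ring_hom_on R\<^sub>1 (fract_deriv dpoly_deriv) (fract_deriv pderiv) \<sigma>'"
    and "\<sigma>' ` R\<^sub>1 \<subseteq> R\<^sub>2" and "\<forall>p. \<sigma>' (to_fract p) = to_fract (\<sigma> p)"
    and "picard_vessiot_ring (fract_deriv dpoly_deriv) \<iota>\<^sub>G d\<^sub>G A"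
    and "picard_vessiot_ring (fract_deriv pderiv) \<iota>\<^sub>H d\<^sub>H (map_matrix \<sigma>' A)"
  shows "\<exists>Z\<^sub>G Z\<^sub>H.
    fundamental_matrix \<iota>\<^sub>G d\<^sub>G A Z\<^sub>G \<and>
    fundamental_matrix \<iota>\<^sub>H d\<^sub>H (map_matrix \<sigma>' A) Z\<^sub>H \<and>
    galois_group (\<lambda>c. to_fract [:c:]) \<iota>\<^sub>H d\<^sub>H Z\<^sub>H \<subseteq>
    galois_group (\<lambda>c. to_fract (dpoly_const c)) \<iota>\<^sub>G d\<^sub>G Z\<^sub>G"
proof -
  note R\<^sub>1 = assms(1) and R\<^sub>2 = assms(2) and fin = assms(3) and S0 = assms(4) and A = assms(5)
    and \<sigma> = assms(6) and \<sigma>c = assms(7) and \<sigma>' = assms(8) and \<sigma>'R = assms(9) and \<sigma>'\<sigma> = assms(10)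
    and pvG = assms(11) and pvH = assms(12)
  let ?M = "mult_generated S"
  have M: "multiplicative_set ?M" by (rule multiplicative_set_mult_generated[OF S0])
  have R1s: "subring_on R\<^sub>1" unfolding R\<^sub>1 by (rule subring_on_localization[OF M])
  have hom\<sigma>: "ring_hom_on UNIV \<sigma>" and hom\<sigma>': "ring_hom_on R\<^sub>1 \<sigma>'"
    using \<sigma> \<sigma>' by (auto simp: diff_ring_hom_on_def ring_hom_on_def)
  \<comment> \<open>Since \<open>m\<close> is invertible in \<open>R\<^sub>1\<close>, its image
    under \<open>\<sigma>'\<close> is a unit.\<close>
  have nz: "\<sigma> m \<noteq> 0" if m: "m \<in> ?M" for m
  proof
    assume 0: "\<sigma> m = 0"
    have m0: "m \<noteq> 0" using multiplicative_setD(2)[OF M m] .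
    have inR: "Fract 1 m \<in> R\<^sub>1" "to_fract m \<in> R\<^sub>1"
      unfolding R\<^sub>1 using m by (auto intro: localizationI to_fract_in_localization[OF M])
    have "to_fract m * Fract 1 m = 1" using m0 by (simp add: to_fract_def One_fract_def eq_fract)
    then have "1 = \<sigma>' (to_fract m * Fract 1 m)" by (simp add: ring_hom_onD(1)[OF hom\<sigma>' R1s])
    also have "\<dots> = 0" using inR 0 \<sigma>'\<sigma> by (simp add: ring_hom_onD(4)[OF hom\<sigma>' R1s])
    finally show False by simp
  qed
  \<comment> \<open>A non-root \<open>a\<close> of this product is a common non-root of all
    specialized generators, hence of all specialized denominators.\<close>
  have "(\<Prod>m\<in>S. \<sigma> m) \<noteq> 0"
    using nz fin mult_generated.mult[OF _ mult_generated.one, of _ S] by auto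
  then have "finite {a. poly (\<Prod>m\<in>S. \<sigma> m) a = 0}" by (rule poly_roots_finite)
  then obtain a where "poly (\<Prod>m\<in>S. \<sigma> m) a \<noteq> 0"
    using infinite_UNIV_char_0[where 'a='c] by (metis (mono_tags, lifting) ex_new_if_finite mem_Collect_eq)
  then have aS: "poly (\<sigma> m) a \<noteq> 0" if "m \<in> S" for m using that fin by (auto simp: poly_prod)
  have aM: "poly (\<sigma> m) a \<noteq> 0" if "m \<in> ?M" for m
    using that
    by induction (use aS in \<open>auto simp: ring_hom_onD[OF hom\<sigma> subring_on_UNIV]\<close>)
  \<comment> \<open>The local ring at \<open>a\<close> serves as base over C(z): it contains the
    image of \<open>R\<^sub>1\<close>, and evaluation at \<open>a\<close> is a homomorphism on it.
    The point of \<open>R\<^sub>1\<close> is this evaluation after \<open>\<sigma>'\<close>.\<close>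
  let ?L = "localization {q. poly q a \<noteq> 0}"
  note L = multiplicative_set_nonvanishing[of a]
  have \<sigma>'L: "\<sigma>' x \<in> ?L" if "x \<in> R\<^sub>1" for x
  proof -
    have "\<sigma>' x \<in> localization (\<sigma> ` ?M)" using that \<sigma>'R unfolding R\<^sub>2 by blast
    then obtain p m where "\<sigma>' x = Fract p (\<sigma> m)" "m \<in> ?M" by (auto simp: localization_def)
    with aM show ?thesis by (auto intro: localizationI)
  qed
  have pv: "diff_algebra (fract_deriv dpoly_deriv) d\<^sub>G \<iota>\<^sub>G" "diff_algebra (fract_deriv pderiv) d\<^sub>H \<iota>\<^sub>H"
    using pvG pvH by (auto simp: picard_vessiot_ring_def diff_algebra_def derivation_fract_deriv
        derivation_dpoly_deriv derivation_pderiv)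
  show ?thesis
  proof (rule galois_group_specialization)
    show "diff_base_algebra (fract_deriv dpoly_deriv) R\<^sub>1 (\<lambda>i j. fract_deriv (dpoly_partial (Dvar i j))) d\<^sub>G \<iota>\<^sub>G"
      unfolding R\<^sub>1 by (intro diff_base_algebra.intro diff_base_dpoly M pv)
    show "diff_base_algebra (fract_deriv pderiv) ?L (\<lambda>(i::unit) j. fract_deriv (\<lambda>_. 0)) d\<^sub>H \<iota>\<^sub>H"
      by (intro diff_base_algebra.intro diff_base_poly L pv)
    show "fract_deriv (\<lambda>_. 0) x = 0" for x :: "'c poly fract"
    proof -
      have "derivation (\<lambda>_::'c poly. 0 :: 'c poly)" by (simp add: derivation_def)
      then show ?thesis by (cases x) (simp add: fract_deriv_Fract fract_collapse)
    qed
    show evH: "ring_hom_on ?L (eval_fract a)" by (rule ring_hom_on_eval_fract)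
    show "ring_hom_on R\<^sub>1 (\<lambda>x. eval_fract a (\<sigma>' x))"
      using hom\<sigma>' evH \<sigma>'L by (auto simp: ring_hom_on_def)
    have ev: "eval_fract a (to_fract [:c:]) = c" for c
      using eval_fract_Fract[of 1 a "[:c:]"] by (simp add: to_fract_def)
    show "constants_embedding (\<lambda>c. to_fract (dpoly_const c)) (fract_deriv dpoly_deriv) R\<^sub>1 (\<lambda>x. eval_fract a (\<sigma>' x))"
      unfolding constants_embedding_def R\<^sub>1
    proof (intro conjI allI)
      show "ring_hom_on UNIV (\<lambda>c. to_fract (dpoly_const c :: ('l, 'c) dpoly))"
        by (simp add: ring_hom_on_def dpoly_const_def single_add mult_single
            flip: to_fract_add to_fract_mult)
    qed (use \<sigma>'\<sigma> \<sigma>c in \<open>simp_all add: ev to_fract_in_localization[OF M] dpoly_deriv_const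
        fract_deriv_to_fract[OF derivation_dpoly_deriv]\<close>)
    show "constants_embedding (\<lambda>c. to_fract [:c:]) (fract_deriv pderiv) ?L (eval_fract a)"
      unfolding constants_embedding_def ring_hom_on_def
      by (auto simp: ev to_fract_in_localization[OF L] fract_deriv_to_fract[OF derivation_pderiv]
          simp flip: to_fract_add to_fract_mult one_pCons)
    show "\<sigma>' ` R\<^sub>1 \<subseteq> ?L" using \<sigma>'L by blast
    show "\<sigma>' (fract_deriv dpoly_deriv x) = fract_deriv pderiv (\<sigma>' x)" if "x \<in> R\<^sub>1" for x
      using \<sigma>' that by (simp add: diff_ring_hom_on_def)
  qed (simp_all add: A pvG pvH)
qed

end
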